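(* In the setting described in the context (unregularized optimal transport with quadratic cost on a convex polytope $X$, with composite cells $(X_J)_{J\in\mathcal{J}}$ that are convex polytopes, cover $X$, and satisfy the boundary covering assumption), for every initialization $\pi^0\in\Pi(\mu,\nu)$ the iterates $(\pi^k)_k$ of the domain decomposition algorithm converge (weak* ) to the unique global minimizer of $$\inf\Big\{\int_{X\times Y}\|x-y\|^2\,d\pi(x,y)\ \Big|\ \pi\in\Pi(\mu,\nu)\Big\}.$$
   Context: $X\subset\mathbb{R}^d$ is a compact, convex polytope, $Y\subset\mathbb{R}^d$ is bounded, $\mu$ is a probability measure on $X$ with $\mu\ll\mathcal{L}$ (Lebesgue measure) and $\frac{d\mu}{d\mathcal{L}}>0$ $\mathcal{L}$-a.e. on $X$, $\nu$ is a probability measure on $Y$, $c(x,y)=\|x-y\|^2$. $\Pi(\alpha,\beta)$ is the set of non-negative measures on $X\times Y$ with marginals $\alpha$ and $\beta$; $\rho|_A$ is the restriction of a measure $\rho$ to $A$; $P_Y$ is the $Y$-marginal. Basic cells: $(X_i)_{i\in I}$ is a finite covering of $X$ by closed convex polytopes contained in $X$ with non-empty interior, with pairwise disjoint interiors. Composite cells: $\mathcal{J}=\{J_1,\dots,J_K\}$ is a finite collection of subsets $J_k\subset I$, such that each $X_J=\bigcup_{i\in J}X_i$, $J\in\mathcal{J}$, is a convex polytope, and $(X_J)_{J\in\mathcal{J}}$ covers $X$. Two composite cells $J,\hat J$ are neighbors if $X_J\cap X_{\hat J}$ has non-empty interior; $J,J'$ are adjacent if $X_J\cap X_{J'}$ is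 non-empty but has empty interior. Boundary covering assumption: for all adjacent $J,J'\in\mathcal{J}$ and every $x\in X_J\cap X_{J'}$ there exists $\hat J\in\mathcal{J}$ neighboring both $J$ and $J'$ with $x\in X_{\hat J}$. Domain decomposition algorithm: extend the enumeration cyclically by $J_k:=J_{((k-1)\bmod K)+1}$ for $k>K$. Given $\pi^0\in\Pi(\mu,\nu)$, for $k\ge1$ let $\mu_{J_k}=\mu|_{X_{J_k}}$, $\nu^k_{J_k}=P_Y(\pi^{k-1}|_{X_{J_k}\times Y})$, let $\pi_{J_k}$ be the (unique, since $\mu_{J_k}\ll\mathcal{L}$) minimizer of $\int c\,d\hat\pi$ over $\hat\pi\in\Pi(\mu_{J_k},\nu^k_{J_k})$, and set $\pi^k=\pi_{J_k}+\pi^{k-1}|_{(X\setminus X_{J_k})\times Y}$. *)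

theory Defs
  imports "HOL-Probability.Probability"
begin

text \<open>
  A measure on a subset \<open>S\<close> of Euclidean space is a measure on the trace Borel
  sigma-algebra \<open>restrict_space borel S\<close>, so its space is \<open>S\<close> itself. The set \<open>Y\<close>
  therefore need not be a Borel set.
\<close>

definition measure_on :: "'b::topological_space set \<Rightarrow> 'b measure \<Rightarrow> bool" where
  "measure_on S M \<longleftrightarrow> sets M = sets (restrict_space borel S)"

text \<open>The restriction of a measure to \<open>A\<close>, still a measure on the same space.\<close>

definition restrict_meas :: "'b measure \<Rightarrow> 'b set \<Rightarrow> 'b measure" where
  "restrict_meas M A = density M (indicator A)"

text \<open>The sum is meant for measures with a common sigma-algebra.\<close>

definition measure_add :: "'b measure \<Rightarrow> 'b measure \<Rightarrow> 'b measure" where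
  "measure_add M N = measure_of (space M) (sets M) (\<lambda>A. emeasure M A + emeasure N A)"

lemma emeasure_measure_add:
  assumes "sets M = sets N" "A \<in> sets M"
  shows "emeasure (measure_add M N) A = emeasure M A + emeasure N A"
proof -
  have "countably_additive (sets M) (\<lambda>A. emeasure M A + emeasure N A)"
    unfolding countably_additive_def using assms(1)
    by (auto simp: suminf_emeasure suminf_add[symmetric])
  then show ?thesis
    unfolding measure_add_def using assms(2)
    by (intro emeasure_measure_of_sigma)
       (auto simp: sets.sigma_algebra_axioms positive_def)
qed

definition fst_marginal ::
    "'a::topological_space set \<Rightarrow> ('a \<times> 'b) measure \<Rightarrow> 'a measure" where
  "fst_marginal X \<pi> = distr \<pi> (restrict_space borel X) fst"

definition snd_marginal ::
    "'b::topological_space set \<Rightarrow> ('a \<times> 'b) measure \<Rightarrow> 'b measure" where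
  "snd_marginal Y \<pi> = distr \<pi> (restrict_space borel Y) snd"

text \<open>The total masses of the marginals are not normalised: the subproblems of the
  algorithm transport sub-probability measures.\<close>

definition couplings ::
    "'a::topological_space set \<Rightarrow> 'b::topological_space set \<Rightarrow>
      'a measure \<Rightarrow> 'b measure \<Rightarrow> ('a \<times> 'b) measure set" where
  "couplings X Y \<alpha> \<beta> =
    {\<pi>. measure_on (X \<times> Y) \<pi> \<and> fst_marginal X \<pi> = \<alpha> \<and> snd_marginal Y \<pi> = \<beta>}"

definition transport_cost :: "('a::euclidean_space \<times> 'a) measure \<Rightarrow> ennreal" where
  "transport_cost \<pi> = (\<integral>\<^sup>+(x, y). ennreal ((norm (x - y))\<^sup>2) \<partial>\<pi>)"

definition optimal_plan ::
    "'a::euclidean_space set \<Rightarrow> 'a set \<Rightarrow> 'a measure \<Rightarrow> 'a measure \<Rightarrow>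
      ('a \<times> 'a) measure \<Rightarrow> bool" where
  "optimal_plan X Y \<alpha> \<beta> \<pi> \<longleftrightarrow>
    is_arg_min transport_cost (\<lambda>\<rho>. \<rho> \<in> couplings X Y \<alpha> \<beta>) \<pi>"

definition composite_cell :: "('i \<Rightarrow> 'a set) \<Rightarrow> 'i set \<Rightarrow> 'a set" where
  "composite_cell Xc J = (\<Union>i\<in>J. Xc i)"

definition neighbors :: "'a::topological_space set \<Rightarrow> 'a set \<Rightarrow> bool" where
  "neighbors A B \<longleftrightarrow> interior (A \<inter> B) \<noteq> {}"

definition adjacent :: "'a::topological_space set \<Rightarrow> 'a set \<Rightarrow> bool" where
  "adjacent A B \<longleftrightarrow> A \<inter> B \<noteq> {} \<and> interior (A \<inter> B) = {}"

definition boundary_covering :: "'a::topological_space set set \<Rightarrow> bool" where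
  "boundary_covering \<C> \<longleftrightarrow>
    (\<forall>A\<in>\<C>. \<forall>B\<in>\<C>. adjacent A B \<longrightarrow>
      (\<forall>x\<in>A \<inter> B. \<exists>C\<in>\<C>. neighbors C A \<and> neighbors C B \<and> x \<in> C))"

definition domdec_step ::
    "'a::euclidean_space set \<Rightarrow> 'a set \<Rightarrow> 'a measure \<Rightarrow> 'a set \<Rightarrow>
      ('a \<times> 'a) measure \<Rightarrow> ('a \<times> 'a) measure" where
  "domdec_step X Y \<mu> A \<pi> =
    (let \<mu>\<^sub>A = restrict_meas \<mu> A;
         \<nu>\<^sub>A = snd_marginal Y (restrict_meas \<pi> (A \<times> Y));
         \<pi>\<^sub>A = (THE \<rho>. optimal_plan X Y \<mu>\<^sub>A \<nu>\<^sub>A \<rho>)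
     in measure_add \<pi>\<^sub>A (restrict_meas \<pi> ((X - A) \<times> Y)))"

text \<open>The cells are \<open>A 1, \<dots>, A K\<close>; iterate \<open>k \<ge> 1\<close> uses cell \<open>((k - 1) mod K) + 1\<close>.\<close>

primrec domdec_iterate ::
    "'a::euclidean_space set \<Rightarrow> 'a set \<Rightarrow> 'a measure \<Rightarrow> nat \<Rightarrow> (nat \<Rightarrow> 'a set) \<Rightarrow>
      ('a \<times> 'a) measure \<Rightarrow> nat \<Rightarrow> ('a \<times> 'a) measure" where
  "domdec_iterate X Y \<mu> K A \<pi>0 0 = \<pi>0"
| "domdec_iterate X Y \<mu> K A \<pi>0 (Suc k) =
    domdec_step X Y \<mu> (A (k mod K + 1)) (domdec_iterate X Y \<mu> K A \<pi>0 k)"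

text \<open>Test functions are all bounded continuous functions on \<open>S\<close>; for compact \<open>S\<close> this is
  convergence in the dual of \<open>C(S)\<close>, and in general it implies convergence against the
  continuous functions vanishing at infinity.\<close>

definition weak_star_tendsto ::
    "'b::topological_space set \<Rightarrow> (nat \<Rightarrow> 'b measure) \<Rightarrow> 'b measure \<Rightarrow> bool" where
  "weak_star_tendsto S \<pi>s \<pi> \<longleftrightarrow>
    (\<forall>f :: 'b \<Rightarrow> real. continuous_on S f \<and> bounded (f ` S) \<longrightarrow>
      (\<lambda>n. \<integral>z. f z \<partial>\<pi>s n) \<longlonglongrightarrow> (\<integral>z. f z \<partial>\<pi>))"

end

theory Submission
  imports Defs "HOL-Complex_Analysis.Great_Picard"
begin

text \<open>
  Minimising \<open>\<integral> |x - y|\<^sup>2\<close> over plans with fixed marginals amounts to maximising the correlation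
  \<open>\<integral> x \<bullet> y\<close>. If the first marginal is absolutely continuous, the maximiser is concentrated on the graph of
  the gradient of a convex function \<open>\<phi>\<close>, a Legendre transform of some \<open>f\<close>, and the deficit of any other plan
  is the integral of the duality gap \<open>\<phi> x + f y - x \<bullet> y \<ge> 0\<close> (\<open>brenier_map\<close>, \<open>plan_unique\<close>). So every
  cell problem has exactly one solution, given by a gradient, and from iteration \<open>K\<close> on the iterate is the
  image of \<open>\<mu>\<close> under \<open>x \<mapsto> (x, T k x)\<close> for a map \<open>T k\<close> that is piecewise such a gradient
  (\<open>iterates_are_maps\<close>).
  
  The correlation of the iterates increases and is bounded, and its increment in a step is the integral over
  the cell of the duality gap between the old map and the new potential (\<open>correlation_increment\<close>). Hence these
  gaps tend to zero. The potentials are equi-Lipschitz, so by Arzela-Ascoli they converge uniformly along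
  subsequences, and gradients of convex functions then converge almost everywhere. A subsequence of the maps
  thus converges almost everywhere to a map \<open>S\<close> whose gap vanishes on every cell: on each composite cell, \<open>S\<close>
  is the gradient of a convex function (\<open>sweep_limit\<close>).
  
  It remains to see that such an \<open>S\<close> is globally optimal. On the overlap of neighbouring cells the two
  gradients agree, so the potentials differ by a constant (\<open>equal_gradients_const\<close>); the boundary covering
  assumption extends this to adjacent cells (\<open>meet_const\<close>). As the union of the cells is convex, the constants
  can be chosen consistently, and the potentials glue to one function \<open>\<Phi>\<close> (\<open>glue\<close>). This function is convex:
  by the boundary covering assumption, an interior point of \<open>X\<close> that is interior to no cell lies on two
  transversal facet hyperplanes (\<open>two_facets_at_uncovered_point\<close>), and a generic segment avoids such points, so
  that \<open>\<Phi>\<close> is locally convex along it (\<open>glue_convex\<close>). Now \<open>\<Phi>\<close> and its conjugate certify that the plan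
  carried by \<open>S\<close> is optimal (\<open>global_potential_certifies\<close>). The optimal plan is unique, so it is the only
  limit point of the iterates.
  
  The set \<open>Y\<close> need not be measurable. All measures are therefore pushed forward to the whole space
  (\<open>ambient\<close>), where the argument takes place; existence of plans and convergence are transferred back to
  \<open>X \<times> Y\<close> at the end (\<open>trace_measure_exists\<close>, \<open>weak_star_trace\<close>).
\<close>

section \<open>Legendre transforms over a ball\<close>

text \<open>
  The supremum runs over a fixed ball that contains both \<open>X\<close> and \<open>Y\<close>. This makes the transform finite and
  \<open>R\<close>-Lipschitz on the whole space, whatever the continuous function \<open>f\<close>.
\<close>

definition legendre :: "real \<Rightarrow> ('a::euclidean_space \<Rightarrow> real) \<Rightarrow> 'a \<Rightarrow> real" where
  "legendre R f x = (SUP y\<in>cball 0 R. x \<bullet> y - f y)"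

definition subgradient :: "('a::euclidean_space \<Rightarrow> real) \<Rightarrow> 'a \<Rightarrow> 'a \<Rightarrow> bool" where
  "subgradient f x p \<longleftrightarrow> (\<forall>z. f x + p \<bullet> (z - x) \<le> f z)"

definition right_slope :: "('a::euclidean_space \<Rightarrow> real) \<Rightarrow> 'a \<Rightarrow> 'a \<Rightarrow> nat \<Rightarrow> real" where
  "right_slope f b x n = real (Suc n) * (f (x + b /\<^sub>R real (Suc n)) - f x)"

text \<open>
  The gradient of a convex function wherever it is differentiable. Taking limits of right difference
  quotients gives a function that is Borel measurable everywhere.
\<close>

definition grad :: "('a::euclidean_space \<Rightarrow> real) \<Rightarrow> 'a \<Rightarrow> 'a" where
  "grad f x = (\<Sum>b\<in>Basis. lim (right_slope f b x) *\<^sub>R b)"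

lemma legendre_attained:
  fixes f :: "'a::euclidean_space \<Rightarrow> real"
  assumes "0 \<le> R" "continuous_on UNIV f"
  obtains y where "y \<in> cball 0 R" "legendre R f x = x \<bullet> y - f y"
    "\<And>z. z \<in> cball 0 R \<Longrightarrow> x \<bullet> z - f z \<le> x \<bullet> y - f y"
proof -
  have "continuous_on (cball 0 R) (\<lambda>y. x \<bullet> y - f y)"
    by (intro continuous_intros continuous_on_subset[OF assms(2)]) auto
  then obtain y where y: "y \<in> cball 0 R" "\<And>z. z \<in> cball 0 R \<Longrightarrow> x \<bullet> z - f z \<le> x \<bullet> y - f y"
    using continuous_attains_sup[OF compact_cball, of 0 R "\<lambda>y. x \<bullet> y - f y"] assms(1) by auto
  moreover have "legendre R f x = x \<bullet> y - f y"
    unfolding legendre_def using y by (intro cSup_eq_maximum) auto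
  ultimately show ?thesis using that by blast
qed

lemma fenchel_young:
  fixes f :: "'a::euclidean_space \<Rightarrow> real"
  assumes "0 \<le> R" "continuous_on UNIV f" "y \<in> cball 0 R"
  shows "x \<bullet> y \<le> legendre R f x + f y"
  using legendre_attained[OF assms(1,2), of x] assms(3) by (smt (verit))

lemma subgradient_legendre:
  fixes f :: "'a::euclidean_space \<Rightarrow> real"
  assumes "0 \<le> R" "continuous_on UNIV f" "y \<in> cball 0 R" "legendre R f x + f y = x \<bullet> y"
  shows "subgradient (legendre R f) x y"
  unfolding subgradient_def
proof
  fix z
  have "z \<bullet> y \<le> legendre R f z + f y" by (rule fenchel_young[OF assms(1-3)])
  then show "legendre R f x + y \<bullet> (z - x) \<le> legendre R f z"
    using assms(4) by (simp add: inner_diff_right inner_commute)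
qed

text \<open>
  A maximiser in the Legendre transform is a subgradient; since it lies in the ball, it is bounded by \<open>R\<close>.
\<close>

lemma legendre_has_subgradient:
  fixes f :: "'a::euclidean_space \<Rightarrow> real"
  assumes "0 \<le> R" "continuous_on UNIV f"
  obtains y where "y \<in> cball 0 R" "legendre R f x + f y = x \<bullet> y" "subgradient (legendre R f) x y"
  using legendre_attained[OF assms, of x] subgradient_legendre[OF assms]
  by (metis add.commute diff_add_cancel)

lemma legendre_lipschitz:
  fixes f :: "'a::euclidean_space \<Rightarrow> real"
  assumes "0 \<le> R" "continuous_on UNIV f"
  shows "R-lipschitz_on UNIV (legendre R f)"
proof (rule lipschitz_onI)
  have *: "legendre R f x - legendre R f z \<le> R * dist x z" for x z
  proof -
    obtain p where p: "p \<in> cball 0 R" "subgradient (legendre R f) x p"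
      using legendre_has_subgradient[OF assms] by blast
    then have "legendre R f x - legendre R f z \<le> p \<bullet> (x - z)"
      unfolding subgradient_def by (smt (verit) inner_diff_right)
    also have "\<dots> \<le> norm p * norm (x - z)" by (rule norm_cauchy_schwarz)
    also have "\<dots> \<le> R * dist x z"
      using p(1) by (auto simp: dist_norm intro!: mult_right_mono)
    finally show ?thesis .
  qed
  show "dist (legendre R f x) (legendre R f z) \<le> R * dist x z" for x z
    using *[of x z] *[of z x] by (auto simp: dist_real_def dist_commute)
qed (use assms in auto)

lemma continuous_on_legendre:
  fixes f :: "'a::euclidean_space \<Rightarrow> real"
  assumes "0 \<le> R" "continuous_on UNIV f"
  shows "continuous_on UNIV (legendre R f)"
  using legendre_lipschitz[OF assms] lipschitz_on_continuous_on by blast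

lemma legendre_diff_le:
  fixes f g :: "'a::euclidean_space \<Rightarrow> real"
  assumes "0 \<le> R" "continuous_on UNIV f" "continuous_on UNIV g"
    and "\<And>y. y \<in> cball 0 R \<Longrightarrow> g y \<le> f y + e"
  shows "legendre R f x \<le> legendre R g x + e"
proof -
  obtain y where y: "y \<in> cball 0 R" "legendre R f x + f y = x \<bullet> y"
    using legendre_has_subgradient[OF assms(1,2)] by metis
  then show ?thesis
    using fenchel_young[OF assms(1,3) y(1), of x] assms(4)[OF y(1)] by linarith
qed

lemma convex_on_legendre:
  fixes f :: "'a::euclidean_space \<Rightarrow> real"
  assumes "0 \<le> R" "continuous_on UNIV f"
  shows "convex_on UNIV (legendre R f)"
proof (rule convex_onI)
  fix t :: real and x y :: 'a
  assume t: "0 < t" "t < 1"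
  define z where "z = (1 - t) *\<^sub>R x + t *\<^sub>R y"
  obtain p where p: "subgradient (legendre R f) z p"
    using legendre_has_subgradient[OF assms] by blast
  have 1: "(1 - t) * (legendre R f z + p \<bullet> (x - z)) \<le> (1 - t) * legendre R f x"
    using p t unfolding subgradient_def by (intro mult_left_mono) auto
  have 2: "t * (legendre R f z + p \<bullet> (y - z)) \<le> t * legendre R f y"
    using p t unfolding subgradient_def by (intro mult_left_mono) auto
  have "(1 - t) * (p \<bullet> (x - z)) + t * (p \<bullet> (y - z)) = 0"
    unfolding z_def by (simp add: inner_diff_right inner_add_right algebra_simps)
  then show "legendre R f ((1 - t) *\<^sub>R x + t *\<^sub>R y) \<le> (1 - t) * legendre R f x + t * legendre R f y"
    using 1 2 unfolding z_def[symmetric] by (simp add: algebra_simps)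
qed simp

section \<open>Differentiability almost everywhere\<close>

lemma right_slope_decseq:
  assumes "convex_on UNIV f"
  shows "decseq (right_slope f b x)"
proof (rule decseq_SucI)
  fix n
  define t where "t = real (Suc n) / real (Suc (Suc n))"
  have t: "0 \<le> t" "t \<le> 1" by (auto simp: t_def)
  have "t * inverse (real (Suc n)) = inverse (real (Suc (Suc n)))" by (simp add: t_def divide_simps)
  then have eq: "x + b /\<^sub>R real (Suc (Suc n)) = (1 - t) *\<^sub>R x + t *\<^sub>R (x + b /\<^sub>R real (Suc n))"
    by (simp only: scaleR_add_right scaleR_scaleR scaleR_left_diff_distrib) simp
  have "f (x + b /\<^sub>R real (Suc (Suc n))) \<le> (1 - t) * f x + t * f (x + b /\<^sub>R real (Suc n))"
    unfolding eq by (rule convex_onD[OF assms]) (use t in auto)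
  then have "f (x + b /\<^sub>R real (Suc (Suc n))) - f x \<le> t * (f (x + b /\<^sub>R real (Suc n)) - f x)"
    by (simp add: algebra_simps)
  then have "real (Suc (Suc n)) * (f (x + b /\<^sub>R real (Suc (Suc n))) - f x)
     \<le> real (Suc (Suc n)) * (t * (f (x + b /\<^sub>R real (Suc n)) - f x))"
    by (intro mult_left_mono) auto
  also have "\<dots> = real (Suc n) * (f (x + b /\<^sub>R real (Suc n)) - f x)"
    by (simp add: t_def)
  finally show "right_slope f b x (Suc n) \<le> right_slope f b x n"
    by (simp only: right_slope_def)
qed

lemma right_slope_ge:
  assumes "subgradient f x p"
  shows "p \<bullet> b \<le> right_slope f b x n"
proof -
  have *: "p \<bullet> (b /\<^sub>R real (Suc n)) \<le> f (x + b /\<^sub>R real (Suc n)) - f x"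
    using assms unfolding subgradient_def by (smt (verit) add_diff_cancel_left')
  have "p \<bullet> b = real (Suc n) * (p \<bullet> (b /\<^sub>R real (Suc n)))"
    by (simp add: divide_simps del: of_nat_Suc)
  also have "\<dots> \<le> right_slope f b x n"
    unfolding right_slope_def using * by (intro mult_left_mono) auto
  finally show ?thesis .
qed

lemma right_slope_abs_le:
  assumes "R-lipschitz_on UNIV f" "norm b \<le> 1"
  shows "\<bar>right_slope f b x n\<bar> \<le> R"
proof -
  have R: "0 \<le> R" using assms(1) lipschitz_on_nonneg by blast
  have "dist (f (x + b /\<^sub>R real (Suc n))) (f x) \<le> R * dist (x + b /\<^sub>R real (Suc n)) x"
    using assms(1) by (rule lipschitz_onD) auto
  also have "\<dots> = R * (norm b / real (Suc n))" by (simp add: dist_norm divide_inverse mult.commute)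
  also have "\<dots> \<le> R * (1 / real (Suc n))"
    using R assms(2) by (intro mult_left_mono divide_right_mono) auto
  finally have "real (Suc n) * \<bar>f (x + b /\<^sub>R real (Suc n)) - f x\<bar> \<le> real (Suc n) * (R * (1 / real (Suc n)))"
    unfolding dist_real_def by (intro mult_left_mono) auto
  then show ?thesis
    by (simp add: right_slope_def abs_mult del: of_nat_Suc)
qed

lemma right_slope_convergent:
  assumes "convex_on UNIV f" "R-lipschitz_on UNIV f" "norm b \<le> 1"
  shows "right_slope f b x \<longlonglongrightarrow> lim (right_slope f b x)"
proof -
  have "Bseq (right_slope f b x)"
    using right_slope_abs_le[OF assms(2,3)] by (intro BseqI'[of _ R]) auto
  then have "convergent (right_slope f b x)"
    using right_slope_decseq[OF assms(1)] Bseq_monoseq_convergent decseq_imp_monoseq by blast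
  then show ?thesis by (simp add: convergent_LIMSEQ_iff)
qed

lemma borel_measurable_right_slope [measurable]:
  assumes [measurable]: "f \<in> borel_measurable borel"
  shows "(\<lambda>x. right_slope f b x n) \<in> borel_measurable borel"
  unfolding right_slope_def by measurable

lemma borel_measurable_grad [measurable]:
  assumes [measurable]: "f \<in> borel_measurable borel"
  shows "grad f \<in> borel_measurable borel"
proof -
  have "(\<lambda>x. lim (\<lambda>n. right_slope f b x n)) \<in> borel_measurable borel" for b
    by (rule borel_measurable_lim_metric) measurable
  then show ?thesis unfolding grad_def[abs_def] by simp
qed

lemma integrable_bump:
  fixes w :: "'a::euclidean_space \<Rightarrow> real"
  assumes [measurable]: "w \<in> borel_measurable borel" and "\<And>x. \<bar>w x\<bar> \<le> B" "\<And>x. r < norm x \<Longrightarrow> w x = 0"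
  shows "integrable lborel w"
proof (rule Bochner_Integration.integrable_bound)
  show "integrable lborel (\<lambda>x::'a. B * indicator (cball 0 r) x)"
    by (intro integrable_mult_right integrable_real_indicator emeasure_bounded_finite) auto
  show "AE x in lborel. norm (w x) \<le> norm (B * indicator (cball 0 r) x)"
  proof (intro AE_I2)
    fix x
    show "norm (w x) \<le> norm (B * indicator (cball 0 r) x)"
      using assms(2)[of x] assms(3)[of x] by (cases "norm x \<le> r") auto
  qed
qed simp

text \<open>
  The left difference quotient at \<open>x\<close> is the right one at \<open>x - b / n\<close>. By translation invariance of
  Lebesgue measure, the two have the same integral against a fixed compactly supported weight, up to
  \<open>O(1 / n)\<close>; their difference is nonnegative, so its limit vanishes almost everywhere.
\<close>

lemma AE_slopes_agree:
  fixes f :: "'a::euclidean_space \<Rightarrow> real"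
  assumes cvx: "convex_on UNIV f" and lip: "R-lipschitz_on UNIV f" and b: "b \<in> Basis"
  shows "AE x in lborel. lim (right_slope f b x) = - lim (right_slope f (- b) x)"
proof -
  have b1: "norm b \<le> 1" "norm (- b) \<le> 1" using b by auto
  have [measurable]: "f \<in> borel_measurable borel"
    using lip by (intro borel_measurable_continuous_onI lipschitz_on_continuous_on)
  have R: "0 \<le> R" using lip lipschitz_on_nonneg by blast
  define D where "D n x = right_slope f b x n" for n x
  define E where "E n x = D n (x - b /\<^sub>R real (Suc n))" for n x
  have [measurable]: "D n \<in> borel_measurable borel" "E n \<in> borel_measurable borel" for n
    unfolding D_def[abs_def] E_def[abs_def] by measurable
  have E_eq: "E n x = - right_slope f (- b) x n" for n x
    by (simp add: E_def D_def right_slope_def algebra_simps)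
  have Dlim: "(\<lambda>n. D n x) \<longlonglongrightarrow> lim (right_slope f b x)" for x
    unfolding D_def by (rule right_slope_convergent[OF cvx lip b1(1)])
  have Dbd: "\<bar>D n x\<bar> \<le> R" for n x unfolding D_def by (rule right_slope_abs_le[OF lip b1(1)])
  have Ebd: "\<bar>E n x\<bar> \<le> R" for n x unfolding E_def by (rule Dbd)
  have Elim: "(\<lambda>n. E n x) \<longlonglongrightarrow> - lim (right_slope f (- b) x)" for x
    unfolding E_eq by (intro tendsto_minus right_slope_convergent[OF cvx lip b1(2)])
  have ED: "E n x \<le> D n x" for n x
  proof -
    define s where "s = b /\<^sub>R real (Suc n)"
    have "f ((1 - 1/2) *\<^sub>R (x - s) + (1/2) *\<^sub>R (x + s)) \<le> (1 - 1/2) * f (x - s) + (1/2) * f (x + s)"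
      by (rule convex_onD[OF cvx]) auto
    moreover have "(1 - 1/2) *\<^sub>R (x - s) + (1/2) *\<^sub>R (x + s) = x"
      by (simp add: algebra_simps flip: scaleR_left.add)
    ultimately have "f x - f (x - s) \<le> f (x + s) - f x" by simp
    then have "real (Suc n) * (f x - f (x - s)) \<le> real (Suc n) * (f (x + s) - f x)"
      by (intro mult_left_mono) auto
    then show ?thesis by (simp add: E_def D_def right_slope_def s_def)
  qed
  have ball: "AE x in lborel. norm x < r \<longrightarrow> lim (right_slope f b x) = - lim (right_slope f (- b) x)" for r :: real
  proof -
    \<comment> \<open>a Lipschitz weight that is positive exactly on the ball of radius \<open>r\<close>\<close>
    define w where "w x = max 0 (r - norm x)" for x :: 'a
    have [measurable]: "w \<in> borel_measurable borel" unfolding w_def[abs_def] by measurable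
    have wbd: "0 \<le> w x" "w x \<le> \<bar>r\<bar>" "r < norm x \<Longrightarrow> w x = 0" for x unfolding w_def
      using norm_ge_zero[of x] abs_ge_self[of r] by (auto simp: max_def simp del: norm_ge_zero)
    have wlip: "\<bar>w x - w y\<bar> \<le> norm (x - y)" for x y unfolding w_def
      using norm_triangle_ineq2[of x y] norm_triangle_ineq2[of y x] by (auto simp: norm_minus_commute max_def)
    define V where "V = measure lborel (cball (0::'a) (r + 1))"
    have int1: "integrable lborel (\<lambda>x. w x * D n x)" for n
      by (rule integrable_bump[where r=r and B="\<bar>r\<bar> * R"]) (use wbd Dbd R in \<open>auto simp: abs_mult intro!: mult_mono\<close>)
    have int2: "integrable lborel (\<lambda>x. w x * E n x)" for n
      by (rule integrable_bump[where r=r and B="\<bar>r\<bar> * R"]) (use wbd Ebd R in \<open>auto simp: abs_mult intro!: mult_mono\<close>)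
    have shift: "(\<integral>x. w x * E n x \<partial>lborel) = (\<integral>x. w (x + b /\<^sub>R real (Suc n)) * D n x \<partial>lborel)" for n
    proof -
      have "(\<integral>x. w x * E n x \<partial>lborel) = (\<integral>x. w x * E n x \<partial>(distr lborel borel ((+) (b /\<^sub>R real (Suc n)))))"
        by (simp add: lborel_distr_plus)
      also have "\<dots> = (\<integral>x. w (b /\<^sub>R real (Suc n) + x) * E n (b /\<^sub>R real (Suc n) + x) \<partial>lborel)"
        by (subst integral_distr) auto
      finally show ?thesis by (simp add: E_def add.commute)
    qed
    have int3: "integrable lborel (\<lambda>x. w (x + b /\<^sub>R real (Suc n)) * D n x)" for n
    proof (rule integrable_bump[where r="r+1" and B="\<bar>r\<bar> * R"])
      show "\<bar>w (x + b /\<^sub>R real (Suc n)) * D n x\<bar> \<le> \<bar>r\<bar> * R" for x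
        using wbd Dbd R by (auto simp: abs_mult intro!: mult_mono)
      show "w (x + b /\<^sub>R real (Suc n)) * D n x = 0" if "r + 1 < norm x" for x
      proof -
        have "norm (b /\<^sub>R real (Suc n)) \<le> 1" using b by (simp add: divide_simps)
        then have "r < norm (x + b /\<^sub>R real (Suc n))"
          using that norm_diff_ineq[of x "b /\<^sub>R real (Suc n)"] by linarith
        then show ?thesis using wbd(3) by simp
      qed
    qed simp
    have bound: "\<bar>\<integral>x. w x * (D n x - E n x) \<partial>lborel\<bar> \<le> R * V / real (Suc n)" for n
    proof -
      have "(\<integral>x. w x * (D n x - E n x) \<partial>lborel) = (\<integral>x. w x * D n x \<partial>lborel) - (\<integral>x. w x * E n x \<partial>lborel)"
        using int1 int2 by (simp add: right_diff_distrib)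
      also have "\<dots> = (\<integral>x. w x * D n x - w (x + b /\<^sub>R real (Suc n)) * D n x \<partial>lborel)"
        using shift int1 int3 by simp
      finally have eq: "(\<integral>x. w x * (D n x - E n x) \<partial>lborel) = (\<integral>x. (w x - w (x + b /\<^sub>R real (Suc n))) * D n x \<partial>lborel)"
        by (simp add: left_diff_distrib)
      have "\<bar>\<integral>x. w x * (D n x - E n x) \<partial>lborel\<bar> \<le> (\<integral>x. R / real (Suc n) * indicator (cball (0::'a) (r + 1)) x \<partial>lborel)"
        unfolding eq real_norm_def[symmetric]
      proof (rule order_trans[OF Bochner_Integration.integral_norm_bound], rule Bochner_Integration.integral_mono)
        show "integrable lborel (\<lambda>x. norm ((w x - w (x + b /\<^sub>R real (Suc n))) * D n x))"
          unfolding left_diff_distrib using int1 int3 by (intro integrable_norm) simp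
        show "integrable lborel (\<lambda>x::'a. R / real (Suc n) * indicator (cball 0 (r + 1)) x)"
          by (intro integrable_mult_right integrable_real_indicator emeasure_bounded_finite) auto
        fix x :: 'a
        have n1: "norm (b /\<^sub>R real (Suc n)) = 1 / real (Suc n)" using b by (simp add: divide_inverse)
        have n2: "norm (b /\<^sub>R real (Suc n)) \<le> 1" using b by (simp add: divide_simps)
        have z: "w x - w (x + b /\<^sub>R real (Suc n)) = 0" if "x \<notin> cball 0 (r + 1)"
        proof -
          have "r + 1 < norm x" using that by auto
          then have "r < norm (x + b /\<^sub>R real (Suc n))" "r < norm x"
            using n2 norm_diff_ineq[of x "b /\<^sub>R real (Suc n)"] by linarith+
          then show ?thesis using wbd(3) by simp
        qed
        have "\<bar>w x - w (x + b /\<^sub>R real (Suc n))\<bar> * \<bar>D n x\<bar> \<le> (1 / real (Suc n)) * R"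
          using wlip[of x "x + b /\<^sub>R real (Suc n)"] Dbd R n1 by (intro mult_mono) auto
        then show "norm ((w x - w (x + b /\<^sub>R real (Suc n))) * D n x) \<le> R / real (Suc n) * indicator (cball 0 (r + 1)) x"
          using z by (cases "x \<in> cball 0 (r + 1)") (auto simp: abs_mult)
      qed
      also have "\<dots> = R * V / real (Suc n)" by (simp add: V_def)
      finally show ?thesis .
    qed
    have lim0: "(\<lambda>n. \<integral>x. w x * (D n x - E n x) \<partial>lborel) \<longlonglongrightarrow> 0"
    proof (rule Lim_null_comparison)
      show "\<forall>\<^sub>F n in sequentially. norm (\<integral>x. w x * (D n x - E n x) \<partial>lborel) \<le> R * V / real (Suc n)"
        using bound by simp
      show "(\<lambda>n. R * V / real (Suc n)) \<longlonglongrightarrow> 0"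
        using LIMSEQ_Suc[OF lim_const_over_n] by simp
    qed
    define h where "h x = w x * (lim (right_slope f b x) - (- lim (right_slope f (- b) x)))" for x
    have hlim: "(\<lambda>n. w x * (D n x - E n x)) \<longlonglongrightarrow> h x" for x
      unfolding h_def by (intro tendsto_intros Dlim Elim)
    have [measurable]: "h \<in> borel_measurable borel"
      by (rule borel_measurable_LIMSEQ_real[OF hlim]) measurable
    have dom: "integrable lborel (\<lambda>x. w x * (2 * R))"
      by (rule integrable_bump[where r=r and B="\<bar>r\<bar> * (2 * R)"]) (use wbd R in \<open>auto simp: abs_mult intro!: mult_mono\<close>)
    have le: "norm (w x * (D n x - E n x)) \<le> w x * (2 * R)" for n x
      using wbd Dbd[of n x] Ebd[of n x] by (auto simp: abs_mult intro!: mult_left_mono)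
    have "(\<lambda>n. \<integral>x. w x * (D n x - E n x) \<partial>lborel) \<longlonglongrightarrow> (\<integral>x. h x \<partial>lborel)"
      by (rule integral_dominated_convergence[OF _ _ dom]) (use hlim le in auto)
    then have h0: "(\<integral>x. h x \<partial>lborel) = 0" using lim0 LIMSEQ_unique by blast
    have hint: "integrable lborel h"
      by (rule integrable_dominated_convergence[OF _ _ dom, where s="\<lambda>n x. w x * (D n x - E n x)"]) (use hlim le in auto)
    have hpos: "0 \<le> h x" for x
      using hlim[of x] by (rule LIMSEQ_le_const) (use wbd ED in auto)
    have "AE x in lborel. h x = 0"
      using integral_nonneg_eq_0_iff_AE[OF hint] hpos h0 by simp
    then show ?thesis
      by eventually_elim (auto simp: h_def w_def max_def split: if_splits)
  qed
  have "AE x in lborel. \<forall>m::nat. norm x < real m \<longrightarrow> lim (right_slope f b x) = - lim (right_slope f (- b) x)"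
    unfolding AE_all_countable using ball by blast
  then show ?thesis
    by eventually_elim (meson reals_Archimedean2)
qed

text \<open>
  A subgradient lies between the one-sided slopes in every coordinate direction.
\<close>

lemma AE_subgradient_unique:
  fixes f :: "'a::euclidean_space \<Rightarrow> real"
  assumes cvx: "convex_on UNIV f" and lip: "R-lipschitz_on UNIV f"
  shows "AE x in lborel. \<forall>p. subgradient f x p \<longrightarrow> p = grad f x"
proof -
  have "AE x in lborel. \<forall>b\<in>Basis. lim (right_slope f b x) = - lim (right_slope f (- b) x)"
    using AE_slopes_agree[OF cvx lip] by (intro AE_finite_allI) auto
  then show ?thesis
  proof eventually_elim
    case (elim x)
    show ?case
    proof (intro allI impI, rule euclidean_eqI)
      fix p b :: 'a assume p: "subgradient f x p" and b: "b \<in> Basis"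
      have lim1: "right_slope f b x \<longlonglongrightarrow> lim (right_slope f b x)"
        by (rule right_slope_convergent[OF cvx lip]) (use b in simp)
      have 1: "p \<bullet> b \<le> lim (right_slope f b x)"
        using lim1 by (rule LIMSEQ_le_const) (use right_slope_ge[OF p] in auto)
      have ge: "- p \<bullet> b \<le> right_slope f (-b) x n" for n
        using right_slope_ge[OF p, of "-b" n] by simp
      have "right_slope f (-b) x \<longlonglongrightarrow> lim (right_slope f (-b) x)"
        by (rule right_slope_convergent[OF cvx lip]) (use b in simp)
      then have "- p \<bullet> b \<le> lim (right_slope f (-b) x)"
        by (rule LIMSEQ_le_const) (use ge in auto)
      then have "p \<bullet> b = lim (right_slope f b x)" using 1 elim b by auto
      moreover have "grad f x \<bullet> b = lim (right_slope f b x)"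
        using b by (simp add: grad_def inner_sum_left inner_Basis if_distrib sum.delta cong: if_cong)
      ultimately show "p \<bullet> b = grad f x \<bullet> b" by simp
    qed
  qed
qed


lemma AE_grad_legendre:
  fixes f :: "'a::euclidean_space \<Rightarrow> real"
  assumes "0 \<le> R" "continuous_on UNIV f"
  shows "AE x in lborel. grad (legendre R f) x \<in> cball 0 R
    \<and> legendre R f x + f (grad (legendre R f) x) = x \<bullet> grad (legendre R f) x
    \<and> (\<forall>p. subgradient (legendre R f) x p \<longrightarrow> p = grad (legendre R f) x)"
  using AE_subgradient_unique[OF convex_on_legendre[OF assms] legendre_lipschitz[OF assms]]
proof eventually_elim
  case (elim x)
  show ?case
    using legendre_has_subgradient[OF assms, of x] elim by metis
qed

lemma legendre_tendsto:
  fixes f :: "'a::euclidean_space \<Rightarrow> real"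
  assumes R: "0 \<le> R" and cont: "\<And>n. continuous_on UNIV (g n)" "continuous_on UNIV f"
    and lim: "uniform_limit (cball 0 R) g f sequentially"
  shows "(\<lambda>n. legendre R (g n) x) \<longlonglongrightarrow> legendre R f x"
proof (rule LIMSEQ_I)
  fix r :: real assume r: "0 < r"
  then have "\<forall>\<^sub>F n in sequentially. \<forall>y\<in>cball 0 R. dist (g n y) (f y) < r/2"
    using uniform_limitD[OF lim, of "r/2"] by auto
  then obtain N where N: "\<And>n y. N \<le> n \<Longrightarrow> y \<in> cball 0 R \<Longrightarrow> dist (g n y) (f y) < r/2"
    unfolding eventually_sequentially by blast
  have "norm (legendre R (g n) x - legendre R f x) < r" if "N \<le> n" for n
  proof -
    have close: "\<bar>g n y - f y\<bar> < r/2" if "y \<in> cball 0 R" for y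
      using N[OF \<open>N \<le> n\<close> that] by (simp add: dist_real_def)
    have c1: "f y \<le> g n y + r/2" "g n y \<le> f y + r/2" if "y \<in> cball 0 R" for y
      using close[OF that] by linarith+
    have "legendre R (g n) x \<le> legendre R f x + r/2"
      by (rule legendre_diff_le[OF R cont(1,2)]) (rule c1)
    moreover have "legendre R f x \<le> legendre R (g n) x + r/2"
      by (rule legendre_diff_le[OF R cont(2,1)]) (rule c1)
    ultimately show ?thesis using r by (simp add: abs_less_iff)
  qed
  then show "\<exists>N. \<forall>n\<ge>N. norm (legendre R (g n) x - legendre R f x) < r" by blast
qed

lemma compact_subseq_tendsto:
  fixes p :: "nat \<Rightarrow> 'a::metric_space"
  assumes "compact S" "\<And>n. p n \<in> S"
    and sub: "\<And>k l. strict_mono k \<Longrightarrow> (\<lambda>n. p (k n)) \<longlonglongrightarrow> l \<Longrightarrow> l = q"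
  shows "p \<longlonglongrightarrow> q"
proof (rule ccontr)
  assume "\<not> p \<longlonglongrightarrow> q"
  then obtain e where e: "e > 0" "\<And>N. \<exists>n\<ge>N. e \<le> dist (p n) q"
    unfolding lim_sequentially by (metis not_less)
  define A where "A = {n. e \<le> dist (p n) q}"
  have A: "infinite A" using e(2) unfolding A_def infinite_nat_iff_unbounded_le by blast
  define k where "k = enumerate A"
  have k: "strict_mono k" "\<And>n. e \<le> dist (p (k n)) q"
    using A enumerate_in_set[OF A] by (auto simp: k_def strict_mono_enumerate A_def)
  obtain l r where lr: "strict_mono r" "(\<lambda>n. p (k (r n))) \<longlonglongrightarrow> l"
    using assms(1)[unfolded compact_def, rule_format, of "\<lambda>n. p (k n)"] assms(2) by (auto simp: o_def)
  have "l = q"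
    using sub[OF strict_mono_o[OF k(1) lr(1)], of l] lr(2) by (simp add: o_def)
  then have "(\<lambda>n. dist (p (k (r n))) q) \<longlonglongrightarrow> 0"
    using tendsto_dist[OF lr(2), of "\<lambda>_. q" q] by simp
  then have "e \<le> 0"
    by (rule LIMSEQ_le_const) (use k in auto)
  then show False using e(1) by simp
qed

text \<open>
  Limit points of subgradients of \<open>legendre R (g n)\<close> are subgradients of the limit, and almost everywhere
  there is only one.
\<close>

lemma AE_grad_tendsto:
  fixes f :: "'a::euclidean_space \<Rightarrow> real"
  assumes R: "0 \<le> R" and cont: "\<And>n. continuous_on UNIV (g n)" "continuous_on UNIV f"
    and lim: "uniform_limit (cball 0 R) g f sequentially"
  shows "AE x in lborel. (\<lambda>n. grad (legendre R (g n)) x) \<longlonglongrightarrow> grad (legendre R f) x"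
proof -
  have "AE x in lborel. \<forall>n. grad (legendre R (g n)) x \<in> cball 0 R
      \<and> legendre R (g n) x + g n (grad (legendre R (g n)) x) = x \<bullet> grad (legendre R (g n)) x"
    unfolding AE_all_countable using AE_grad_legendre[OF R cont(1)] by (auto elim: eventually_mono)
  then show ?thesis using AE_grad_legendre[OF R cont(2)]
  proof eventually_elim
    case (elim x)
    define p where "p n = grad (legendre R (g n)) x" for n
    have p: "p n \<in> cball 0 R" "subgradient (legendre R (g n)) x (p n)" for n
      unfolding p_def using elim subgradient_legendre[OF R cont(1)] by blast+
    have sub: "q = grad (legendre R f) x" if q: "strict_mono k" "(\<lambda>n. p (k n)) \<longlonglongrightarrow> q" for k q
    proof -
      have "subgradient (legendre R f) x q" unfolding subgradient_def
      proof
        fix z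
        have l: "(\<lambda>n. legendre R (g (k n)) y) \<longlonglongrightarrow> legendre R f y" for y
          using LIMSEQ_subseq_LIMSEQ[OF legendre_tendsto[OF R cont lim, of y] q(1)] by (simp add: o_def)
        have "(\<lambda>n. legendre R (g (k n)) x + p (k n) \<bullet> (z - x)) \<longlonglongrightarrow> legendre R f x + q \<bullet> (z - x)"
          by (intro tendsto_intros l q)
        then show "legendre R f x + q \<bullet> (z - x) \<le> legendre R f z"
          by (rule LIMSEQ_le[OF _ l]) (use p(2) in \<open>auto simp: subgradient_def\<close>)
      qed
      then show ?thesis using elim by blast
    qed
    show ?case unfolding p_def[symmetric]
      by (rule compact_subseq_tendsto[OF compact_cball p(1) sub])
  qed
qed

section \<open>Existence of optimal maps\<close>

text \<open>
  The normalisation at \<open>0\<close> removes the additive constant, to which the dual problem is insensitive, so that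
  potentials form a compact class.
\<close>

definition potential :: "real \<Rightarrow> ('a::euclidean_space \<Rightarrow> real) \<Rightarrow> bool" where
  "potential R f \<longleftrightarrow> R-lipschitz_on UNIV f \<and> f 0 = 0"

lemma potential_continuous: "potential R f \<Longrightarrow> continuous_on UNIV f"
  by (auto simp: potential_def intro: lipschitz_on_continuous_on)

lemma potential_bound:
  assumes "potential R f" "y \<in> cball 0 R"
  shows "\<bar>f y\<bar> \<le> R * R"
proof -
  have R: "0 \<le> R" using assms(1) by (auto simp: potential_def dest: lipschitz_on_nonneg)
  have "dist (f y) (f 0) \<le> R * dist y 0"
    using assms(1) unfolding potential_def by (meson lipschitz_onD UNIV_I)
  also have "\<dots> \<le> R * R" using assms(2) R by (intro mult_left_mono) auto
  finally show ?thesis using assms(1) by (simp add: potential_def dist_real_def)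
qed

lemma legendre_bound:
  assumes R: "0 \<le> R" and f: "continuous_on UNIV f" "\<And>y. y \<in> cball 0 R \<Longrightarrow> \<bar>f y\<bar> \<le> B" and x: "x \<in> cball 0 R"
  shows "\<bar>legendre R f x\<bar> \<le> R * R + B"
proof -
  obtain y where y: "y \<in> cball 0 R" "legendre R f x + f y = x \<bullet> y"
    using legendre_has_subgradient[OF R f(1)] by metis
  have "\<bar>x \<bullet> y\<bar> \<le> R * R"
    using Cauchy_Schwarz_ineq2[of x y] x y(1) R mult_mono[of "norm x" R "norm y" R] by auto
  then show ?thesis using y(2) f(2)[OF y(1)] by linarith
qed

lemma legendre_shift:
  assumes "0 \<le> R" "continuous_on UNIV f"
  shows "legendre R (\<lambda>y. f y + c) x = legendre R f x - c"
proof (rule antisym)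
  have c: "continuous_on UNIV (\<lambda>y. f y + c)" by (intro continuous_intros assms)
  show "legendre R (\<lambda>y. f y + c) x \<le> legendre R f x - c"
    using legendre_diff_le[OF assms(1) c assms(2), of "- c" x] by simp
  show "legendre R f x - c \<le> legendre R (\<lambda>y. f y + c) x"
    using legendre_diff_le[OF assms(1) assms(2) c, of c x] by simp
qed

text \<open>
  Arzela-Ascoli on the ball; composing with the nearest-point projection extends the limit to the whole space
  with the same Lipschitz constant.
\<close>

lemma potential_compactness:
  fixes g :: "nat \<Rightarrow> 'a::euclidean_space \<Rightarrow> real"
  assumes R: "0 \<le> R" and g: "\<And>n. potential R (g n)"
  obtains k f where "strict_mono k" "potential R f"
    "uniform_limit (cball 0 R) (\<lambda>n. g (k n)) f sequentially"
proof -
  obtain h and k :: "nat \<Rightarrow> nat" where h: "continuous_on (cball 0 R) h" and k: "strict_mono k"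
    and lim: "\<And>e. 0 < e \<Longrightarrow> \<exists>N. \<forall>n x. n \<ge> N \<and> x \<in> cball 0 R \<longrightarrow> norm (g (k n) x - h x) < e"
  proof (rule Arzela_Ascoli[of "cball 0 R" g "R * R"])
    fix x :: 'a and e :: real assume e: "0 < e"
    show "\<exists>d>0. \<forall>n y. y \<in> cball 0 R \<and> norm (x - y) < d \<longrightarrow> norm (g n x - g n y) < e"
    proof (intro exI conjI allI impI)
      show "0 < e / (R + 1)" using e R by simp
      fix n y assume y: "y \<in> cball 0 R \<and> norm (x - y) < e / (R + 1)"
      have "norm (g n x - g n y) \<le> R * norm (x - y)"
        using g[of n] lipschitz_onD[of R UNIV "g n" x y] by (auto simp: potential_def dist_norm)
      also have "\<dots> \<le> (R + 1) * norm (x - y)" by (intro mult_right_mono) auto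
      also have "\<dots> < e" using y R by (simp add: field_simps)
      finally show "norm (g n x - g n y) < e" .
    qed
  qed (use potential_bound[OF g] in auto)
  let ?c = "closest_point (cball (0::'a) R)"
  define f where "f = h \<circ> ?c"
  have c_in: "?c x \<in> cball 0 R" for x using R by (intro closest_point_in_set) auto
  have ptw: "(\<lambda>n. g (k n) x) \<longlonglongrightarrow> h x" if "x \<in> cball 0 R" for x
    unfolding LIMSEQ_iff using lim that by meson
  have "R-lipschitz_on UNIV f"
  proof (rule lipschitz_onI[OF _ R])
    fix x y
    have "dist (h (?c x)) (h (?c y)) \<le> R * dist (?c x) (?c y)"
    proof (rule LIMSEQ_le_const2)
      show "(\<lambda>n. dist (g (k n) (?c x)) (g (k n) (?c y))) \<longlonglongrightarrow> dist (h (?c x)) (h (?c y))"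
        by (intro tendsto_dist ptw c_in)
      show "\<exists>N. \<forall>n\<ge>N. dist (g (k n) (?c x)) (g (k n) (?c y)) \<le> R * dist (?c x) (?c y)"
        using g lipschitz_onD unfolding potential_def by blast
    qed
    also have "\<dots> \<le> R * dist x y"
      using R by (intro mult_left_mono closest_point_lipschitz) auto
    finally show "dist (f x) (f y) \<le> R * dist x y" by (simp add: f_def)
  qed
  moreover have fh: "f x = h x" if "x \<in> cball 0 R" for x
    using that by (simp add: f_def closest_point_self)
  moreover have "h 0 = 0"
    using LIMSEQ_unique[OF ptw[of 0], of 0] g R by (simp add: potential_def)
  moreover have "uniform_limit (cball 0 R) (\<lambda>n. g (k n)) f sequentially"
    unfolding uniform_limit_iff eventually_sequentially
  proof (intro allI impI)
    fix e :: real assume "0 < e"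
    then obtain N where "\<forall>n x. n \<ge> N \<and> x \<in> cball 0 R \<longrightarrow> norm (g (k n) x - h x) < e" using lim by blast
    then show "\<exists>N. \<forall>n\<ge>N. \<forall>x\<in>cball 0 R. dist (g (k n) x) (f x) < e"
      using fh by (intro exI[of _ N] allI impI ballI) (simp add: dist_norm)
  qed
  ultimately show ?thesis using that[OF k, of f] R by (simp add: potential_def)
qed

text \<open>
  The functions \<open>max 0 (1 - n * infdist x F)\<close> decrease to the indicator of the closed set \<open>F\<close>, and the
  closed sets are an intersection-stable generator of the Borel sets.
\<close>

lemma finite_borel_measure_eqI:
  fixes M N :: "'b::metric_space measure"
  assumes fin: "finite_measure M" "finite_measure N"
    and sets: "sets M = sets borel" "sets N = sets borel"
    and eq: "\<And>h :: 'b \<Rightarrow> real. continuous_on UNIV h \<Longrightarrow> (\<And>x. \<bar>h x\<bar> \<le> 1) \<Longrightarrow> (\<integral>x. h x \<partial>M) = (\<integral>x. h x \<partial>N)"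
  shows "M = N"
proof -
  have sp: "space M = UNIV" "space N = UNIV" using sets[THEN sets_eq_imp_space_eq] by auto
  have lim: "(\<lambda>n. \<integral>x. max 0 (1 - real n * infdist x F) \<partial>L) \<longlonglongrightarrow> measure L F"
    if F: "closed F" "F \<noteq> {}" and L: "finite_measure L" "sets L = sets borel" for F :: "'b set" and L
  proof -
    have [measurable_cong]: "sets L = sets borel" by fact
    have c: "(\<lambda>x. max 0 (1 - real n * infdist x F)) \<in> borel_measurable L" for n
      unfolding L(2)[THEN measurable_cong_sets[OF _ refl]]
      by (intro borel_measurable_continuous_onI continuous_intros)
    have "(\<lambda>n. \<integral>x. max 0 (1 - real n * infdist x F) \<partial>L) \<longlonglongrightarrow> (\<integral>x. indicator F x \<partial>L)"
    proof (rule integral_dominated_convergence[where w="\<lambda>_. 1"])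
      show "AE x in L. (\<lambda>n. max 0 (1 - real n * infdist x F)) \<longlonglongrightarrow> indicator F x"
      proof (rule AE_I2)
        fix x
        show "(\<lambda>n. max 0 (1 - real n * infdist x F)) \<longlonglongrightarrow> indicator F x"
        proof (cases "x \<in> F")
          case False
          then have "0 < infdist x F" using F in_closed_iff_infdist_zero infdist_nonneg[of x F] by force
          then obtain n0 :: nat where n0: "1 < real n0 * infdist x F"
            using reals_Archimedean3 by blast
          have "max 0 (1 - real n * infdist x F) = 0" if "n0 \<le> n" for n
          proof -
            have "real n0 * infdist x F \<le> real n * infdist x F"
              using that by (intro mult_right_mono infdist_nonneg) auto
            then show ?thesis using n0 by simp
          qed
          then have "\<forall>\<^sub>F n in sequentially. max 0 (1 - real n * infdist x F) = 0"
            unfolding eventually_sequentially by blast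
          then show ?thesis using False by (simp add: tendsto_eventually)
        qed simp
      qed
      show "integrable L (\<lambda>x. 1::real)" using L(1) by (simp add: finite_measure.integrable_const)
      show "(indicator F :: 'b \<Rightarrow> real) \<in> borel_measurable L" using F by (subst measurable_cong_sets[OF L(2) refl]) simp
      show "AE x in L. norm (max 0 (1 - real n * infdist x F)) \<le> 1" for n
        by (intro AE_I2) (auto simp: infdist_nonneg)
    qed (rule c)
    moreover have "F \<inter> space L = F" using L(2)[THEN sets_eq_imp_space_eq] by simp
    ultimately show ?thesis by simp
  qed
  show ?thesis
  proof (rule measure_eqI_generator_eq[where E="Collect closed" and \<Omega>=UNIV and A="\<lambda>_. UNIV"])
    show "Int_stable (Collect (closed :: 'b set \<Rightarrow> bool))" by (auto simp: Int_stable_def)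
    show "sets M = sigma_sets UNIV (Collect closed)" "sets N = sigma_sets UNIV (Collect closed)"
      using sets by (auto simp: borel_eq_closed)
    show "emeasure M UNIV \<noteq> \<infinity>" using finite_measure.emeasure_finite[OF fin(1)] by simp
    fix F :: "'b set" assume "F \<in> Collect closed"
    then have F: "closed F" by simp
    show "emeasure M F = emeasure N F"
    proof (cases "F = {}")
      case False
      have "(\<integral>x. max 0 (1 - real n * infdist x F) \<partial>M) = (\<integral>x. max 0 (1 - real n * infdist x F) \<partial>N)" for n
        by (rule eq) (auto intro!: continuous_intros simp: infdist_nonneg)
      then have "measure M F = measure N F"
        using lim[OF F False fin(1) sets(1)] lim[OF F False fin(2) sets(2)] by (simp add: LIMSEQ_unique)
      then show ?thesis using fin by (simp add: finite_measure.emeasure_eq_measure)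
    qed simp
  qed auto
qed

lemma integrable_concentrated:
  fixes f :: "'a::euclidean_space \<Rightarrow> real"
  assumes "finite_measure M" "sets M = sets borel" "AE x in M. x \<in> cball 0 R" "continuous_on UNIV f"
  shows "integrable M f"
proof -
  have "bounded (f ` cball 0 R)"
    by (intro compact_imp_bounded compact_continuous_image continuous_on_subset[OF assms(4)]) auto
  then obtain B where B: "\<And>x. x \<in> cball 0 R \<Longrightarrow> norm (f x) \<le> B"
    unfolding bounded_iff by blast
  show ?thesis
  proof (rule finite_measure.integrable_const_bound[OF assms(1)])
    show "AE x in M. norm (f x) \<le> B" using assms(3) by eventually_elim (rule B)
    show "f \<in> borel_measurable M"
      by (subst measurable_cong_sets[OF assms(2) refl]) (rule borel_measurable_continuous_onI[OF assms(4)])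
  qed
qed

text \<open>
  The Kantorovich dual functional for the correlation, with the first potential eliminated.
\<close>

definition dual_cost :: "real \<Rightarrow> 'a::euclidean_space measure \<Rightarrow> 'a measure \<Rightarrow> ('a \<Rightarrow> real) \<Rightarrow> real" where
  "dual_cost R \<alpha> \<beta> f = (\<integral>x. legendre R f x \<partial>\<alpha>) + (\<integral>y. f y \<partial>\<beta>)"

text \<open>
  Conjugating twice lowers \<open>f\<close> on the ball without raising its transform there, and adding a constant does
  not change the functional because the masses agree.
\<close>

lemma dual_cost_improve:
  fixes \<alpha> \<beta> :: "'a::euclidean_space measure"
  assumes R: "0 \<le> R"
    and \<alpha>: "finite_measure \<alpha>" "sets \<alpha> = sets borel" "AE x in \<alpha>. x \<in> cball 0 R"
    and \<beta>: "finite_measure \<beta>" "sets \<beta> = sets borel" "AE x in \<beta>. x \<in> cball 0 R"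
    and mass: "measure \<alpha> UNIV = measure \<beta> UNIV"
    and f: "continuous_on UNIV f"
  shows "\<exists>g. potential R g \<and> dual_cost R \<alpha> \<beta> g \<le> dual_cost R \<alpha> \<beta> f"
proof -
  define f' where "f' = legendre R f"
  define f2 where "f2 = legendre R f'"
  define c where "c = - f2 0"
  define g where "g y = f2 y + c" for y
  have f': "continuous_on UNIV f'" unfolding f'_def by (rule continuous_on_legendre[OF R f])
  have lip: "R-lipschitz_on UNIV f2" unfolding f2_def by (rule legendre_lipschitz[OF R f'])
  have f2: "continuous_on UNIV f2" using lip lipschitz_on_continuous_on by blast
  have "potential R g"
    using lip by (auto simp: potential_def g_def[abs_def] c_def lipschitz_on_def dist_real_def)
  note int\<alpha> = integrable_concentrated[OF \<alpha>] and int\<beta> = integrable_concentrated[OF \<beta>]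
  have sp: "space \<alpha> = UNIV" "space \<beta> = UNIV" using \<alpha>(2)[THEN sets_eq_imp_space_eq] \<beta>(2)[THEN sets_eq_imp_space_eq] by auto
  have 1: "f2 y \<le> f y" if "y \<in> cball 0 R" for y
  proof -
    obtain x where x: "x \<in> cball 0 R" "f2 y + f' x = y \<bullet> x"
      using legendre_has_subgradient[OF R f'] unfolding f2_def by metis
    then show ?thesis using fenchel_young[OF R f that, of x] unfolding f'_def by (simp add: inner_commute)
  qed
  have 2: "legendre R f2 x \<le> f' x" if "x \<in> cball 0 R" for x
  proof -
    obtain y where y: "y \<in> cball 0 R" "legendre R f2 x + f2 y = x \<bullet> y"
      using legendre_has_subgradient[OF R f2] by metis
    then show ?thesis using fenchel_young[OF R f' that, of y] unfolding f2_def by (simp add: inner_commute)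
  qed
  have "dual_cost R \<alpha> \<beta> g = (\<integral>x. legendre R f2 x - c \<partial>\<alpha>) + (\<integral>y. f2 y + c \<partial>\<beta>)"
    unfolding dual_cost_def g_def legendre_shift[OF R f2] ..
  also have "\<dots> = (\<integral>x. legendre R f2 x \<partial>\<alpha>) + (\<integral>y. f2 y \<partial>\<beta>)"
    using int\<alpha>[OF continuous_on_legendre[OF R f2]] int\<beta>[OF f2] mass \<alpha>(1) \<beta>(1)
    by (simp add: finite_measure.integrable_const sp)
  also have "\<dots> \<le> (\<integral>x. f' x \<partial>\<alpha>) + (\<integral>y. f y \<partial>\<beta>)"
  proof (intro add_mono integral_mono_AE)
    show "AE x in \<alpha>. legendre R f2 x \<le> f' x" using \<alpha>(3) by eventually_elim (rule 2)
    show "AE x in \<beta>. f2 x \<le> f x" using \<beta>(3) by eventually_elim (rule 1)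
  qed (intro int\<alpha> int\<beta> f f' f2 continuous_on_legendre R)+
  finally show ?thesis using \<open>potential R g\<close> unfolding dual_cost_def f'_def by blast
qed

lemma dual_cost_minimizer:
  fixes \<alpha> \<beta> :: "'a::euclidean_space measure"
  assumes R: "0 \<le> R"
    and \<alpha>: "finite_measure \<alpha>" "sets \<alpha> = sets borel" "AE x in \<alpha>. x \<in> cball 0 R"
    and \<beta>: "finite_measure \<beta>" "sets \<beta> = sets borel" "AE x in \<beta>. x \<in> cball 0 R"
    and mass: "measure \<alpha> UNIV = measure \<beta> UNIV"
  obtains g where "potential R g" "\<And>f. continuous_on UNIV f \<Longrightarrow> dual_cost R \<alpha> \<beta> g \<le> dual_cost R \<alpha> \<beta> f"
proof -
  note int\<alpha> = integrable_concentrated[OF \<alpha>] and int\<beta> = integrable_concentrated[OF \<beta>]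
  have sp: "space \<alpha> = UNIV" "space \<beta> = UNIV" using \<alpha>(2)[THEN sets_eq_imp_space_eq] \<beta>(2)[THEN sets_eq_imp_space_eq] by auto
  define S where "S = dual_cost R \<alpha> \<beta> ` Collect (potential R)"
  have z: "potential R (\<lambda>_::'a. 0)" using R by (simp add: potential_def lipschitz_on_def)
  have lower: "- (R * R + R * R) * measure \<alpha> UNIV - R * R * measure \<beta> UNIV \<le> dual_cost R \<alpha> \<beta> g" if g: "potential R g" for g
  proof -
    have c: "continuous_on UNIV g" using g by (rule potential_continuous)
    have lb: "- (R * R + R * R) \<le> legendre R g x" if "x \<in> cball 0 R" for x
      using legendre_bound[OF R c potential_bound[OF g] that] by linarith
    have lb2: "- (R * R) \<le> g x" if "x \<in> cball 0 R" for x
      using potential_bound[OF g that] by linarith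
    have "(\<integral>x. - (R * R + R * R) \<partial>\<alpha>) \<le> (\<integral>x. legendre R g x \<partial>\<alpha>)"
    proof (rule integral_mono_AE)
      show "AE x in \<alpha>. - (R * R + R * R) \<le> legendre R g x"
        using \<alpha>(3) by eventually_elim (rule lb)
    qed (use \<alpha>(1) int\<alpha>[OF continuous_on_legendre[OF R c]] in \<open>auto simp: finite_measure.integrable_const\<close>)
    moreover have "(\<integral>x. - (R * R) \<partial>\<beta>) \<le> (\<integral>x. g x \<partial>\<beta>)"
    proof (rule integral_mono_AE)
      show "AE x in \<beta>. - (R * R) \<le> g x"
        using \<beta>(3) by eventually_elim (rule lb2)
    qed (use \<beta>(1) int\<beta>[OF c] in \<open>auto simp: finite_measure.integrable_const\<close>)
    ultimately show ?thesis by (simp add: dual_cost_def sp algebra_simps)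
  qed
  have S: "S \<noteq> {}" "bdd_below S" unfolding S_def using z lower by (blast, intro bdd_belowI2) auto
  have "\<exists>g. potential R g \<and> dual_cost R \<alpha> \<beta> g < Inf S + 1 / real (Suc n)" for n
    using cInf_lessD[OF S(1), of "Inf S + 1 / real (Suc n)"] by (auto simp: S_def)
  then have "\<exists>G. \<forall>n. potential R (G n) \<and> dual_cost R \<alpha> \<beta> (G n) < Inf S + 1 / real (Suc n)"
    by (intro choice allI)
  then obtain g where g: "\<And>n. potential R (g n)" "\<And>n. dual_cost R \<alpha> \<beta> (g n) < Inf S + 1 / real (Suc n)"
    by blast
  obtain k h where k: "strict_mono k" and h: "potential R h"
    and lim: "uniform_limit (cball 0 R) (\<lambda>n. g (k n)) h sequentially"
    by (rule potential_compactness[OF R g(1)])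
  have lb: "norm (legendre R (g n) x) \<le> R * R + R * R" if "x \<in> cball 0 R" for n x
    using legendre_bound[OF R potential_continuous potential_bound that, OF g(1) g(1)] by simp
  have lb2: "norm (g n x) \<le> R * R" if "x \<in> cball 0 R" for n x
    using potential_bound[OF g(1) that] by simp
  note ch = potential_continuous[OF h] and cg = potential_continuous[OF g(1)]
  have "(\<lambda>n. \<integral>x. legendre R (g (k n)) x \<partial>\<alpha>) \<longlonglongrightarrow> (\<integral>x. legendre R h x \<partial>\<alpha>)"
  proof (rule integral_dominated_convergence[where w="\<lambda>_. R * R + R * R"])
    show "AE x in \<alpha>. (\<lambda>n. legendre R (g (k n)) x) \<longlonglongrightarrow> legendre R h x"
      by (intro AE_I2 legendre_tendsto[OF R cg ch lim])
    show "AE x in \<alpha>. norm (legendre R (g (k n)) x) \<le> R * R + R * R" for n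
      using \<alpha>(3) by eventually_elim (rule lb)
    show "legendre R h \<in> borel_measurable \<alpha>" using int\<alpha>[OF continuous_on_legendre[OF R ch]] by auto
    show "legendre R (g (k n)) \<in> borel_measurable \<alpha>" for n using int\<alpha>[OF continuous_on_legendre[OF R cg]] by auto
  qed (use \<alpha>(1) in \<open>auto simp: finite_measure.integrable_const\<close>)
  moreover have "(\<lambda>n. \<integral>x. g (k n) x \<partial>\<beta>) \<longlonglongrightarrow> (\<integral>x. h x \<partial>\<beta>)"
  proof (rule integral_dominated_convergence[where w="\<lambda>_. R * R"])
    show "AE x in \<beta>. (\<lambda>n. g (k n) x) \<longlonglongrightarrow> h x"
      using \<beta>(3) by eventually_elim (rule tendsto_uniform_limitI[OF lim])
    show "AE x in \<beta>. norm (g (k n) x) \<le> R * R" for n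
      using \<beta>(3) by eventually_elim (rule lb2)
    show "h \<in> borel_measurable \<beta>" using int\<beta>[OF ch] by auto
    show "g (k n) \<in> borel_measurable \<beta>" for n using int\<beta>[OF cg] by auto
  qed (use \<beta>(1) in \<open>auto simp: finite_measure.integrable_const\<close>)
  ultimately have "(\<lambda>n. dual_cost R \<alpha> \<beta> (g (k n))) \<longlonglongrightarrow> dual_cost R \<alpha> \<beta> h"
    unfolding dual_cost_def by (rule tendsto_add)
  moreover have "(\<lambda>n. Inf S + 1 / real (Suc (k n))) \<longlonglongrightarrow> Inf S + 0"
    using LIMSEQ_subseq_LIMSEQ[OF LIMSEQ_Suc[OF lim_const_over_n[of "1::real"]] k]
    by (intro tendsto_add tendsto_const) (simp add: o_def)
  ultimately have le: "dual_cost R \<alpha> \<beta> h \<le> Inf S"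
    using LIMSEQ_le[of "\<lambda>n. dual_cost R \<alpha> \<beta> (g (k n))" _ "\<lambda>n. Inf S + 1 / real (Suc (k n))"] g(2)
    by (metis add.right_neutral less_imp_le)
  have "dual_cost R \<alpha> \<beta> h \<le> dual_cost R \<alpha> \<beta> f" if f: "continuous_on UNIV f" for f
  proof -
    obtain g where g: "potential R g" "dual_cost R \<alpha> \<beta> g \<le> dual_cost R \<alpha> \<beta> f"
      using dual_cost_improve[OF R \<alpha> \<beta> mass f] by blast
    have "Inf S \<le> dual_cost R \<alpha> \<beta> g" by (rule cInf_lower) (use g S in \<open>auto simp: S_def\<close>)
    then show ?thesis using le g(2) by linarith
  qed
  then show ?thesis using that h by blast
qed

text \<open>
  An envelope theorem: the derivative of the maximum in direction \<open>h\<close> is the derivative of the objective at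
  the unique maximiser \<open>T\<close>.
\<close>

lemma legendre_perturb_tendsto:
  fixes f h :: "'a::euclidean_space \<Rightarrow> real"
  assumes R: "0 \<le> R" and f: "continuous_on UNIV f" and h: "continuous_on UNIV h" "\<And>y. \<bar>h y\<bar> \<le> H"
    and T: "T \<in> cball 0 R" "legendre R f x + f T = x \<bullet> T" "\<And>p. subgradient (legendre R f) x p \<Longrightarrow> p = T"
  shows "(\<lambda>n. real (Suc n) * (legendre R (\<lambda>y. f y + h y / real (Suc n)) x - legendre R f x)) \<longlonglongrightarrow> - h T"
proof -
  define t where "t n = 1 / real (Suc n)" for n
  have t: "0 < t n" for n by (simp add: t_def)
  have t0: "t \<longlonglongrightarrow> 0" unfolding t_def using LIMSEQ_Suc[OF lim_const_over_n[of "1::real"]] by simp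
  define F where "F n = legendre R (\<lambda>y. f y + h y / real (Suc n)) x" for n
  have c: "continuous_on UNIV (\<lambda>y. f y + h y / real (Suc n))" for n by (intro continuous_intros f h) auto
  have "\<exists>y. y \<in> cball 0 R \<and> F n + (f y + h y / real (Suc n)) = x \<bullet> y" for n
    unfolding F_def using legendre_has_subgradient[OF R c] by metis
  then obtain y where y: "\<And>n. y n \<in> cball 0 R" "\<And>n. F n + f (y n) + t n * h (y n) = x \<bullet> y n"
    unfolding t_def by (metis add.assoc mult.commute mult_1 times_divide_eq_left)
  have lo: "legendre R f x - t n * h T \<le> F n" for n
    using fenchel_young[OF R c T(1), of x n] T(2) by (simp add: F_def t_def)
  have up: "F n \<le> legendre R f x - t n * h (y n)" for n
    using fenchel_young[OF R f y(1), of x n] y(2)[of n] by linarith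
  have "y \<longlonglongrightarrow> T"
  proof (rule compact_subseq_tendsto[OF compact_cball y(1)])
    fix k l assume k: "strict_mono k" and l: "(\<lambda>n. y (k n)) \<longlonglongrightarrow> l"
    have tk: "(\<lambda>n. t (k n)) \<longlonglongrightarrow> 0" using LIMSEQ_subseq_LIMSEQ[OF t0 k] by (simp add: o_def)
    have lin: "l \<in> cball 0 R" using closed_sequentially[OF closed_cball _ l] y(1) by blast
    have ct: "(\<lambda>n. f (y (k n))) \<longlonglongrightarrow> f l" 
      using continuous_on_tendsto_compose[OF f l] by simp
    have "legendre R f x + f l \<le> x \<bullet> l"
    proof (rule LIMSEQ_le)
      show "(\<lambda>n. legendre R f x + f (y (k n)) - t (k n) * (2 * H)) \<longlonglongrightarrow> legendre R f x + f l"
        using tendsto_diff[OF tendsto_add[OF tendsto_const ct] tendsto_mult_right[OF tk, of "2 * H"], of "legendre R f x"] by simp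
      show "(\<lambda>n. x \<bullet> y (k n)) \<longlonglongrightarrow> x \<bullet> l" by (intro tendsto_intros l)
      have "legendre R f x + f (y n) - t n * (2 * H) \<le> x \<bullet> y n" for n
      proof -
        have "t n * h T \<le> t n * H" "t n * (- h (y n)) \<le> t n * H"
          using t[of n] h(2)[of T] h(2)[of "y n"] by (intro mult_left_mono; linarith)+
        then show ?thesis using lo[of n] y(2)[of n] by (simp add: algebra_simps)
      qed
      then show "\<exists>N. \<forall>n\<ge>N. legendre R f x + f (y (k n)) - t (k n) * (2 * H) \<le> x \<bullet> y (k n)" by blast
    qed
    then have "legendre R f x + f l = x \<bullet> l" using fenchel_young[OF R f lin, of x] by linarith
    then show "l = T" using T(3) subgradient_legendre[OF R f lin] by blast
  qed
  then have hy: "(\<lambda>n. h (y n)) \<longlonglongrightarrow> h T"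
    using continuous_on_tendsto_compose[OF h(1)] by simp
  show ?thesis unfolding F_def[symmetric]
  proof (rule tendsto_sandwich[of "\<lambda>_. - h T" _ _ "\<lambda>n. - h (y n)"])
    show "(\<lambda>n. - h (y n)) \<longlonglongrightarrow> - h T" using hy by (rule tendsto_minus)
    have "- h T \<le> real (Suc n) * (F n - legendre R f x)" "real (Suc n) * (F n - legendre R f x) \<le> - h (y n)" for n
    proof -
      have "real (Suc n) * (- t n * h T) \<le> real (Suc n) * (F n - legendre R f x)"
        using lo[of n] by (intro mult_left_mono) auto
      then show "- h T \<le> real (Suc n) * (F n - legendre R f x)" by (simp add: t_def)
      have "real (Suc n) * (F n - legendre R f x) \<le> real (Suc n) * (- t n * h (y n))"
        using up[of n] by (intro mult_left_mono) auto
      then show "real (Suc n) * (F n - legendre R f x) \<le> - h (y n)" by (simp add: t_def)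
    qed
    then show "\<forall>\<^sub>F n in sequentially. - h T \<le> real (Suc n) * (F n - legendre R f x)"
      "\<forall>\<^sub>F n in sequentially. real (Suc n) * (F n - legendre R f x) \<le> - h (y n)" by auto
  qed simp
qed

text \<open>
  The Euler-Lagrange equation of a minimiser of the dual functional says that the gradient of its Legendre
  transform pushes \<open>\<alpha>\<close> to \<open>\<beta>\<close>: perturbing \<open>f\<close> by \<open>h / n\<close> changes the functional at rate
  \<open>\<integral> h d\<beta> - \<integral> h (grad \<dots>) d\<alpha>\<close>, which has to vanish for all \<open>h\<close>.
\<close>

theorem brenier_map:
  fixes \<alpha> \<beta> :: "'a::euclidean_space measure"
  assumes R: "0 \<le> R"
    and \<alpha>: "finite_measure \<alpha>" "sets \<alpha> = sets borel" "AE x in \<alpha>. x \<in> cball 0 R"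
    and \<beta>: "finite_measure \<beta>" "sets \<beta> = sets borel" "AE x in \<beta>. x \<in> cball 0 R"
    and mass: "measure \<alpha> UNIV = measure \<beta> UNIV"
    and ac: "absolutely_continuous lborel \<alpha>"
  obtains f where "potential R f" "distr \<alpha> borel (grad (legendre R f)) = \<beta>"
proof -
  note int\<alpha> = integrable_concentrated[OF \<alpha>] and int\<beta> = integrable_concentrated[OF \<beta>]
  have sp: "space \<alpha> = UNIV" "space \<beta> = UNIV" using \<alpha>(2)[THEN sets_eq_imp_space_eq] \<beta>(2)[THEN sets_eq_imp_space_eq] by auto
  obtain f where f: "potential R f" and
    min: "\<And>g. continuous_on UNIV g \<Longrightarrow> dual_cost R \<alpha> \<beta> f \<le> dual_cost R \<alpha> \<beta> g"
    using dual_cost_minimizer[OF R \<alpha> \<beta> mass] by blast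
  note cf = potential_continuous[OF f]
  let ?T = "grad (legendre R f)"
  note cl = continuous_on_legendre[OF R cf]
  have T[measurable]: "?T \<in> borel_measurable borel"
    by (rule borel_measurable_grad) (rule borel_measurable_continuous_onI[OF cl])
  have [measurable_cong]: "sets \<alpha> = sets borel" by fact
  have T\<alpha>: "?T \<in> measurable \<alpha> borel" by measurable
  have AEl: "AE x in lborel. ?T x \<in> cball 0 R \<and> legendre R f x + f (?T x) = x \<bullet> ?T x
    \<and> (\<forall>p. subgradient (legendre R f) x p \<longrightarrow> p = ?T x)"
    by (rule AE_grad_legendre[OF R cf])
  have AE\<alpha>: "AE x in \<alpha>. ?T x \<in> cball 0 R \<and> legendre R f x + f (?T x) = x \<bullet> ?T x
    \<and> (\<forall>p. subgradient (legendre R f) x p \<longrightarrow> p = ?T x)"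
    by (rule absolutely_continuous_AE[OF _ ac AEl]) (use \<alpha> in simp)
  have le: "(\<integral>x. h (?T x) \<partial>\<alpha>) \<le> (\<integral>y. h y \<partial>\<beta>)"
    if h: "continuous_on UNIV h" "\<And>y. \<bar>h y\<bar> \<le> 1" for h :: "'a \<Rightarrow> real"
  proof -
    define q where "q n x = real (Suc n) * (legendre R (\<lambda>y. f y + h y / real (Suc n)) x - legendre R f x)" for n x
    have c: "continuous_on UNIV (\<lambda>y. f y + h y / real (Suc n))" for n by (intro continuous_intros cf h) auto
    have cl': "continuous_on UNIV (legendre R (\<lambda>y. f y + h y / real (Suc n)))" for n
      by (rule continuous_on_legendre[OF R c])
    have iq: "integrable \<alpha> (q n)" for n
      unfolding q_def using int\<alpha>[OF cl'] int\<alpha>[OF cl] by (intro integrable_mult_right Bochner_Integration.integrable_diff) auto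
    have hm: "h \<in> borel_measurable borel" by (rule borel_measurable_continuous_onI[OF h(1)])
    have bd: "\<bar>q n x\<bar> \<le> 1" for n x
    proof -
      have "\<bar>h y / real (Suc n)\<bar> \<le> 1 / real (Suc n)" for y
        using h(2)[of y] by (simp add: divide_right_mono)
      then have b: "f y + h y / real (Suc n) \<le> f y + 1 / real (Suc n)" "f y \<le> f y + h y / real (Suc n) + 1 / real (Suc n)" for y
        by (smt (verit))+
      have "\<bar>legendre R (\<lambda>y. f y + h y / real (Suc n)) x - legendre R f x\<bar> \<le> 1 / real (Suc n)"
        using legendre_diff_le[OF R cf c b(1), of x] legendre_diff_le[OF R c cf b(2), of x] by linarith
      then have "real (Suc n) * \<bar>legendre R (\<lambda>y. f y + h y / real (Suc n)) x - legendre R f x\<bar> \<le> real (Suc n) * (1 / real (Suc n))"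
        by (intro mult_left_mono) auto
      then show ?thesis by (simp add: q_def abs_mult)
    qed
    have nonneg: "0 \<le> (\<integral>x. q n x \<partial>\<alpha>) + (\<integral>y. h y \<partial>\<beta>)" for n
    proof -
      have "0 \<le> real (Suc n) * (dual_cost R \<alpha> \<beta> (\<lambda>y. f y + h y / real (Suc n)) - dual_cost R \<alpha> \<beta> f)"
        using min[OF c[of n]] by simp
      also have "dual_cost R \<alpha> \<beta> (\<lambda>y. f y + h y / real (Suc n)) =
         (\<integral>x. legendre R (\<lambda>y. f y + h y / real (Suc n)) x \<partial>\<alpha>) + ((\<integral>y. f y \<partial>\<beta>) + (\<integral>y. h y \<partial>\<beta>) / real (Suc n))"
        unfolding dual_cost_def using int\<beta>[OF cf] int\<beta>[OF h(1)] by simp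
      also have "real (Suc n) * (\<dots> - dual_cost R \<alpha> \<beta> f) =
        real (Suc n) * ((\<integral>x. legendre R (\<lambda>y. f y + h y / real (Suc n)) x \<partial>\<alpha>) - (\<integral>x. legendre R f x \<partial>\<alpha>)) + (\<integral>y. h y \<partial>\<beta>)"
        unfolding dual_cost_def by (simp add: field_simps)
      also have "real (Suc n) * ((\<integral>x. legendre R (\<lambda>y. f y + h y / real (Suc n)) x \<partial>\<alpha>) - (\<integral>x. legendre R f x \<partial>\<alpha>)) = (\<integral>x. q n x \<partial>\<alpha>)"
        unfolding q_def using int\<alpha>[OF cl', of n] int\<alpha>[OF cl] by simp
      finally show ?thesis .
    qed
    have "(\<lambda>n. \<integral>x. q n x \<partial>\<alpha>) \<longlonglongrightarrow> (\<integral>x. - h (?T x) \<partial>\<alpha>)"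
    proof (rule integral_dominated_convergence[where w="\<lambda>_. 1"])
      show "AE x in \<alpha>. (\<lambda>n. q n x) \<longlonglongrightarrow> - h (?T x)"
        using AE\<alpha> unfolding q_def
        by eventually_elim (rule legendre_perturb_tendsto[OF R cf h], auto)
      show "(\<lambda>x. - h (?T x)) \<in> borel_measurable \<alpha>" using hm by measurable
    qed (use \<alpha>(1) iq bd in \<open>auto simp: finite_measure.integrable_const\<close>)
    then have "(\<lambda>n. (\<integral>x. q n x \<partial>\<alpha>) + (\<integral>y. h y \<partial>\<beta>)) \<longlonglongrightarrow> (\<integral>x. - h (?T x) \<partial>\<alpha>) + (\<integral>y. h y \<partial>\<beta>)"
      by (intro tendsto_add tendsto_const)
    then have "0 \<le> (\<integral>x. - h (?T x) \<partial>\<alpha>) + (\<integral>y. h y \<partial>\<beta>)"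
      by (rule LIMSEQ_le_const) (use nonneg in blast)
    then show ?thesis by simp
  qed
  have "distr \<alpha> borel ?T = \<beta>"
  proof (rule finite_borel_measure_eqI)
    show "finite_measure (distr \<alpha> borel ?T)" by (rule finite_measure.finite_measure_distr[OF \<alpha>(1) T\<alpha>])
    fix h :: "'a \<Rightarrow> real" assume h: "continuous_on UNIV h" "\<And>x. \<bar>h x\<bar> \<le> 1"
    have "(\<integral>x. h x \<partial>distr \<alpha> borel ?T) = (\<integral>x. h (?T x) \<partial>\<alpha>)"
      by (rule integral_distr[OF T\<alpha>]) (rule borel_measurable_continuous_onI[OF h(1)])
    moreover have "(\<integral>x. h (?T x) \<partial>\<alpha>) \<le> (\<integral>y. h y \<partial>\<beta>)" by (rule le[OF h])
    moreover have "(\<integral>x. - h (?T x) \<partial>\<alpha>) \<le> (\<integral>y. - h y \<partial>\<beta>)"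
      by (rule le) (use h in \<open>auto intro!: continuous_intros\<close>)
    ultimately show "(\<integral>x. h x \<partial>distr \<alpha> borel ?T) = (\<integral>x. h x \<partial>\<beta>)" by simp
  qed (use \<beta> in auto)
  then show ?thesis using that f by blast
qed

section \<open>Uniqueness through the duality gap\<close>

lemma measurable_graph:
  fixes T :: "'a::euclidean_space \<Rightarrow> 'a"
  assumes "T \<in> borel_measurable borel"
  shows "(\<lambda>x. (x, T x)) \<in> borel_measurable borel"
  using assms by (intro borel_measurable_Pair) auto

lemma measurable_grad_legendre:
  assumes "0 \<le> R" "potential R f"
  shows "grad (legendre R f) \<in> borel_measurable borel"
  by (intro borel_measurable_grad borel_measurable_continuous_onI continuous_on_legendre[OF assms(1)]
      potential_continuous[OF assms(2)])

lemma AE_grad_in_cball: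
  assumes "0 \<le> R" "potential R f" "absolutely_continuous lborel \<alpha>" "sets \<alpha> = sets borel"
  shows "AE x in \<alpha>. grad (legendre R f) x \<in> cball 0 R
    \<and> legendre R f x + f (grad (legendre R f) x) = x \<bullet> grad (legendre R f) x
    \<and> (\<forall>p. subgradient (legendre R f) x p \<longrightarrow> p = grad (legendre R f) x)"
  by (rule absolutely_continuous_AE[OF _ assms(3) AE_grad_legendre[OF assms(1) potential_continuous[OF assms(2)]]])
     (use assms(4) in simp)

lemma integrable_concentrated_pair:
  fixes f :: "'a::euclidean_space \<times> 'a \<Rightarrow> real"
  assumes "finite_measure M" "sets M = sets borel"
    and AE: "AE z in M. fst z \<in> cball 0 R \<and> snd z \<in> cball 0 R" and "continuous_on UNIV f"
  shows "integrable M f"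
proof (rule integrable_concentrated[OF assms(1,2) _ assms(4), where R="R + R"])
  show "AE z in M. z \<in> cball 0 (R + R)"
    using AE
  proof eventually_elim
    case (elim z)
    then show ?case using norm_Pair_le[of "fst z" "snd z"] by auto
  qed
qed

text \<open>
  The integral of the duality gap against \<open>\<gamma>\<close> is the difference of the two correlations. If it vanishes,
  then \<open>\<gamma>\<close>-almost everywhere the second coordinate is a subgradient at the first one, hence the gradient.
\<close>

lemma
  fixes \<alpha> :: "'a::euclidean_space measure" and \<gamma> :: "('a \<times> 'a) measure"
  assumes R: "0 \<le> R" and f: "potential R f"
    and \<alpha>: "finite_measure \<alpha>" "sets \<alpha> = sets borel" "AE x in \<alpha>. x \<in> cball 0 R" "absolutely_continuous lborel \<alpha>"
    and \<gamma>: "sets \<gamma> = sets borel" "distr \<gamma> borel fst = \<alpha>"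
      "distr \<gamma> borel snd = distr \<alpha> borel (grad (legendre R f))"
  shows plan_inner_le: "(\<integral>z. fst z \<bullet> snd z \<partial>\<gamma>) \<le> (\<integral>x. x \<bullet> grad (legendre R f) x \<partial>\<alpha>)"
    and plan_unique: "(\<integral>x. x \<bullet> grad (legendre R f) x \<partial>\<alpha>) \<le> (\<integral>z. fst z \<bullet> snd z \<partial>\<gamma>) \<Longrightarrow>
      \<gamma> = distr \<alpha> borel (\<lambda>x. (x, grad (legendre R f) x))"
proof -
  let ?\<phi> = "legendre R f"
  let ?T = "grad ?\<phi>"
  have T[measurable]: "?T \<in> borel_measurable borel" by (rule measurable_grad_legendre[OF R f])
  have [measurable_cong]: "sets \<alpha> = sets borel" "sets \<gamma> = sets borel" by fact+
  have T\<alpha>: "?T \<in> measurable \<alpha> borel" by measurable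
  have fs: "fst \<in> measurable \<gamma> borel" "snd \<in> measurable \<gamma> borel"
    by (simp_all add: measurable_cong_sets[OF \<gamma>(1) refl] borel_measurable_continuous_onI continuous_on_fst continuous_on_snd continuous_on_id)
  have sp: "space \<alpha> = UNIV" "space \<gamma> = UNIV"
    using \<alpha>(2)[THEN sets_eq_imp_space_eq] \<gamma>(1)[THEN sets_eq_imp_space_eq] by auto
  have fin: "finite_measure \<gamma>"
  proof (rule finite_measureI)
    have "emeasure \<gamma> (space \<gamma>) = emeasure \<alpha> (space \<alpha>)"
      unfolding \<gamma>(2)[symmetric] using fs(1) by (subst emeasure_distr) (auto simp: sp)
    then show "emeasure \<gamma> (space \<gamma>) \<noteq> \<infinity>" using finite_measure.emeasure_finite[OF \<alpha>(1)] by simp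
  qed
  note AE\<alpha> = AE_grad_in_cball[OF R f \<alpha>(4,2)]
  have AE1: "AE z in \<gamma>. fst z \<in> cball 0 R \<and> (\<forall>p. subgradient ?\<phi> (fst z) p \<longrightarrow> p = ?T (fst z))"
    by (rule AE_distrD[OF fs(1)]) (use \<alpha>(3) AE\<alpha> in \<open>unfold \<gamma>(2), eventually_elim, auto\<close>)
  have AE2: "AE z in \<gamma>. snd z \<in> cball 0 R"
  proof (rule AE_distrD[OF fs(2)])
    show "AE y in distr \<gamma> borel snd. y \<in> cball 0 R"
      unfolding \<gamma>(3) using AE\<alpha> by (subst AE_distr_iff[OF T\<alpha>]) auto
  qed
  have AEc: "AE z in \<gamma>. fst z \<in> cball 0 R \<and> snd z \<in> cball 0 R" using AE1 AE2 by eventually_elim auto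
  note ip = integrable_concentrated_pair[OF fin \<gamma>(1) AEc]
  note i\<alpha> = integrable_concentrated[OF \<alpha>(1-3)]
  have cf: "continuous_on UNIV f" by (rule potential_continuous[OF f])
  note c\<phi> = continuous_on_legendre[OF R cf]
  define gap where "gap z = ?\<phi> (fst z) + f (snd z) - fst z \<bullet> snd z" for z
  have i1: "integrable \<gamma> (\<lambda>z. ?\<phi> (fst z))"
    by (intro ip continuous_on_compose2[OF c\<phi>] continuous_intros) auto
  have i2: "integrable \<gamma> (\<lambda>z. f (snd z))"
    by (intro ip continuous_on_compose2[OF cf] continuous_intros) auto
  have i3: "integrable \<gamma> (\<lambda>z. fst z \<bullet> snd z)"
    by (intro ip continuous_intros)
  have igap: "integrable \<gamma> gap" unfolding gap_def[abs_def] using i1 i2 i3 by auto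
  have gap_nonneg: "AE z in \<gamma>. 0 \<le> gap z"
    using AE2 by eventually_elim (use fenchel_young[OF R cf] in \<open>auto simp: gap_def\<close>)
  have i2T: "integrable \<alpha> (\<lambda>x. f (?T x))"
  proof -
    have "integrable (distr \<gamma> borel snd) f"
      using i2 fs(2) borel_measurable_continuous_onI[OF cf] by (subst integrable_distr_eq) auto
    then show ?thesis
      unfolding \<gamma>(3) using T\<alpha> borel_measurable_continuous_onI[OF cf] by (subst (asm) integrable_distr_eq) auto
  qed
  have "(\<integral>z. gap z \<partial>\<gamma>) = (\<integral>z. ?\<phi> (fst z) \<partial>\<gamma>) + (\<integral>z. f (snd z) \<partial>\<gamma>) - (\<integral>z. fst z \<bullet> snd z \<partial>\<gamma>)"
    unfolding gap_def using i1 i2 i3 by simp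
  also have "(\<integral>z. ?\<phi> (fst z) \<partial>\<gamma>) = (\<integral>x. ?\<phi> x \<partial>\<alpha>)"
    unfolding \<gamma>(2)[symmetric] using fs(1) borel_measurable_continuous_onI[OF c\<phi>] by (subst integral_distr) auto
  also have "(\<integral>z. f (snd z) \<partial>\<gamma>) = (\<integral>x. f (?T x) \<partial>\<alpha>)"
    using integral_distr[OF fs(2) borel_measurable_continuous_onI[OF cf]]
      integral_distr[OF T\<alpha> borel_measurable_continuous_onI[OF cf]] \<gamma>(3) by simp
  also have "(\<integral>x. ?\<phi> x \<partial>\<alpha>) + (\<integral>x. f (?T x) \<partial>\<alpha>) = (\<integral>x. ?\<phi> x + f (?T x) \<partial>\<alpha>)"
    using i\<alpha>[OF c\<phi>] i2T by simp
  also have "\<dots> = (\<integral>x. x \<bullet> ?T x \<partial>\<alpha>)"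
    using AE\<alpha> i\<alpha>[OF c\<phi>] i2T
    by (intro integral_cong_AE) (auto elim: eventually_mono)
  finally have eq: "(\<integral>z. gap z \<partial>\<gamma>) = (\<integral>x. x \<bullet> ?T x \<partial>\<alpha>) - (\<integral>z. fst z \<bullet> snd z \<partial>\<gamma>)" .
  show "(\<integral>z. fst z \<bullet> snd z \<partial>\<gamma>) \<le> (\<integral>x. x \<bullet> ?T x \<partial>\<alpha>)"
    using integral_nonneg_AE[OF gap_nonneg] eq by linarith
  assume "(\<integral>x. x \<bullet> ?T x \<partial>\<alpha>) \<le> (\<integral>z. fst z \<bullet> snd z \<partial>\<gamma>)"
  then have "(\<integral>z. gap z \<partial>\<gamma>) = 0" using integral_nonneg_AE[OF gap_nonneg] eq by linarith
  then have gap0: "AE z in \<gamma>. gap z = 0" using integral_nonneg_eq_0_iff_AE[OF igap gap_nonneg] by simp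
  have snd_eq: "AE z in \<gamma>. snd z = ?T (fst z)"
    using gap0 AE1 AE2
  proof eventually_elim
    case (elim z)
    then have "subgradient ?\<phi> (fst z) (snd z)" by (intro subgradient_legendre[OF R cf]) (auto simp: gap_def)
    then show ?case using elim by blast
  qed
  have gm: "(\<lambda>x. (x, ?T x)) \<in> measurable borel borel" by (rule measurable_graph[OF T])
  have "\<gamma> = distr \<gamma> borel (\<lambda>z. z)" by (rule distr_id2[symmetric]) (use \<gamma> in simp)
  also have "\<dots> = distr \<gamma> borel (\<lambda>z. (fst z, ?T (fst z)))"
  proof (rule distr_cong_AE)
    show "AE z in \<gamma>. z = (fst z, ?T (fst z))" using snd_eq by eventually_elim (auto simp: prod_eq_iff)
    show "(\<lambda>z. z) \<in> \<gamma> \<rightarrow>\<^sub>M borel" using \<gamma>(1) by (simp add: measurable_ident_sets)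
    show "(\<lambda>z. (fst z, ?T (fst z))) \<in> \<gamma> \<rightarrow>\<^sub>M borel"
      using measurable_compose[OF fs(1) gm] by simp
  qed auto
  also have "\<dots> = distr (distr \<gamma> borel fst) borel (\<lambda>x. (x, ?T x))"
    by (subst distr_distr[OF gm fs(1)]) (simp add: o_def)
  finally show "\<gamma> = distr \<alpha> borel (\<lambda>x. (x, ?T x))" unfolding \<gamma>(2) .
qed

section \<open>Measures on subsets of the ambient space\<close>

definition ambient :: "'b::topological_space measure \<Rightarrow> 'b measure" where
  "ambient M = distr M borel (\<lambda>x. x)"

lemma sets_ambient [simp]: "sets (ambient M) = sets borel"
  and space_ambient [simp]: "space (ambient M) = UNIV"
  by (simp_all add: ambient_def)

lemma space_measure_on: "measure_on S M \<Longrightarrow> space M = S"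
  unfolding measure_on_def by (drule sets_eq_imp_space_eq) (simp add: space_restrict_space)

lemma sets_measure_on: "measure_on S M \<Longrightarrow> sets M = (\<lambda>B. B \<inter> S) ` sets borel"
  unfolding measure_on_def by (auto simp: sets_restrict_space)

lemma measurable_inclusion: "measure_on S M \<Longrightarrow> (\<lambda>x. x) \<in> measurable M borel"
  by (rule measurableI) (auto simp: sets_measure_on space_measure_on)

lemma measurable_measure_on: "measure_on S M \<Longrightarrow> f \<in> measurable borel N \<Longrightarrow> f \<in> measurable M N"
  using measurable_compose[OF measurable_inclusion] by blast

lemma emeasure_ambient:
  "measure_on S M \<Longrightarrow> B \<in> sets borel \<Longrightarrow> emeasure (ambient M) B = emeasure M (B \<inter> S)"
  unfolding ambient_def by (subst emeasure_distr[OF measurable_inclusion]) (auto simp: space_measure_on)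

lemma nn_integral_ambient:
  "measure_on S M \<Longrightarrow> f \<in> borel_measurable borel \<Longrightarrow> (\<integral>\<^sup>+x. f x \<partial>ambient M) = (\<integral>\<^sup>+x. f x \<partial>M)"
  unfolding ambient_def by (subst nn_integral_distr[OF measurable_inclusion]) auto

lemma integral_ambient:
  fixes f :: "'b::topological_space \<Rightarrow> real"
  shows "measure_on S M \<Longrightarrow> f \<in> borel_measurable borel \<Longrightarrow> (\<integral>x. f x \<partial>ambient M) = (\<integral>x. f x \<partial>M)"
  unfolding ambient_def by (subst integral_distr[OF measurable_inclusion]) auto

lemma finite_measure_ambient: "measure_on S M \<Longrightarrow> finite_measure M \<Longrightarrow> finite_measure (ambient M)"
  unfolding ambient_def by (rule finite_measure.finite_measure_distr[OF _ measurable_inclusion])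

lemma ambient_inject:
  assumes "measure_on S M" "measure_on S N" "ambient M = ambient N"
  shows "M = N"
proof (rule measure_eqI)
  show "sets M = sets N" using assms by (simp add: measure_on_def)
  fix A assume "A \<in> sets M"
  then obtain B where "B \<in> sets borel" "A = B \<inter> S" using sets_measure_on[OF assms(1)] by auto
  then show "emeasure M A = emeasure N A"
    using emeasure_ambient[OF assms(1), of B] emeasure_ambient[OF assms(2), of B] assms(3) by simp
qed

lemma AE_ambient_closed:
  assumes "measure_on S M" "S \<subseteq> C" "closed C"
  shows "AE x in ambient M. x \<in> C"
  unfolding ambient_def using assms space_measure_on[OF assms(1)]
  by (subst AE_distr_iff[OF measurable_inclusion[OF assms(1)]]) (auto intro!: AE_I2)

text \<open>
  Any two Borel sets with the same trace on \<open>S\<close> differ by Borel sets that miss \<open>S\<close>, which are null by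
  inner regularity. The measure of a trace is therefore well defined, also when \<open>S\<close> is not measurable.
\<close>

lemma trace_measure_exists:
  fixes \<gamma> :: "'b::euclidean_space measure"
  assumes fin: "finite_measure \<gamma>" and sb: "sets \<gamma> = sets borel"
    and null: "\<And>K. compact K \<Longrightarrow> K \<inter> S = {} \<Longrightarrow> emeasure \<gamma> K = 0"
  obtains \<pi> where "measure_on S \<pi>" "ambient \<pi> = \<gamma>"
proof -
  have sp: "space \<gamma> = UNIV" using sb[THEN sets_eq_imp_space_eq] by simp
  have null': "emeasure \<gamma> B = 0" if B: "B \<in> sets borel" "B \<inter> S = {}" for B
  proof -
    have "emeasure \<gamma> B = (SUP K \<in> {K. K \<subseteq> B \<and> compact K}. emeasure \<gamma> K)"
      by (rule inner_regular) (use sb B finite_measure.emeasure_finite[OF fin] in auto)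
    also have "\<dots> \<le> 0" by (rule SUP_least) (use null B(2) in auto)
    finally show ?thesis by simp
  qed
  have eq: "emeasure \<gamma> B = emeasure \<gamma> B'" if B: "B \<in> sets borel" "B' \<in> sets borel" "B \<inter> S = B' \<inter> S" for B B'
  proof -
    have "emeasure \<gamma> B = emeasure \<gamma> (B \<inter> B') + emeasure \<gamma> (B - B')"
      using B sb by (subst plus_emeasure) (auto intro!: arg_cong[where f="emeasure \<gamma>"])
    moreover have "emeasure \<gamma> B' = emeasure \<gamma> (B \<inter> B') + emeasure \<gamma> (B' - B)"
      using B sb by (subst plus_emeasure) (auto intro!: arg_cong[where f="emeasure \<gamma>"])
    moreover have "emeasure \<gamma> (B - B') = 0" "emeasure \<gamma> (B' - B) = 0"
      using B by (auto intro!: null')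
    ultimately show ?thesis by simp
  qed
  \<comment> \<open>a Borel set whose trace is \<open>A\<close>\<close>
  define lift where "lift A = (SOME B. B \<in> sets borel \<and> B \<inter> S = A)" for A
  have lift: "lift A \<in> sets borel" "lift A \<inter> S = A" if "A \<in> sets (restrict_space borel S)" for A
    using that someI_ex[of "\<lambda>B. B \<in> sets borel \<and> B \<inter> S = A"] unfolding lift_def
    by (auto simp: sets_restrict_space)
  define \<pi> where "\<pi> = measure_of S (sets (restrict_space borel S)) (\<lambda>A. emeasure \<gamma> (lift A))"
  have sa: "sigma_algebra S (sets (restrict_space borel S))"
    using sets.sigma_algebra_axioms[of "restrict_space borel S"] by (simp add: space_restrict_space)
  have sets_\<pi>: "sets \<pi> = sets (restrict_space borel S)"
    unfolding \<pi>_def using sigma_algebra.sets_measure_of_eq[OF sa] by simp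
  then have on: "measure_on S \<pi>" by (simp add: measure_on_def)
  have ca: "countably_additive (sets (restrict_space borel S)) (\<lambda>A. emeasure \<gamma> (lift A))"
  proof (rule countably_additiveI)
    fix A :: "nat \<Rightarrow> 'b set"
    assume A: "range A \<subseteq> sets (restrict_space borel S)" "disjoint_family A" "(\<Union>i. A i) \<in> sets (restrict_space borel S)"
    \<comment> \<open>the lifts of disjoint traces overlap in null sets only; removing the overlaps makes them disjoint\<close>
    define D where "D i = lift (A i) - (\<Union>j<i. lift (A j))" for i
    have l: "lift (A i) \<in> sets borel" "lift (A i) \<inter> S = A i" for i using lift A(1) by auto
    have Dm: "D i \<in> sets borel" for i unfolding D_def using l(1) by auto
    have DS: "D i \<inter> S = A i" for i
    proof -
      have "A i \<inter> A j = {}" if "j < i" for j using A(2) that unfolding disjoint_family_on_def by auto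
      moreover have "D i \<inter> S = A i - (\<Union>j<i. A j)" unfolding D_def using l(2) by blast
      ultimately show ?thesis by blast
    qed
    have disj: "disjoint_family D"
      unfolding disjoint_family_on_def D_def
    proof (intro ballI impI)
      fix m n :: nat assume "m \<noteq> n"
      then consider "m < n" | "n < m" by linarith
      then show "(lift (A m) - (\<Union>j<m. lift (A j))) \<inter> (lift (A n) - (\<Union>j<n. lift (A j))) = {}"
        by cases auto
    qed
    have "(\<Sum>i. emeasure \<gamma> (lift (A i))) = (\<Sum>i. emeasure \<gamma> (D i))"
      by (intro arg_cong[where f=suminf] ext eq) (use l Dm DS in auto)
    also have "\<dots> = emeasure \<gamma> (\<Union>i. D i)"
      by (rule suminf_emeasure[OF _ disj]) (use Dm sb in auto)
    also have "\<dots> = emeasure \<gamma> (lift (\<Union>i. A i))"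
    proof (rule eq)
      show "(\<Union>i. D i) \<inter> S = lift (\<Union>i. A i) \<inter> S" unfolding lift(2)[OF A(3)] using DS by blast
    qed (use Dm lift A in auto)
    finally show "(\<Sum>i. emeasure \<gamma> (lift (A i))) = emeasure \<gamma> (lift (\<Union>i. A i))" .
  qed
  have pos: "positive (sets (restrict_space borel S)) (\<lambda>A. emeasure \<gamma> (lift A))"
    unfolding positive_def using null'[of "lift {}"] lift[of "{}"] by simp
  have em: "emeasure \<pi> A = emeasure \<gamma> (lift A)" if "A \<in> sets (restrict_space borel S)" for A
    unfolding \<pi>_def by (rule emeasure_measure_of_sigma[OF sa pos ca that])
  have "ambient \<pi> = \<gamma>"
  proof (rule measure_eqI)
    fix B assume "B \<in> sets (ambient \<pi>)"
    then have B: "B \<in> sets borel" by simp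
    then have BS: "B \<inter> S \<in> sets (restrict_space borel S)" by (auto simp: sets_restrict_space)
    have "emeasure (ambient \<pi>) B = emeasure \<gamma> (lift (B \<inter> S))"
      using emeasure_ambient[OF on B] em[OF BS] by simp
    also have "\<dots> = emeasure \<gamma> B" by (rule eq) (use lift[OF BS] B in auto)
    finally show "emeasure (ambient \<pi>) B = emeasure \<gamma> B" .
  qed (use sb in simp)
  then show ?thesis using that on by blast
qed

lemma measurable_fst_snd_borel:
  "(fst :: 'a::euclidean_space \<times> 'b::euclidean_space \<Rightarrow> 'a) \<in> borel_measurable borel"
  "(snd :: 'a::euclidean_space \<times> 'b::euclidean_space \<Rightarrow> 'b) \<in> borel_measurable borel"
  by (auto intro!: borel_measurable_continuous_onI continuous_intros)

lemma measurable_measure_on_pair: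
  fixes \<pi> :: "('a::euclidean_space \<times> 'b::euclidean_space) measure"
  assumes "measure_on (X \<times> Y) \<pi>"
  shows "fst \<in> measurable \<pi> (restrict_space borel X)" "snd \<in> measurable \<pi> (restrict_space borel Y)"
proof -
  note sp = space_measure_on[OF assms]
  show "fst \<in> measurable \<pi> (restrict_space borel X)"
    by (rule measurable_restrict_space2[OF _ measurable_measure_on[OF assms measurable_fst_snd_borel(1)]])
       (simp add: sp Pi_iff)
  show "snd \<in> measurable \<pi> (restrict_space borel Y)"
    by (rule measurable_restrict_space2[OF _ measurable_measure_on[OF assms measurable_fst_snd_borel(2)]])
       (simp add: sp Pi_iff)
qed

lemma measure_on_marginals:
  "measure_on X (fst_marginal X \<pi>)" "measure_on Y (snd_marginal Y \<pi>)"
  by (simp_all add: measure_on_def fst_marginal_def snd_marginal_def)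

lemma ambient_marginals:
  fixes \<pi> :: "('a::euclidean_space \<times> 'b::euclidean_space) measure"
  assumes "measure_on (X \<times> Y) \<pi>"
  shows "ambient (fst_marginal X \<pi>) = distr (ambient \<pi>) borel fst"
    and "ambient (snd_marginal Y \<pi>) = distr (ambient \<pi>) borel snd"
proof -
  have i: "(\<lambda>x. x) \<in> measurable (restrict_space borel S) borel" for S :: "'c::topological_space set"
    by (rule measurable_restrict_space1) simp
  show "ambient (fst_marginal X \<pi>) = distr (ambient \<pi>) borel fst"
    unfolding ambient_def fst_marginal_def
    by (simp add: distr_distr[OF i measurable_measure_on_pair(1)[OF assms]]
        distr_distr[OF measurable_fst_snd_borel(1) measurable_inclusion[OF assms]] o_def)
  show "ambient (snd_marginal Y \<pi>) = distr (ambient \<pi>) borel snd"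
    unfolding ambient_def snd_marginal_def
    by (simp add: distr_distr[OF i measurable_measure_on_pair(2)[OF assms]]
        distr_distr[OF measurable_fst_snd_borel(2) measurable_inclusion[OF assms]] o_def)
qed

lemma couplings_iff:
  fixes \<pi> :: "('a::euclidean_space \<times> 'b::euclidean_space) measure"
  assumes "measure_on X \<alpha>" "measure_on Y \<beta>"
  shows "\<pi> \<in> couplings X Y \<alpha> \<beta> \<longleftrightarrow> measure_on (X \<times> Y) \<pi> \<and>
    distr (ambient \<pi>) borel fst = ambient \<alpha> \<and> distr (ambient \<pi>) borel snd = ambient \<beta>"
proof -
  have "fst_marginal X \<pi> = \<alpha> \<longleftrightarrow> ambient (fst_marginal X \<pi>) = ambient \<alpha>"
    by (rule iffI[OF _ ambient_inject[OF measure_on_marginals(1) assms(1)]]) simp_all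
  moreover have "snd_marginal Y \<pi> = \<beta> \<longleftrightarrow> ambient (snd_marginal Y \<pi>) = ambient \<beta>"
    by (rule iffI[OF _ ambient_inject[OF measure_on_marginals(2) assms(2)]]) simp_all
  ultimately show ?thesis
    by (cases "measure_on (X \<times> Y) \<pi>") (simp_all add: couplings_def ambient_marginals[of X Y \<pi>])
qed

lemma restrict_meas_ambient:
  assumes M: "measure_on S M" and B: "B \<in> sets borel" and A: "A \<inter> S = B \<inter> S"
  shows "measure_on S (restrict_meas M A)"
    and "ambient (restrict_meas M A) = density (ambient M) (indicator B)"
    and "finite_measure M \<Longrightarrow> finite_measure (restrict_meas M A)"
proof -
  have eq: "restrict_meas M A = density M (indicator B)"
    unfolding restrict_meas_def
  proof (rule density_cong)
    show "AE x in M. (indicator A x :: ennreal) = indicator B x"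
      using A space_measure_on[OF M] by (intro AE_I2) (auto split: split_indicator)
    have 1: "(indicator B :: _ \<Rightarrow> ennreal) \<in> borel_measurable M"
      by (rule measurable_measure_on[OF M]) (use B in simp)
    show "(indicator A :: _ \<Rightarrow> ennreal) \<in> borel_measurable M"
      using A space_measure_on[OF M] by (subst measurable_cong[OF _ , where g="indicator B"]) (auto simp: 1 split: split_indicator)
    show "(indicator B :: _ \<Rightarrow> ennreal) \<in> borel_measurable M" by (rule 1)
  qed
  show on: "measure_on S (restrict_meas M A)" using M by (simp add: restrict_meas_def measure_on_def)
  have BM: "B \<inter> S \<in> sets M" using sets_measure_on[OF M] B by blast
  have em: "emeasure (restrict_meas M A) (D \<inter> S) = emeasure M (D \<inter> B \<inter> S)" if D: "D \<in> sets borel" for D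
  proof -
    have "D \<inter> S \<in> sets M" using sets_measure_on[OF M] D by blast
    moreover have "(indicator B :: _ \<Rightarrow> ennreal) \<in> borel_measurable M"
      by (rule measurable_measure_on[OF M]) (use B in simp)
    ultimately have "emeasure (restrict_meas M A) (D \<inter> S) = (\<integral>\<^sup>+x. indicator B x * indicator (D \<inter> S) x \<partial>M)"
      unfolding eq by (rule emeasure_density[rotated])
    also have "\<dots> = (\<integral>\<^sup>+x. indicator (D \<inter> B \<inter> S) x \<partial>M)"
      by (intro nn_integral_cong) (auto split: split_indicator)
    also have "\<dots> = emeasure M (D \<inter> B \<inter> S)"
      by (rule nn_integral_indicator) (use sets_measure_on[OF M] D B in auto)
    finally show ?thesis .
  qed
  show "ambient (restrict_meas M A) = density (ambient M) (indicator B)"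
  proof (rule measure_eqI)
    fix D assume "D \<in> sets (ambient (restrict_meas M A))"
    then have D: "D \<in> sets borel" by simp
    have "emeasure (density (ambient M) (indicator B)) D = emeasure (ambient M) (B \<inter> D)"
      using B D by (simp add: emeasure_restricted)
    then show "emeasure (ambient (restrict_meas M A)) D = emeasure (density (ambient M) (indicator B)) D"
      using emeasure_ambient[OF on D] em[OF D] emeasure_ambient[OF M, of "B \<inter> D"] B D by (simp add: Int_commute)
  qed simp
  assume "finite_measure M"
  then show "finite_measure (restrict_meas M A)"
    using em[of UNIV] space_measure_on[OF on] finite_measure.emeasure_finite[of M]
    by (intro finite_measureI) auto
qed

section \<open>The cell problems\<close>

lemma couplings_finite:
  assumes "\<pi> \<in> couplings X Y \<alpha> \<beta>" "finite_measure \<alpha>"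
  shows "finite_measure (\<pi> :: ('a::euclidean_space \<times> 'a) measure)"
proof -
  have on: "measure_on (X \<times> Y) \<pi>" and \<alpha>: "\<alpha> = fst_marginal X \<pi>" using assms(1) by (auto simp: couplings_def)
  have "emeasure \<alpha> (space \<alpha>) = emeasure \<pi> (space \<pi>)"
    unfolding \<alpha> fst_marginal_def using measurable_measure_on_pair(1)[OF on]
    by (subst emeasure_distr) (auto intro!: arg_cong[where f="emeasure \<pi>"] dest: measurable_space)
  then show ?thesis using finite_measure.emeasure_finite[OF assms(2)] by (intro finite_measureI) auto
qed

text \<open>
  Expanding the square leaves the correlation as the only term that depends on more than the marginals.
\<close>

lemma transport_cost_ambient:
  fixes \<pi> :: "('a::euclidean_space \<times> 'a) measure"
  assumes on: "measure_on (X \<times> Y) \<pi>" and fin: "finite_measure \<pi>" and XY: "X \<subseteq> cball 0 R" "Y \<subseteq> cball 0 R"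
    and marg: "distr (ambient \<pi>) borel fst = \<alpha>" "distr (ambient \<pi>) borel snd = \<beta>"
  shows "transport_cost \<pi> = ennreal ((\<integral>x. x \<bullet> x \<partial>\<alpha>) + (\<integral>y. y \<bullet> y \<partial>\<beta>) - 2 * (\<integral>z. fst z \<bullet> snd z \<partial>ambient \<pi>))"
    and "0 \<le> (\<integral>x. x \<bullet> x \<partial>\<alpha>) + (\<integral>y. y \<bullet> y \<partial>\<beta>) - 2 * (\<integral>z. fst z \<bullet> snd z \<partial>ambient \<pi>)"
proof -
  let ?\<gamma> = "ambient \<pi>"
  have AE: "AE z in ?\<gamma>. z \<in> cball 0 R \<times> cball 0 R"
    by (rule AE_ambient_closed[OF on]) (use XY in \<open>auto intro!: closed_Times\<close>)
  have AE': "AE z in ?\<gamma>. fst z \<in> cball 0 R \<and> snd z \<in> cball 0 R"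
    using AE by eventually_elim auto
  note int = integrable_concentrated_pair[OF finite_measure_ambient[OF on fin] sets_ambient AE']
  have i: "integrable ?\<gamma> (\<lambda>z. fst z \<bullet> fst z)" "integrable ?\<gamma> (\<lambda>z. snd z \<bullet> snd z)" "integrable ?\<gamma> (\<lambda>z. fst z \<bullet> snd z)"
    by (intro int continuous_intros)+
  have i4: "integrable ?\<gamma> (\<lambda>z. (norm (fst z - snd z))\<^sup>2)" by (intro int continuous_intros)
  have fs: "fst \<in> measurable ?\<gamma> borel" "snd \<in> measurable ?\<gamma> borel"
    using measurable_fst_snd_borel by (simp_all add: measurable_cong_sets[OF sets_ambient refl])
  have m: "(\<lambda>x::'a. x \<bullet> x) \<in> borel_measurable borel" by simp
  have eq: "(\<integral>z. (norm (fst z - snd z))\<^sup>2 \<partial>?\<gamma>) = (\<integral>x. x \<bullet> x \<partial>\<alpha>) + (\<integral>y. y \<bullet> y \<partial>\<beta>) - 2 * (\<integral>z. fst z \<bullet> snd z \<partial>?\<gamma>)"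
  proof -
    have "(\<integral>z. (norm (fst z - snd z))\<^sup>2 \<partial>?\<gamma>) = (\<integral>z. fst z \<bullet> fst z + snd z \<bullet> snd z - 2 * (fst z \<bullet> snd z) \<partial>?\<gamma>)"
      by (intro Bochner_Integration.integral_cong refl)
         (simp add: power2_norm_eq_inner inner_diff_left inner_diff_right inner_commute)
    also have "\<dots> = (\<integral>z. fst z \<bullet> fst z \<partial>?\<gamma>) + (\<integral>z. snd z \<bullet> snd z \<partial>?\<gamma>) - 2 * (\<integral>z. fst z \<bullet> snd z \<partial>?\<gamma>)"
      using i by simp
    finally show ?thesis
      unfolding marg[symmetric] integral_distr[OF fs(1) m] integral_distr[OF fs(2) m] .
  qed
  have "transport_cost \<pi> = (\<integral>\<^sup>+z. ennreal ((norm (fst z - snd z))\<^sup>2) \<partial>?\<gamma>)"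
    unfolding transport_cost_def case_prod_unfold
    by (subst nn_integral_ambient[OF on])
       (auto intro!: measurable_compose[OF _ measurable_ennreal] borel_measurable_continuous_onI continuous_intros)
  also have "\<dots> = ennreal (\<integral>z. (norm (fst z - snd z))\<^sup>2 \<partial>?\<gamma>)"
    by (rule nn_integral_eq_integral[OF i4]) simp
  finally show "transport_cost \<pi> = ennreal ((\<integral>x. x \<bullet> x \<partial>\<alpha>) + (\<integral>y. y \<bullet> y \<partial>\<beta>) - 2 * (\<integral>z. fst z \<bullet> snd z \<partial>?\<gamma>))"
    unfolding eq .
  have "0 \<le> (\<integral>z. (norm (fst z - snd z))\<^sup>2 \<partial>?\<gamma>)" by simp
  then show "0 \<le> (\<integral>x. x \<bullet> x \<partial>\<alpha>) + (\<integral>y. y \<bullet> y \<partial>\<beta>) - 2 * (\<integral>z. fst z \<bullet> snd z \<partial>?\<gamma>)" unfolding eq .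
qed

text \<open>
  The hypothetical coupling \<open>\<pi>1\<close> only serves to make \<open>\<beta>\<close> a marginal with the right mass. The graph plan
  charges \<open>X \<times> Y\<close>, because the projection of a compact set that misses \<open>X \<times> Y\<close> is a compact set that
  misses \<open>Y\<close>.
\<close>

theorem optimal_plan_ex1:
  fixes X Y :: "'a::euclidean_space set"
  assumes R: "0 \<le> R" and X: "closed X" "X \<subseteq> cball 0 R" and Y: "Y \<subseteq> cball 0 R"
    and \<alpha>: "measure_on X \<alpha>" "finite_measure \<alpha>" "absolutely_continuous lborel (ambient \<alpha>)"
    and \<pi>1: "\<pi>1 \<in> couplings X Y \<alpha> \<beta>"
  obtains f \<pi> where "potential R f" "\<pi> \<in> couplings X Y \<alpha> \<beta>"
    "ambient \<pi> = distr (ambient \<alpha>) borel (\<lambda>x. (x, grad (legendre R f) x))"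
    "distr (ambient \<alpha>) borel (grad (legendre R f)) = ambient \<beta>"
    "\<And>\<rho>. optimal_plan X Y \<alpha> \<beta> \<rho> \<longleftrightarrow> \<rho> = \<pi>"
proof -
  have \<beta>: "measure_on Y \<beta>" using \<pi>1 measure_on_marginals(2)[of Y \<pi>1] by (auto simp: couplings_def)
  have on1: "measure_on (X \<times> Y) \<pi>1" using \<pi>1 by (simp add: couplings_def)
  have fin1: "finite_measure \<pi>1" by (rule couplings_finite[OF \<pi>1 \<alpha>(2)])
  have m1: "distr (ambient \<pi>1) borel fst = ambient \<alpha>" "distr (ambient \<pi>1) borel snd = ambient \<beta>"
    using \<pi>1 couplings_iff[OF \<alpha>(1) \<beta>] by auto
  have fs: "fst \<in> measurable (ambient \<rho>) borel" "snd \<in> measurable (ambient \<rho>) borel" for \<rho> :: "('a \<times> 'a) measure"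
    using measurable_fst_snd_borel by (simp_all add: measurable_cong_sets[OF sets_ambient refl])
  have fa: "finite_measure (ambient \<alpha>)" by (rule finite_measure_ambient[OF \<alpha>(1,2)])
  have fb: "finite_measure (ambient \<beta>)"
    unfolding m1(2)[symmetric] by (intro finite_measure.finite_measure_distr finite_measure_ambient[OF on1 fin1] fs)
  have mass: "measure (ambient \<alpha>) UNIV = measure (ambient \<beta>) UNIV"
    unfolding m1[symmetric] by (simp add: measure_distr fs)
  have Xa: "AE x in ambient \<alpha>. x \<in> cball 0 R" by (rule AE_ambient_closed[OF \<alpha>(1) X(2)]) simp
  have Yb: "AE x in ambient \<beta>. x \<in> cball 0 R" by (rule AE_ambient_closed[OF \<beta> Y]) simp
  obtain f where f: "potential R f" "distr (ambient \<alpha>) borel (grad (legendre R f)) = ambient \<beta>"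
    by (rule brenier_map[OF R fa sets_ambient Xa fb sets_ambient Yb mass \<alpha>(3)])
  let ?T = "grad (legendre R f)"
  have T: "?T \<in> borel_measurable borel" by (rule measurable_grad_legendre[OF R f(1)])
  have G: "(\<lambda>x. (x, ?T x)) \<in> borel_measurable borel" by (rule measurable_graph[OF T])
  define \<gamma> where "\<gamma> = distr (ambient \<alpha>) borel (\<lambda>x. (x, ?T x))"
  have Ta: "?T \<in> measurable (ambient \<alpha>) borel" and Ga: "(\<lambda>x. (x, ?T x)) \<in> measurable (ambient \<alpha>) borel"
    using T G by (simp_all add: measurable_cong_sets[OF sets_ambient refl])
  have g1: "distr \<gamma> borel fst = ambient \<alpha>"
    unfolding \<gamma>_def by (subst distr_distr[OF measurable_fst_snd_borel(1) Ga]) (simp add: o_def distr_id2)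
  have g2: "distr \<gamma> borel snd = ambient \<beta>"
    unfolding \<gamma>_def f(2)[symmetric] by (subst distr_distr[OF measurable_fst_snd_borel(2) Ga]) (simp add: o_def)
  have finG: "finite_measure \<gamma>" unfolding \<gamma>_def by (rule finite_measure.finite_measure_distr[OF fa Ga])
  have sG: "sets \<gamma> = sets borel" by (simp add: \<gamma>_def)
  have fG: "fst \<in> measurable \<gamma> borel" "snd \<in> measurable \<gamma> borel"
    using measurable_fst_snd_borel by (simp_all add: measurable_cong_sets[OF sG refl])
  have spG: "space \<gamma> = UNIV" by (simp add: \<gamma>_def)
  obtain \<pi> where \<pi>: "measure_on (X \<times> Y) \<pi>" "ambient \<pi> = \<gamma>"
  proof (rule trace_measure_exists[OF finG sG])
    fix K :: "('a \<times> 'a) set" assume K: "compact K" "K \<inter> (X \<times> Y) = {}"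
    define K' where "K' = K \<inter> (X \<times> UNIV)"
    have K': "compact K'" unfolding K'_def using K(1) X(1) by (intro compact_Int_closed closed_Times) auto
    have "compact (snd ` K')" using K' by (intro compact_continuous_image continuous_intros)
    then have c: "snd ` K' \<in> sets borel" by (simp add: borel_compact)
    have cX: "X \<in> sets borel" using X(1) by simp
    have sub: "K \<subseteq> fst -` (- X) \<union> snd -` (snd ` K')"
    proof
      fix z assume "z \<in> K"
      then have "fst z \<in> X \<Longrightarrow> z \<in> K'" by (simp add: K'_def mem_Times_iff)
      then show "z \<in> fst -` (- X) \<union> snd -` (snd ` K')" by auto
    qed
    have "emeasure \<gamma> K \<le> emeasure \<gamma> (fst -` (- X) \<union> snd -` (snd ` K'))"
      using cX measurable_sets[OF fG(1), of "- X"] measurable_sets[OF fG(2) c]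
      by (intro emeasure_mono sub) (auto simp: spG)
    also have "\<dots> \<le> emeasure \<gamma> (fst -` (- X)) + emeasure \<gamma> (snd -` (snd ` K'))"
      using measurable_sets[OF fG(1), of "- X"] measurable_sets[OF fG(2) c] cX
      by (intro emeasure_subadditive) (auto simp: spG)
    also have "emeasure \<gamma> (fst -` (- X)) = emeasure (ambient \<alpha>) (- X)"
      unfolding g1[symmetric] using cX by (subst emeasure_distr[OF fG(1)]) (auto simp: spG)
    also have "\<dots> = 0" using emeasure_ambient[OF \<alpha>(1), of "- X"] cX by simp
    also have "emeasure \<gamma> (snd -` (snd ` K')) = emeasure (ambient \<beta>) (snd ` K')"
      unfolding g2[symmetric] using c by (subst emeasure_distr[OF fG(2)]) (auto simp: spG)
    also have "\<dots> = emeasure \<beta> (snd ` K' \<inter> Y)" using emeasure_ambient[OF \<beta> c] by simp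
    also have "snd ` K' \<inter> Y = {}" using K(2) by (auto simp: K'_def)
    finally show "emeasure \<gamma> K = 0" by simp
  qed
  have \<pi>c: "\<pi> \<in> couplings X Y \<alpha> \<beta>"
    using couplings_iff[OF \<alpha>(1) \<beta>] \<pi> g1 g2 by auto
  have F\<pi>: "(\<integral>z. fst z \<bullet> snd z \<partial>ambient \<pi>) = (\<integral>x. x \<bullet> ?T x \<partial>ambient \<alpha>)"
    unfolding \<pi>(2) \<gamma>_def
    by (subst integral_distr[OF Ga]) (auto intro!: borel_measurable_continuous_onI continuous_intros)
  define c where "c = (\<integral>x. x \<bullet> x \<partial>ambient \<alpha>) + (\<integral>y. y \<bullet> y \<partial>ambient \<beta>)"
  define F where "F \<rho> = (\<integral>z. fst z \<bullet> snd z \<partial>ambient \<rho>)" for \<rho> :: "('a \<times> 'a) measure"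
  have cost: "transport_cost \<rho> = ennreal (c - 2 * F \<rho>)" "0 \<le> c - 2 * F \<rho>" if "\<rho> \<in> couplings X Y \<alpha> \<beta>" for \<rho>
    using transport_cost_ambient[OF _ couplings_finite[OF that \<alpha>(2)] X(2) Y, of "ambient \<alpha>" "ambient \<beta>"]
      that couplings_iff[OF \<alpha>(1) \<beta>] unfolding c_def F_def by auto
  have le: "F \<rho> \<le> F \<pi>" if "\<rho> \<in> couplings X Y \<alpha> \<beta>" for \<rho>
    using plan_inner_le[OF R f(1) fa sets_ambient Xa \<alpha>(3) sets_ambient, of \<rho>] that couplings_iff[OF \<alpha>(1) \<beta>]
    unfolding F_def F\<pi> f(2) by auto
  have un: "\<rho> = \<pi>" if "\<rho> \<in> couplings X Y \<alpha> \<beta>" "F \<pi> \<le> F \<rho>" for \<rho>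
  proof (rule ambient_inject[of "X \<times> Y"])
    have "(\<integral>x. x \<bullet> ?T x \<partial>ambient \<alpha>) \<le> (\<integral>z. fst z \<bullet> snd z \<partial>ambient \<rho>)"
      using that(2) unfolding F_def F\<pi> .
    then show "ambient \<rho> = ambient \<pi>"
      using plan_unique[OF R f(1) fa sets_ambient Xa \<alpha>(3) sets_ambient, of \<rho>] that couplings_iff[OF \<alpha>(1) \<beta>]
      unfolding f(2) \<pi>(2) \<gamma>_def by auto
  qed (use that \<pi>c in \<open>auto simp: couplings_def\<close>)
  have "optimal_plan X Y \<alpha> \<beta> \<rho> \<longleftrightarrow> \<rho> = \<pi>" for \<rho>
  proof
    assume "optimal_plan X Y \<alpha> \<beta> \<rho>"
    then have \<rho>: "\<rho> \<in> couplings X Y \<alpha> \<beta>" and "\<not> transport_cost \<pi> < transport_cost \<rho>"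
      using \<pi>c by (auto simp: optimal_plan_def is_arg_min_def)
    then have "\<not> c - 2 * F \<pi> < c - 2 * F \<rho>"
      using cost[OF \<rho>] cost[OF \<pi>c] by (simp add: ennreal_less_iff)
    then show "\<rho> = \<pi>" using un[OF \<rho>] by linarith
  next
    assume "\<rho> = \<pi>"
    moreover have "\<not> transport_cost \<rho>' < transport_cost \<pi>" if "\<rho>' \<in> couplings X Y \<alpha> \<beta>" for \<rho>'
      using cost[OF that] cost[OF \<pi>c] le[OF that] by (simp add: ennreal_less_iff)
    ultimately show "optimal_plan X Y \<alpha> \<beta> \<rho>"
      using \<pi>c by (auto simp: optimal_plan_def is_arg_min_def)
  qed
  then show ?thesis using that[OF f(1) \<pi>c _ f(2)] \<pi>(2) \<gamma>_def by blast
qed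

text \<open>
  The two formulas for measures express that the step replaces the plan over \<open>A\<close> by a graph, keeps it
  elsewhere, and preserves the second marginal of the part over \<open>A\<close>.
\<close>

lemma domdec_step_map:
  fixes X Y A :: "'a::euclidean_space set"
  assumes R: "0 \<le> R" and X: "closed X" "X \<subseteq> cball 0 R" and Y: "Y \<subseteq> cball 0 R"
    and \<mu>: "measure_on X \<mu>" "finite_measure \<mu>" "absolutely_continuous lborel (ambient \<mu>)"
    and \<nu>: "measure_on Y \<nu>"
    and \<pi>: "\<pi> \<in> couplings X Y \<mu> \<nu>"
    and A: "closed A"
  obtains f where "potential R f" "domdec_step X Y \<mu> A \<pi> \<in> couplings X Y \<mu> \<nu>"
    "\<And>D. D \<in> sets borel \<Longrightarrow> emeasure (ambient (domdec_step X Y \<mu> A \<pi>)) D =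
       emeasure (ambient \<mu>) (A \<inter> {x. (x, grad (legendre R f) x) \<in> D}) + emeasure (ambient \<pi>) (D \<inter> ((- A) \<times> UNIV))"
    "\<And>D. D \<in> sets borel \<Longrightarrow> emeasure (ambient \<mu>) (A \<inter> grad (legendre R f) -` D) = emeasure (ambient \<pi>) (A \<times> D)"
proof -
  have on: "measure_on (X \<times> Y) \<pi>" using \<pi> by (simp add: couplings_def)
  have marg: "distr (ambient \<pi>) borel fst = ambient \<mu>" "distr (ambient \<pi>) borel snd = ambient \<nu>"
    using \<pi> couplings_iff[OF \<mu>(1) \<nu>] by auto
  have Ab: "A \<in> sets borel" using A by simp
  have Ab2: "A \<times> (UNIV :: 'a set) \<in> sets borel" "(- A) \<times> (UNIV :: 'a set) \<in> sets borel"
    by (intro borel_closed closed_Times A closed_UNIV, intro borel_open open_Times open_Compl A open_UNIV)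
  define \<mu>A where "\<mu>A = restrict_meas \<mu> A"
  define \<pi>A where "\<pi>A = restrict_meas \<pi> (A \<times> Y)"
  define \<pi>C where "\<pi>C = restrict_meas \<pi> ((X - A) \<times> Y)"
  define \<nu>A where "\<nu>A = snd_marginal Y \<pi>A"
  note r\<mu> = restrict_meas_ambient[OF \<mu>(1) Ab refl, folded \<mu>A_def]
  have r\<pi>: "measure_on (X \<times> Y) \<pi>A" "ambient \<pi>A = density (ambient \<pi>) (indicator (A \<times> UNIV))"
    unfolding \<pi>A_def by (rule restrict_meas_ambient[OF on Ab2(1)]; auto)+
  have rC: "measure_on (X \<times> Y) \<pi>C" "ambient \<pi>C = density (ambient \<pi>) (indicator ((- A) \<times> UNIV))"
    unfolding \<pi>C_def by (rule restrict_meas_ambient[OF on Ab2(2)]; auto)+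
  have fs: "fst \<in> measurable (ambient \<rho>) borel" "snd \<in> measurable (ambient \<rho>) borel" for \<rho> :: "('a \<times> 'a) measure"
    using measurable_fst_snd_borel by (simp_all add: measurable_cong_sets[OF sets_ambient refl])
  have emf: "emeasure (distr (ambient \<rho>) borel fst) D = emeasure (ambient \<rho>) (D \<times> UNIV)"
    and ems: "emeasure (distr (ambient \<rho>) borel snd) D = emeasure (ambient \<rho>) (UNIV \<times> D)"
    if "D \<in> sets borel" for D and \<rho> :: "('a \<times> 'a) measure"
    using that by (subst emeasure_distr; auto simp: fs intro!: arg_cong[where f="emeasure (ambient \<rho>)"])+
  have prodm: "D \<times> (UNIV::'a set) \<in> sets borel" "(UNIV::'a set) \<times> D \<in> sets borel" if "D \<in> sets borel" for D :: "'a set"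
    using that by (simp_all add: borel_Times)
  have c1: "\<pi>A \<in> couplings X Y \<mu>A \<nu>A"
    unfolding couplings_iff[OF r\<mu>(1) measure_on_marginals(2)[of Y \<pi>A, folded \<nu>A_def]]
  proof (intro conjI r\<pi>(1))
    show "distr (ambient \<pi>A) borel snd = ambient \<nu>A" unfolding \<nu>A_def ambient_marginals[OF r\<pi>(1)] ..
    show "distr (ambient \<pi>A) borel fst = ambient \<mu>A"
    proof (rule measure_eqI)
      fix D assume "D \<in> sets (distr (ambient \<pi>A) borel fst)"
      then have D: "D \<in> sets borel" by simp
      have "emeasure (distr (ambient \<pi>A) borel fst) D = emeasure (ambient \<pi>) (A \<times> UNIV \<inter> D \<times> UNIV)"
        unfolding emf[OF D] unfolding r\<pi>(2) by (rule emeasure_restricted) (use Ab2 prodm[OF D] in auto)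
      also have "A \<times> (UNIV::'a set) \<inter> D \<times> UNIV = (A \<inter> D) \<times> UNIV" by auto
      also have "emeasure (ambient \<pi>) ((A \<inter> D) \<times> UNIV) = emeasure (ambient \<mu>) (A \<inter> D)"
        unfolding marg(1)[symmetric] using emf[of "A \<inter> D" \<pi>] Ab D by simp
      also have "\<dots> = emeasure (ambient \<mu>A) D"
        unfolding r\<mu>(2) using Ab D by (simp add: emeasure_restricted)
      finally show "emeasure (distr (ambient \<pi>A) borel fst) D = emeasure (ambient \<mu>A) D" .
    qed simp
  qed
  have ac: "absolutely_continuous lborel (ambient \<mu>A)"
    unfolding absolutely_continuous_def r\<mu>(2)
  proof
    fix N :: "'a set" assume N: "N \<in> null_sets lborel"
    then have Nb: "N \<in> sets borel" and "emeasure (ambient \<mu>) N = 0"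
      using \<mu>(3) unfolding absolutely_continuous_def by auto
    then have "emeasure (ambient \<mu>) (A \<inter> N) \<le> 0"
      using emeasure_mono[of "A \<inter> N" N "ambient \<mu>"] Ab by auto
    then show "N \<in> null_sets (density (ambient \<mu>) (indicator A))"
      using Nb Ab by (auto simp: null_sets_def emeasure_restricted)
  qed
  obtain f \<rho> where f: "potential R f" and \<rho>: "\<rho> \<in> couplings X Y \<mu>A \<nu>A"
    "ambient \<rho> = distr (ambient \<mu>A) borel (\<lambda>x. (x, grad (legendre R f) x))"
    "distr (ambient \<mu>A) borel (grad (legendre R f)) = ambient \<nu>A"
    and opt: "\<And>\<rho>'. optimal_plan X Y \<mu>A \<nu>A \<rho>' \<longleftrightarrow> \<rho>' = \<rho>"
    by (rule optimal_plan_ex1[OF R X Y r\<mu>(1) r\<mu>(3)[OF \<mu>(2)] ac c1], rule that)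
  let ?T = "grad (legendre R f)"
  have T: "?T \<in> borel_measurable borel" by (rule measurable_grad_legendre[OF R f(1)])
  have G: "(\<lambda>x. (x, ?T x)) \<in> borel_measurable borel" by (rule measurable_graph[OF T])
  have Ta: "?T \<in> measurable (ambient \<mu>A) borel" and Ga: "(\<lambda>x. (x, ?T x)) \<in> measurable (ambient \<mu>A) borel"
    using T G by (simp_all add: measurable_cong_sets[OF sets_ambient refl])
  define \<sigma> where "\<sigma> = domdec_step X Y \<mu> A \<pi>"
  have the_opt: "The (optimal_plan X Y \<mu>A \<nu>A) = \<rho>"
    by (rule the_equality) (simp_all add: opt)
  have \<sigma>: "\<sigma> = measure_add \<rho> \<pi>C"
    unfolding \<sigma>_def domdec_step_def Let_def \<mu>A_def[symmetric] \<pi>A_def[symmetric] \<nu>A_def[symmetric] \<pi>C_def[symmetric]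
    by (simp add: the_opt)
  have on\<rho>: "measure_on (X \<times> Y) \<rho>" using \<rho>(1) by (simp add: couplings_def)
  have on\<sigma>: "measure_on (X \<times> Y) \<sigma>"
  proof -
    have "sets (measure_add \<rho> \<pi>C) = sets \<rho>" unfolding measure_add_def by (rule sets.sets_measure_of_eq)
    then show ?thesis using on\<rho> unfolding \<sigma> measure_on_def by simp
  qed
  have em: "emeasure (ambient \<sigma>) D = emeasure (ambient \<mu>) (A \<inter> {x. (x, ?T x) \<in> D}) + emeasure (ambient \<pi>) (D \<inter> ((- A) \<times> UNIV))"
    if D: "D \<in> sets borel" for D
  proof -
    have DS: "D \<inter> (X \<times> Y) \<in> sets \<rho>" using sets_measure_on[OF on\<rho>] D by blast
    have "emeasure (ambient \<sigma>) D = emeasure \<rho> (D \<inter> (X \<times> Y)) + emeasure \<pi>C (D \<inter> (X \<times> Y))"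
      unfolding emeasure_ambient[OF on\<sigma> D] unfolding \<sigma>
      by (rule emeasure_measure_add[OF _ DS]) (use on\<rho> rC(1) in \<open>simp add: measure_on_def\<close>)
    also have "\<dots> = emeasure (ambient \<rho>) D + emeasure (ambient \<pi>C) D"
      using emeasure_ambient[OF on\<rho> D] emeasure_ambient[OF rC(1) D] by simp
    also have "emeasure (ambient \<pi>C) D = emeasure (ambient \<pi>) (D \<inter> ((- A) \<times> UNIV))"
      unfolding rC(2) using emeasure_restricted[of "(- A) \<times> UNIV" "ambient \<pi>" D] Ab2 D by (simp add: Int_commute)
    also have "emeasure (ambient \<rho>) D = emeasure (ambient \<mu>A) {x. (x, ?T x) \<in> D}"
      unfolding \<rho>(2) using D by (subst emeasure_distr[OF Ga]) (auto simp: vimage_def)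
    also have "\<dots> = emeasure (ambient \<mu>) (A \<inter> {x. (x, ?T x) \<in> D})"
      unfolding r\<mu>(2) using Ab measurable_sets[OF G D] by (subst emeasure_restricted) (auto simp: vimage_def)
    finally show ?thesis .
  qed
  have emT: "emeasure (ambient \<mu>) (A \<inter> ?T -` D) = emeasure (ambient \<pi>) (A \<times> D)" if D: "D \<in> sets borel" for D
  proof -
    have "emeasure (ambient \<mu>) (A \<inter> ?T -` D) = emeasure (ambient \<mu>A) (?T -` D)"
      unfolding r\<mu>(2) using Ab measurable_sets[OF T D] by (subst emeasure_restricted) auto
    also have "\<dots> = emeasure (ambient \<nu>A) D"
      unfolding \<rho>(3)[symmetric] using D by (subst emeasure_distr[OF Ta]) auto
    also have "\<dots> = emeasure (ambient \<pi>A) (UNIV \<times> D)"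
      unfolding \<nu>A_def ambient_marginals[OF r\<pi>(1)] by (rule ems[OF D])
    also have "\<dots> = emeasure (ambient \<pi>) (A \<times> UNIV \<inter> UNIV \<times> D)"
      unfolding r\<pi>(2) by (rule emeasure_restricted) (use Ab2 prodm[OF D] in auto)
    also have "A \<times> UNIV \<inter> UNIV \<times> D = A \<times> D" by auto
    finally show ?thesis .
  qed
  have c\<sigma>: "\<sigma> \<in> couplings X Y \<mu> \<nu>"
    unfolding couplings_iff[OF \<mu>(1) \<nu>]
  proof (intro conjI on\<sigma>)
    show "distr (ambient \<sigma>) borel fst = ambient \<mu>"
    proof (rule measure_eqI)
      fix D assume "D \<in> sets (distr (ambient \<sigma>) borel fst)"
      then have D: "D \<in> sets borel" by simp
      have "emeasure (distr (ambient \<sigma>) borel fst) D = emeasure (ambient \<mu>) (A \<inter> D) + emeasure (ambient \<pi>) ((D - A) \<times> UNIV)"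
        unfolding emf[OF D] em[OF prodm(1)[OF D]]
        by (intro arg_cong2[where f="(+)"] arg_cong[where f="emeasure _"]) auto
      also have "emeasure (ambient \<pi>) ((D - A) \<times> UNIV) = emeasure (ambient \<mu>) (D - A)"
        unfolding marg(1)[symmetric] using emf[of "D - A" \<pi>] Ab D by simp
      also have "emeasure (ambient \<mu>) (A \<inter> D) + emeasure (ambient \<mu>) (D - A) = emeasure (ambient \<mu>) D"
        using Ab D by (subst plus_emeasure) (auto intro!: arg_cong[where f="emeasure (ambient \<mu>)"])
      finally show "emeasure (distr (ambient \<sigma>) borel fst) D = emeasure (ambient \<mu>) D" .
    qed simp
    show "distr (ambient \<sigma>) borel snd = ambient \<nu>"
    proof (rule measure_eqI)
      fix D assume "D \<in> sets (distr (ambient \<sigma>) borel snd)"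
      then have D: "D \<in> sets borel" by simp
      have "emeasure (distr (ambient \<sigma>) borel snd) D = emeasure (ambient \<mu>) (A \<inter> ?T -` D) + emeasure (ambient \<pi>) ((- A) \<times> D)"
        unfolding ems[OF D] em[OF prodm(2)[OF D]]
        by (intro arg_cong2[where f="(+)"] arg_cong[where f="emeasure _"]) auto
      also have "\<dots> = emeasure (ambient \<pi>) (A \<times> D) + emeasure (ambient \<pi>) ((- A) \<times> D)"
        unfolding emT[OF D] ..
      also have "\<dots> = emeasure (ambient \<pi>) (UNIV \<times> D)"
      proof (subst plus_emeasure)
        have "A \<times> D = (A \<times> UNIV) \<inter> (UNIV \<times> D)" by auto
        then show "A \<times> D \<in> sets (ambient \<pi>)" using Ab2 prodm[OF D] by auto
        have "(-A) \<times> D = ((-A) \<times> UNIV) \<inter> (UNIV \<times> D)" by auto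
        then show "(- A) \<times> D \<in> sets (ambient \<pi>)" using Ab2 prodm[OF D] by auto
      qed (auto intro!: arg_cong[where f="emeasure (ambient \<pi>)"])
      also have "\<dots> = emeasure (ambient \<nu>) D" unfolding marg(2)[symmetric] ems[OF D] ..
      finally show "emeasure (distr (ambient \<sigma>) borel snd) D = emeasure (ambient \<nu>) D" .
    qed simp
  qed
  show ?thesis using that[OF f] c\<sigma> em emT unfolding \<sigma>_def by blast
qed

section \<open>Limit points of the iterated maps\<close>

text \<open>
  The iteration reduced to maps: in step \<open>k\<close> the map is replaced on the cell \<open>A (k mod K)\<close> by a gradient.
  The zero map stands in for the initial plan, which need not be carried by a map; so preservation of the
  second marginal is available only after the first sweep, when no trace of the initial map is left.
\<close>

locale cell_sweep =
  fixes R :: real and m :: "'a::euclidean_space measure" and K :: nat and A :: "nat \<Rightarrow> 'a set"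
    and f :: "nat \<Rightarrow> 'a \<Rightarrow> real" and T :: "nat \<Rightarrow> 'a \<Rightarrow> 'a"
  assumes R: "0 \<le> R"
    and fin: "finite_measure m" and sets_m: "sets m = sets borel"
    and conc: "AE x in m. x \<in> cball 0 R" and ac: "absolutely_continuous lborel m"
    and K: "0 < K" and A: "\<And>j. A j \<in> sets borel" and cover: "AE x in m. \<exists>j<K. x \<in> A j"
    and f: "\<And>k. potential R (f k)"
    and T0: "T 0 = (\<lambda>_. 0)"
    and T_Suc: "\<And>k x. T (Suc k) x = (if x \<in> A (k mod K) then grad (legendre R (f k)) x else T k x)"
    and marg: "\<And>k D. K \<le> k \<Longrightarrow> D \<in> sets borel \<Longrightarrow>
      emeasure m (A (k mod K) \<inter> T (Suc k) -` D) = emeasure m (A (k mod K) \<inter> T k -` D)"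
begin

lemma measurable_m: "g \<in> measurable borel N \<Longrightarrow> g \<in> measurable m N"
  by (simp add: measurable_cong_sets[OF sets_m refl])

lemma T_measurable: "T k \<in> borel_measurable borel"
proof (induction k)
  case (Suc k)
  have "T (Suc k) = (\<lambda>x. if x \<in> A (k mod K) then grad (legendre R (f k)) x else T k x)"
    using T_Suc by blast
  then show ?case
    using Suc A[of "k mod K"] measurable_grad_legendre[OF R f[of k]] by (auto intro!: measurable_If_set)
qed (simp add: T0)

lemma AE_maps: "AE x in m. x \<in> cball 0 R \<and> (\<exists>j<K. x \<in> A j) \<and> (\<forall>k. T k x \<in> cball 0 R) \<and>
    (\<forall>k. legendre R (f k) x + f k (grad (legendre R (f k)) x) = x \<bullet> grad (legendre R (f k)) x)"
proof -
  have "AE x in m. \<forall>k. grad (legendre R (f k)) x \<in> cball 0 R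
      \<and> legendre R (f k) x + f k (grad (legendre R (f k)) x) = x \<bullet> grad (legendre R (f k)) x"
    unfolding AE_all_countable
  proof
    fix k
    show "AE x in m. grad (legendre R (f k)) x \<in> cball 0 R
      \<and> legendre R (f k) x + f k (grad (legendre R (f k)) x) = x \<bullet> grad (legendre R (f k)) x"
      using AE_grad_in_cball[OF R f[of k] ac sets_m] by eventually_elim blast
  qed
  then show ?thesis using conc cover
  proof eventually_elim
    case (elim x)
    have "T k x \<in> cball 0 R" for k by (induction k) (use elim R in \<open>auto simp: T0 T_Suc\<close>)
    then show ?case using elim by blast
  qed
qed

definition correlation :: "nat \<Rightarrow> real" where "correlation k = (\<integral>x. x \<bullet> T k x \<partial>m)"

definition gap :: "nat \<Rightarrow> 'a \<Rightarrow> real" where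
  "gap k x = legendre R (f k) x + f k (T k x) - x \<bullet> T k x"

lemma inner_cball: "x \<in> cball 0 R \<Longrightarrow> y \<in> cball 0 R \<Longrightarrow> \<bar>x \<bullet> y\<bar> \<le> R * R" for x y :: 'a
  using Cauchy_Schwarz_ineq2[of x y] R mult_mono[of "norm x" R "norm y" R] by auto

lemma integrable_of_bound:
  assumes "g \<in> borel_measurable borel" "AE x in m. \<bar>g x\<bar> \<le> B"
  shows "integrable m (g :: 'a \<Rightarrow> real)"
  by (rule finite_measure.integrable_const_bound[OF fin, of _ B]) (use assms measurable_m in auto)

lemma potential_measurable: "potential R g \<Longrightarrow> g \<in> borel_measurable borel"
  by (intro borel_measurable_continuous_onI potential_continuous)

lemma legendre_measurable: "potential R g \<Longrightarrow> legendre R g \<in> borel_measurable borel"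
  by (intro borel_measurable_continuous_onI continuous_on_legendre[OF R] potential_continuous)

lemma gap_bound:
  fixes x y :: 'a
  assumes "potential R g" "x \<in> cball 0 R" "y \<in> cball 0 R"
  shows "\<bar>legendre R g x + g y - x \<bullet> y\<bar> \<le> 4 * (R * R)" "0 \<le> legendre R g x + g y - x \<bullet> y"
  using legendre_bound[OF R potential_continuous[OF assms(1)] potential_bound[OF assms(1)] assms(2)]
    potential_bound[OF assms(1,3)] inner_cball[OF assms(2,3)]
    fenchel_young[OF R potential_continuous[OF assms(1)] assms(3), of x] by linarith+

lemma gap_measurable: "gap k \<in> borel_measurable borel"
  unfolding gap_def[abs_def]
  using legendre_measurable[OF f[of k]] measurable_compose[OF T_measurable[of k] potential_measurable[OF f[of k]]] T_measurable[of k]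
  by measurable

lemma AE_gap: "AE x in m. \<bar>gap k x\<bar> \<le> 4 * (R * R) \<and> 0 \<le> gap k x"
  using AE_maps
proof eventually_elim
  case (elim x)
  then show ?case using gap_bound[OF f[of k], of x "T k x"] by (simp add: gap_def)
qed

lemma inner_T_integrable: "integrable m (\<lambda>x. x \<bullet> T k x)"
proof (rule integrable_of_bound)
  show "(\<lambda>x. x \<bullet> T k x) \<in> borel_measurable borel" using T_measurable[of k] by measurable
  show "AE x in m. \<bar>x \<bullet> T k x\<bar> \<le> R * R" using AE_maps by eventually_elim (simp add: inner_cball)
qed

text \<open>
  On the cell the new map attains equality in the Fenchel-Young inequality, and the old and the new map push
  the cell to the same measure, so \<open>f k\<close> has the same integral along both.
\<close>

lemma correlation_increment:
  assumes k: "K \<le> k"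
  shows "correlation (Suc k) - correlation k = (\<integral>x. indicator (A (k mod K)) x * gap k x \<partial>m)"
proof -
  let ?A = "A (k mod K)"
  define mA where "mA = density m (indicator ?A)"
  have sA: "sets mA = sets borel" by (simp add: mA_def sets_m)
  have measA: "g \<in> measurable mA N" if "g \<in> measurable borel N" for g :: "'a \<Rightarrow> 'b" and N
    using that by (simp add: measurable_cong_sets[OF sA refl])
  have Am: "?A \<in> sets m" using A sets_m by simp
  have em: "emeasure mA D = emeasure m (?A \<inter> D)" if "D \<in> sets borel" for D
    unfolding mA_def using Am that by (intro emeasure_restricted) (auto simp: sets_m)
  have ind: "(\<integral>x. indicator ?A x * g x \<partial>m) = (\<integral>x. g x \<partial>mA)" if "g \<in> borel_measurable borel" for g :: "'a \<Rightarrow> real"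
  proof -
    have "mA = density m (\<lambda>x. ennreal (indicator ?A x))" by (simp add: mA_def ennreal_indicator)
    moreover have "(\<integral>x. g x \<partial>density m (\<lambda>x. ennreal (indicator ?A x))) = (\<integral>x. indicator ?A x *\<^sub>R g x \<partial>m)"
      by (rule integral_density) (use that Am in \<open>auto simp: measurable_m\<close>)
    ultimately show ?thesis by simp
  qed
  have distr_eq: "distr mA borel (T (Suc k)) = distr mA borel (T k)"
  proof (rule measure_eqI)
    fix D assume "D \<in> sets (distr mA borel (T (Suc k)))"
    then have D: "D \<in> sets borel" by simp
    have sp: "space mA = UNIV" using sA[THEN sets_eq_imp_space_eq] by simp
    have "emeasure (distr mA borel (T j)) D = emeasure m (?A \<inter> T j -` D)" for j
      using D measurable_sets[OF T_measurable D]
      by (subst emeasure_distr[OF measA[OF T_measurable]]) (auto simp: sp em)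
    then show "emeasure (distr mA borel (T (Suc k))) D = emeasure (distr mA borel (T k)) D"
      using marg[OF k D] by simp
  qed simp
  have fT: "(\<lambda>x. f k (T j x)) \<in> borel_measurable borel" for j
    by (rule measurable_compose[OF T_measurable potential_measurable[OF f]])
  have xT: "(\<lambda>x. x \<bullet> T j x) \<in> borel_measurable borel" for j using T_measurable[of j] by measurable
  have lm: "legendre R (f k) \<in> borel_measurable borel" by (rule legendre_measurable[OF f])
  have ifT: "integrable m (\<lambda>x. indicator ?A x * f k (T j x))" for j
  proof (rule integrable_of_bound)
    show "(\<lambda>x. indicator ?A x * f k (T j x)) \<in> borel_measurable borel" using fT[of j] A by measurable
    show "AE x in m. \<bar>indicator ?A x * f k (T j x)\<bar> \<le> R * R"
      using AE_maps by eventually_elim (use R in \<open>auto simp: abs_mult potential_bound[OF f] split: split_indicator\<close>)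
  qed
  have il: "integrable m (\<lambda>x. indicator ?A x * legendre R (f k) x)"
  proof (rule integrable_of_bound)
    show "(\<lambda>x. indicator ?A x * legendre R (f k) x) \<in> borel_measurable borel" using lm A by measurable
    show "AE x in m. \<bar>indicator ?A x * legendre R (f k) x\<bar> \<le> R * R + R * R"
      using conc
      by eventually_elim (use R legendre_bound[OF R potential_continuous[OF f] potential_bound[OF f]] in
          \<open>auto simp: abs_mult split: split_indicator\<close>)
  qed
  have ix: "integrable m (\<lambda>x. indicator ?A x * (x \<bullet> T j x))" for j
  proof (rule integrable_of_bound)
    show "(\<lambda>x. indicator ?A x * (x \<bullet> T j x)) \<in> borel_measurable borel" using xT[of j] A by measurable
    show "AE x in m. \<bar>indicator ?A x * (x \<bullet> T j x)\<bar> \<le> R * R"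
      using AE_maps by eventually_elim (use R in \<open>auto simp: abs_mult inner_cball split: split_indicator\<close>)
  qed
  have transport: "(\<integral>x. indicator ?A x * f k (T (Suc k) x) \<partial>m) = (\<integral>x. indicator ?A x * f k (T k x) \<partial>m)"
  proof -
    have "(\<integral>x. f k (T j x) \<partial>mA) = (\<integral>y. f k y \<partial>distr mA borel (T j))" for j
      by (rule integral_distr[OF measA[OF T_measurable] potential_measurable[OF f], symmetric])
    then show ?thesis unfolding ind[OF fT] using distr_eq by simp
  qed
  have "correlation (Suc k) - correlation k = (\<integral>x. x \<bullet> T (Suc k) x - x \<bullet> T k x \<partial>m)"
    unfolding correlation_def using inner_T_integrable by simp
  also have "\<dots> = (\<integral>x. indicator ?A x * legendre R (f k) x + indicator ?A x * f k (T (Suc k) x) - indicator ?A x * (x \<bullet> T k x) \<partial>m)"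
  proof (rule integral_cong_AE)
    show "AE x in m. x \<bullet> T (Suc k) x - x \<bullet> T k x =
      indicator ?A x * legendre R (f k) x + indicator ?A x * f k (T (Suc k) x) - indicator ?A x * (x \<bullet> T k x)"
      using AE_maps by eventually_elim (auto simp: T_Suc split: split_indicator)
  qed (use inner_T_integrable ifT il ix in auto)
  also have "\<dots> = (\<integral>x. indicator ?A x * legendre R (f k) x \<partial>m) + (\<integral>x. indicator ?A x * f k (T (Suc k) x) \<partial>m) - (\<integral>x. indicator ?A x * (x \<bullet> T k x) \<partial>m)"
    using ifT il ix by simp
  also have "\<dots> = (\<integral>x. indicator ?A x * legendre R (f k) x + indicator ?A x * f k (T k x) - indicator ?A x * (x \<bullet> T k x) \<partial>m)"
    unfolding transport using ifT il ix by simp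
  also have "\<dots> = (\<integral>x. indicator ?A x * gap k x \<partial>m)"
    unfolding gap_def by (simp add: algebra_simps)
  finally show ?thesis .
qed

lemma correlation_increment_tendsto: "(\<lambda>n. correlation (Suc (K + n)) - correlation (K + n)) \<longlonglongrightarrow> 0"
proof -
  have "correlation (K + n) \<le> correlation (K + Suc n)" for n
  proof -
    have "0 \<le> (\<integral>x. indicator (A ((K + n) mod K)) x * gap (K + n) x \<partial>m)"
      by (rule integral_nonneg_AE) (use AE_gap[of "K + n"] in \<open>eventually_elim, auto\<close>)
    then show ?thesis using correlation_increment[of "K + n"] by simp
  qed
  then have inc: "incseq (\<lambda>n. correlation (K + n))" by (intro incseq_SucI) simp
  have "correlation (K + n) \<le> (\<integral>x. R * R \<partial>m)" for n
    unfolding correlation_def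
  proof (rule integral_mono_AE)
    show "AE x in m. x \<bullet> T (K + n) x \<le> R * R"
      using AE_maps by eventually_elim (use inner_cball in \<open>force simp: abs_le_iff\<close>)
  qed (use inner_T_integrable fin in \<open>auto simp: finite_measure.integrable_const\<close>)
  then obtain L where L: "(\<lambda>n. correlation (K + n)) \<longlonglongrightarrow> L"
    using incseq_convergent[OF inc] by blast
  have "(\<lambda>n. correlation (K + Suc n) - correlation (K + n)) \<longlonglongrightarrow> L - L"
    by (rule tendsto_diff[OF LIMSEQ_Suc[OF L] L])
  then show ?thesis by simp
qed

lemma AE_grad_tendsto_m:
  assumes "\<And>n. potential R (g n)" "potential R h" "uniform_limit (cball 0 R) g h sequentially"
  shows "AE x in m. (\<lambda>n. grad (legendre R (g n)) x) \<longlonglongrightarrow> grad (legendre R h) x"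
  by (rule absolutely_continuous_AE[OF _ ac AE_grad_tendsto[OF R _ _ assms(3)]])
     (use assms potential_continuous sets_m in auto)

text \<open>
  Once every cell has been visited, a point carries the gradient of the potential of the last cell that
  contained it. Compactness of potentials, applied to the \<open>K\<close> steps of a sweep in turn, makes all these
  gradients converge.
\<close>

lemma first_sweep:
  fixes s :: "nat \<Rightarrow> nat"
  assumes s: "strict_mono s" and i: "i \<le> K"
  shows "\<exists>r. strict_mono r \<and> (AE x in m. (\<exists>j<i. x \<in> A j) \<longrightarrow> convergent (\<lambda>n. T (K * s (r n) + i) x))"
  using i
proof (induction i)
  case 0
  show ?case by (rule exI[of _ "\<lambda>n::nat. n"]) (auto simp: strict_mono_def)
next
  case (Suc i)
  then obtain r where r: "strict_mono r"
    and c: "AE x in m. (\<exists>j<i. x \<in> A j) \<longrightarrow> convergent (\<lambda>n. T (K * s (r n) + i) x)" by auto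
  obtain q h where q: "strict_mono q" and h: "potential R h"
    and lim: "uniform_limit (cball 0 R) (\<lambda>n. f (K * s (r (q n)) + i)) h sequentially"
    by (rule potential_compactness[OF R, of "\<lambda>n. f (K * s (r n) + i)"]) (auto intro: f)
  have md: "i mod K = i" using Suc.prems by simp
  have "AE x in m. (\<exists>j<Suc i. x \<in> A j) \<longrightarrow> convergent (\<lambda>n. T (K * s (r (q n)) + Suc i) x)"
    using c AE_grad_tendsto_m[OF f h lim]
  proof eventually_elim
    case (elim x)
    show ?case
    proof (intro impI)
      assume ex: "\<exists>j<Suc i. x \<in> A j"
      show "convergent (\<lambda>n. T (K * s (r (q n)) + Suc i) x)"
      proof (cases "x \<in> A i")
        case True
        then show ?thesis using elim(2) by (auto simp: T_Suc md convergent_def)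
      next
        case False
        then have "\<exists>j<i. x \<in> A j" using ex less_Suc_eq by auto
        then have "convergent (\<lambda>n. T (K * s (r n) + i) x)" using elim(1) by blast
        then have "convergent ((\<lambda>n. T (K * s (r n) + i) x) \<circ> q)" using q by (rule convergent_subseq_convergent)
        then show ?thesis using False by (simp add: T_Suc md o_def)
      qed
    qed
  qed
  then show ?case using strict_mono_o[OF r q] by (intro exI[of _ "r \<circ> q"]) (simp add: o_def)
qed

text \<open>
  In the limit the gap between \<open>S\<close> and the limit potential vanishes on the cell, so \<open>S\<close> is its gradient
  there. The next iterates have gradients on the cell that converge to the same gradient, so the limit does
  not change when the index is advanced.
\<close>

lemma second_sweep_step:
  assumes t: "strict_mono t" and j: "\<And>n. t n mod K = j" and tK: "\<And>n. K \<le> t n"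
    and conv: "AE x in m. (\<lambda>n. T (t n) x) \<longlonglongrightarrow> S x" and S: "S \<in> borel_measurable borel"
  obtains q h where "strict_mono q" "potential R h" "AE x in m. x \<in> A j \<longrightarrow> S x = grad (legendre R h) x"
    "AE x in m. (\<lambda>n. T (Suc (t (q n))) x) \<longlonglongrightarrow> S x"
proof -
  obtain q h where q: "strict_mono q" and h: "potential R h"
    and lim: "uniform_limit (cball 0 R) (\<lambda>n. f (t (q n))) h sequentially"
    by (rule potential_compactness[OF R, of "\<lambda>n. f (t n)"]) (auto intro: f)
  define G where "G x = legendre R h x + h (S x) - x \<bullet> S x" for x
  have Gm: "G \<in> borel_measurable borel" unfolding G_def[abs_def]
    using legendre_measurable[OF h] measurable_compose[OF S potential_measurable[OF h]] S by measurable
  have conv': "AE x in m. (\<lambda>n. T (t (q n)) x) \<longlonglongrightarrow> S x"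
    using conv by eventually_elim (use LIMSEQ_subseq_LIMSEQ[OF _ q] in \<open>auto simp: o_def\<close>)
  have AES: "AE x in m. S x \<in> cball 0 R \<and> (\<lambda>n. gap (t (q n)) x) \<longlonglongrightarrow> G x"
    using conv' AE_maps
  proof eventually_elim
    case (elim x)
    have Sx: "S x \<in> cball 0 R"
      using closed_sequentially[OF closed_cball _ elim(1)] elim(2) by blast
    have fl: "(\<lambda>n. f (t (q n)) (T (t (q n)) x)) \<longlonglongrightarrow> h (S x)"
    proof (rule Lim_transform)
      show "(\<lambda>n. f (t (q n)) (S x)) \<longlonglongrightarrow> h (S x)" by (rule tendsto_uniform_limitI[OF lim Sx])
      show "(\<lambda>n. f (t (q n)) (T (t (q n)) x) - f (t (q n)) (S x)) \<longlonglongrightarrow> 0"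
      proof (rule Lim_null_comparison)
        show "\<forall>\<^sub>F n in sequentially. norm (f (t (q n)) (T (t (q n)) x) - f (t (q n)) (S x)) \<le> R * dist (T (t (q n)) x) (S x)"
        proof (rule always_eventually, rule allI)
          fix n
          have "R-lipschitz_on UNIV (f (t (q n)))" using f by (simp add: potential_def)
          then show "norm (f (t (q n)) (T (t (q n)) x) - f (t (q n)) (S x)) \<le> R * dist (T (t (q n)) x) (S x)"
            using lipschitz_onD[of R UNIV "f (t (q n))" "T (t (q n)) x" "S x"] by (simp add: dist_real_def)
        qed
        show "(\<lambda>n. R * dist (T (t (q n)) x) (S x)) \<longlonglongrightarrow> 0"
          using tendsto_mult_left[OF tendsto_dist[OF elim(1) tendsto_const], of R "S x"] by simp
      qed
    qed
    have "(\<lambda>n. gap (t (q n)) x) \<longlonglongrightarrow> G x"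
      unfolding gap_def G_def
      by (intro tendsto_intros fl elim(1)
          legendre_tendsto[OF R potential_continuous[OF f] potential_continuous[OF h] lim])
    then show ?case using Sx by blast
  qed
  have Aj: "A j \<in> sets borel" by (rule A)
  have "(\<lambda>n. \<integral>x. indicator (A j) x * gap (t (q n)) x \<partial>m) \<longlonglongrightarrow> (\<integral>x. indicator (A j) x * G x \<partial>m)"
  proof (rule integral_dominated_convergence[where w="\<lambda>_. 4 * (R * R)"])
    show "(\<lambda>x. indicator (A j) x * G x) \<in> borel_measurable m"
      by (rule measurable_m) (use Aj Gm in measurable)
    show "(\<lambda>x. indicator (A j) x * gap (t (q n)) x) \<in> borel_measurable m" for n
      by (rule measurable_m) (use Aj gap_measurable in measurable)
    show "AE x in m. (\<lambda>n. indicator (A j) x * gap (t (q n)) x) \<longlonglongrightarrow> indicator (A j) x * G x"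
      using AES by eventually_elim (intro tendsto_intros, blast)
    show "AE x in m. norm (indicator (A j) x * gap (t (q n)) x) \<le> 4 * (R * R)" for n
      using AE_gap[of "t (q n)"] by eventually_elim (use R in \<open>auto simp: abs_mult split: split_indicator\<close>)
  qed (use fin in \<open>auto simp: finite_measure.integrable_const\<close>)
  moreover have "(\<integral>x. indicator (A j) x * gap (t (q n)) x \<partial>m) = correlation (Suc (K + (t (q n) - K))) - correlation (K + (t (q n) - K))" for n
    using correlation_increment[OF tK[of "q n"]] j[of "q n"] tK[of "q n"] by simp
  moreover have "(\<lambda>n. correlation (Suc (K + (t (q n) - K))) - correlation (K + (t (q n) - K))) \<longlonglongrightarrow> 0"
  proof -
    have "strict_mono (\<lambda>n. t (q n) - K)"
      using strict_mono_o[OF t q] tK unfolding strict_mono_def by (metis comp_apply diff_less_mono)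
    from LIMSEQ_subseq_LIMSEQ[OF correlation_increment_tendsto this] show ?thesis by (simp add: o_def)
  qed
  ultimately have G0: "(\<integral>x. indicator (A j) x * G x \<partial>m) = 0"
    using LIMSEQ_unique by force
  have AEG: "AE x in m. \<bar>G x\<bar> \<le> 4 * (R * R) \<and> 0 \<le> G x"
    using AES conc
  proof eventually_elim
    case (elim x)
    then show ?case using gap_bound[OF h, of x "S x"] by (simp add: G_def)
  qed
  have "integrable m (\<lambda>x. indicator (A j) x * G x)"
  proof (rule integrable_of_bound)
    show "(\<lambda>x. indicator (A j) x * G x) \<in> borel_measurable borel" using Aj Gm by measurable
    show "AE x in m. \<bar>indicator (A j) x * G x\<bar> \<le> 4 * (R * R)"
      using AEG by eventually_elim (use R in \<open>auto simp: abs_mult split: split_indicator\<close>)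
  qed
  moreover have "AE x in m. 0 \<le> indicator (A j) x * G x" using AEG by eventually_elim auto
  ultimately have "AE x in m. indicator (A j) x * G x = 0"
    using integral_nonneg_eq_0_iff_AE G0 by blast
  then have Sg: "AE x in m. x \<in> A j \<longrightarrow> S x = grad (legendre R h) x"
    using AES AE_grad_in_cball[OF R h ac sets_m]
  proof eventually_elim
    case (elim x)
    show ?case
    proof
      assume "x \<in> A j"
      then have "legendre R h x + h (S x) = x \<bullet> S x" using elim(1) by (simp add: G_def)
      then have "subgradient (legendre R h) x (S x)"
        using elim(2) by (intro subgradient_legendre[OF R potential_continuous[OF h]]) auto
      then show "S x = grad (legendre R h) x" using elim(3) by blast
    qed
  qed
  have "AE x in m. (\<lambda>n. T (Suc (t (q n))) x) \<longlonglongrightarrow> S x"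
    using Sg conv' AE_grad_tendsto_m[OF f h lim]
  proof eventually_elim
    case (elim x)
    then show ?case by (cases "x \<in> A j") (auto simp: T_Suc j)
  qed
  then show ?thesis using that[OF q h Sg] by blast
qed

text \<open>
  The conclusion covers a complete sweep of indices, so that every residue modulo \<open>K\<close> has the same limit.
\<close>

theorem sweep_limit:
  fixes s :: "nat \<Rightarrow> nat"
  assumes s: "strict_mono s"
  obtains r S where "strict_mono r" "S \<in> borel_measurable borel"
    "\<And>i. i < K \<Longrightarrow> AE x in m. (\<lambda>n. T (K * s (r n) + K + i) x) \<longlonglongrightarrow> S x"
    "\<And>j. j < K \<Longrightarrow> \<exists>h. potential R h \<and> (AE x in m. x \<in> A j \<longrightarrow> S x = grad (legendre R h) x)"
proof -
  obtain r where r: "strict_mono r"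
    and c: "AE x in m. (\<exists>j<K. x \<in> A j) \<longrightarrow> convergent (\<lambda>n. T (K * s (r n) + K) x)"
    using first_sweep[OF s, of K] by auto
  define S where "S x = lim (\<lambda>n. T (K * s (r n) + K) x)" for x
  have S: "S \<in> borel_measurable borel"
    unfolding S_def[abs_def] by (rule borel_measurable_lim_metric) (rule T_measurable)
  have lim: "AE x in m. (\<lambda>n. T (K * s (r n) + K) x) \<longlonglongrightarrow> S x"
    using c cover by eventually_elim (auto simp: S_def convergent_LIMSEQ_iff)
  have "\<exists>q. strict_mono q \<and> (\<forall>i'\<le>i. AE x in m. (\<lambda>n. T (K * s (r (q n)) + K + i') x) \<longlonglongrightarrow> S x) \<and>
     (\<forall>j<i. \<exists>h. potential R h \<and> (AE x in m. x \<in> A j \<longrightarrow> S x = grad (legendre R h) x))" if "i \<le> K" for i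
    using that
  proof (induction i)
    case 0
    show ?case by (rule exI[of _ "\<lambda>n::nat. n"]) (use lim in \<open>auto simp: strict_mono_def\<close>)
  next
    case (Suc i)
    then obtain q where q: "strict_mono q"
      and c1: "\<And>i'. i' \<le> i \<Longrightarrow> AE x in m. (\<lambda>n. T (K * s (r (q n)) + K + i') x) \<longlonglongrightarrow> S x"
      and c2: "\<And>j. j < i \<Longrightarrow> \<exists>h. potential R h \<and> (AE x in m. x \<in> A j \<longrightarrow> S x = grad (legendre R h) x)"
      by auto
    define t where "t n = K * s (r (q n)) + K + i" for n
    have "strict_mono (s \<circ> r \<circ> q)" by (intro strict_mono_o s r q)
    then have t: "strict_mono t" using K by (auto simp: t_def strict_mono_def)
    have tm: "t n mod K = i" for n
      unfolding t_def using Suc.prems by (metis add.commute less_eq_Suc_le mod_add_self1 mod_less mod_mult_self4 add.assoc)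
    obtain p h where p: "strict_mono p" and h: "potential R h" "AE x in m. x \<in> A i \<longrightarrow> S x = grad (legendre R h) x"
      and l: "AE x in m. (\<lambda>n. T (Suc (t (p n))) x) \<longlonglongrightarrow> S x"
      by (rule second_sweep_step[OF t tm _ _ S]) (use c1[of i] in \<open>auto simp: t_def\<close>)
    have "\<forall>i'\<le>Suc i. AE x in m. (\<lambda>n. T (K * s (r ((q \<circ> p) n)) + K + i') x) \<longlonglongrightarrow> S x"
    proof (intro allI impI)
      fix i' assume "i' \<le> Suc i"
      then consider "i' \<le> i" | "i' = Suc i" by linarith
      then show "AE x in m. (\<lambda>n. T (K * s (r ((q \<circ> p) n)) + K + i') x) \<longlonglongrightarrow> S x"
      proof cases
        case 1
        show ?thesis using c1[OF 1]
          by eventually_elim (use LIMSEQ_subseq_LIMSEQ[OF _ p] in \<open>auto simp: o_def\<close>)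
      next
        case 2
        show ?thesis using l by (simp add: 2 t_def)
      qed
    qed
    moreover have "\<forall>j<Suc i. \<exists>h. potential R h \<and> (AE x in m. x \<in> A j \<longrightarrow> S x = grad (legendre R h) x)"
      using c2 h less_Suc_eq by auto
    ultimately show ?case using strict_mono_o[OF q p] by blast
  qed
  from this[of K] obtain q where q: "strict_mono q"
     "\<And>i. i \<le> K \<Longrightarrow> AE x in m. (\<lambda>n. T (K * s (r (q n)) + K + i) x) \<longlonglongrightarrow> S x"
     "\<And>j. j < K \<Longrightarrow> \<exists>h. potential R h \<and> (AE x in m. x \<in> A j \<longrightarrow> S x = grad (legendre R h) x)"
    by auto
  show ?thesis
    by (rule that[OF strict_mono_o[OF r q(1)] S]) (use q in auto)
qed

end

section \<open>Gluing the potentials of the cells\<close>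

lemma AE_lborel_negligible:
  assumes "AE x in lborel. P (x :: 'a::euclidean_space)"
  obtains N where "negligible N" "\<And>x. x \<notin> N \<Longrightarrow> P x"
proof -
  from assms obtain N where N: "{x \<in> space lborel. \<not> P x} \<subseteq> N" "emeasure lborel N = 0" "N \<in> sets lborel"
    by (rule AE_E)
  then have "N \<in> null_sets lborel" by auto
  then have "negligible N" by (simp add: negligible_iff_null_sets null_sets_completionI)
  then show ?thesis using that N(1) by auto
qed

lemma avoid_negligible:
  assumes "negligible N" "open U" "U \<noteq> {}"
  obtains u where "u \<in> U" "u \<notin> (N :: 'a::euclidean_space set)"
  using assms open_not_negligible negligible_subset by (metis subsetI)

text \<open>
  For \<open>D = \<phi> - \<theta>\<close> the subgradient inequalities give \<open>|D w - D z| \<le> (g w - g z) \<bullet> (w - z)\<close>. Over a segment cut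
  into \<open>n\<close> equal pieces these bounds telescope to \<open>O(1 / n)\<close>. Almost every small translation moves all
  division points off the exceptional set.
\<close>

lemma equal_gradients_const:
  fixes \<phi> \<theta> :: "'a::euclidean_space \<Rightarrow> real"
  assumes U: "open U" "convex U" and N: "negligible N"
    and sub: "\<And>x. x \<in> U - N \<Longrightarrow> subgradient \<phi> x (g x) \<and> subgradient \<theta> x (g x) \<and> norm (g x) \<le> R"
    and cont: "continuous_on UNIV \<phi>" "continuous_on UNIV \<theta>"
    and xy: "x \<in> U" "y \<in> U"
  shows "\<phi> x - \<theta> x = \<phi> y - \<theta> y"
proof -
  define D where "D x = \<phi> x - \<theta> x" for x
  have step: "\<bar>D w - D z\<bar> \<le> (g w - g z) \<bullet> (w - z)" if "z \<in> U - N" "w \<in> U - N" for z w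
  proof -
    have "\<phi> z + g z \<bullet> (w - z) \<le> \<phi> w" "\<theta> z + g z \<bullet> (w - z) \<le> \<theta> w"
      "\<phi> w + g w \<bullet> (z - w) \<le> \<phi> z" "\<theta> w + g w \<bullet> (z - w) \<le> \<theta> z"
      using sub[OF that(1)] sub[OF that(2)] unfolding subgradient_def by auto
    then show ?thesis unfolding D_def by (simp add: abs_le_iff inner_diff_left inner_diff_right)
  qed
  obtain d where d: "d > 0" "ball x d \<subseteq> U" "ball y d \<subseteq> U"
  proof -
    obtain d1 d2 where "d1 > 0" "ball x d1 \<subseteq> U" "d2 > 0" "ball y d2 \<subseteq> U"
      using U(1) xy by (metis open_contains_ball)
    then show ?thesis using that[of "min d1 d2"] by (auto simp: subset_iff)
  qed
  have "\<exists>u. norm u < 1 / real (Suc n) \<and> \<bar>D (y + u) - D (x + u)\<bar> \<le> 2 * R * norm (y - x) / real (Suc n)" for n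
  proof -
    define z where "z i = x + (real i / real (Suc n)) *\<^sub>R (y - x)" for i
    have neg: "negligible ((\<lambda>v. - z i + v) ` N)" for i by (rule negligible_translation[OF N])
    have "negligible (\<Union>i\<le>Suc n. (\<lambda>v. - z i + v) ` N)"
      by (intro negligible_Union finite_imageI finite_atMost, elim imageE) (simp only: neg)
    moreover have "open (ball (0::'a) (min d (1 / real (Suc n))))" by simp
    moreover have "ball (0::'a) (min d (1 / real (Suc n))) \<noteq> {}"
    proof -
      have "0 \<in> ball (0::'a) (min d (1 / real (Suc n)))" using d(1) by simp
      then show ?thesis by blast
    qed
    ultimately obtain u where u: "u \<in> ball 0 (min d (1 / real (Suc n)))" "u \<notin> (\<Union>i\<le>Suc n. (\<lambda>v. - z i + v) ` N)"
      by (rule avoid_negligible)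
    have zu: "z i + u \<in> U - N" if i: "i \<le> Suc n" for i
    proof -
      have "z i + u \<notin> N"
      proof
        assume "z i + u \<in> N"
        then have "- z i + (z i + u) \<in> (\<lambda>v. - z i + v) ` N" by (rule imageI)
        then show False using u(2) i by auto
      qed
      moreover have "z i + u = (1 - real i / real (Suc n)) *\<^sub>R (x + u) + (real i / real (Suc n)) *\<^sub>R (y + u)"
        unfolding z_def by (simp add: scaleR_left_diff_distrib scaleR_add_right scaleR_diff_right del: of_nat_Suc)
      moreover have "x + u \<in> U" "y + u \<in> U" using d u(1) by (auto simp: subset_iff dist_norm)
      moreover have "0 \<le> real i / real (Suc n)" "real i / real (Suc n) \<le> 1" using i by auto
      ultimately show ?thesis using convexD_alt[OF U(2)] by auto
    qed
    have "\<bar>D (z (Suc i) + u) - D (z i + u)\<bar> \<le> (g (z (Suc i) + u) - g (z i + u)) \<bullet> (y - x) / real (Suc n)" if "i < Suc n" for i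
    proof -
      have "z (Suc i) + u - (z i + u) = (1 / real (Suc n)) *\<^sub>R (y - x)"
        unfolding z_def by (simp add: add_divide_distrib scaleR_left_distrib del: of_nat_Suc) (simp add: add_divide_distrib scaleR_left_distrib)
      then show ?thesis using step[OF zu zu, of i "Suc i"] that by simp
    qed
    then have "(\<Sum>i<Suc n. \<bar>D (z (Suc i) + u) - D (z i + u)\<bar>) \<le> (\<Sum>i<Suc n. (g (z (Suc i) + u) - g (z i + u)) \<bullet> (y - x) / real (Suc n))"
      by (intro sum_mono) auto
    also have "\<dots> = (\<Sum>i<Suc n. g (z (Suc i) + u) \<bullet> (y - x) / real (Suc n) - g (z i + u) \<bullet> (y - x) / real (Suc n))"
      by (simp add: inner_diff_left diff_divide_distrib del: sum.lessThan_Suc)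
    also have "\<dots> = g (z (Suc n) + u) \<bullet> (y - x) / real (Suc n) - g (z 0 + u) \<bullet> (y - x) / real (Suc n)"
      by (rule sum_lessThan_telescope)
    also have "\<dots> = (g (z (Suc n) + u) - g (z 0 + u)) \<bullet> (y - x) / real (Suc n)"
      by (simp add: inner_diff_left diff_divide_distrib)
    also have "\<dots> \<le> 2 * R * norm (y - x) / real (Suc n)"
    proof (intro divide_right_mono)
      have "(g (z (Suc n) + u) - g (z 0 + u)) \<bullet> (y - x) \<le> norm (g (z (Suc n) + u) - g (z 0 + u)) * norm (y - x)"
        by (rule norm_cauchy_schwarz)
      also have "\<dots> \<le> (R + R) * norm (y - x)"
        using norm_triangle_ineq4[of "g (z (Suc n) + u)" "g (z 0 + u)"] sub[OF zu[of "Suc n"]] sub[OF zu[of 0]]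
        by (intro mult_right_mono) auto
      finally show "(g (z (Suc n) + u) - g (z 0 + u)) \<bullet> (y - x) \<le> 2 * R * norm (y - x)" by simp
    qed simp
    finally have 1: "(\<Sum>i<Suc n. \<bar>D (z (Suc i) + u) - D (z i + u)\<bar>) \<le> 2 * R * norm (y - x) / real (Suc n)" .
    have "D (y + u) - D (x + u) = (\<Sum>i<Suc n. D (z (Suc i) + u) - D (z i + u))"
      by (subst sum_lessThan_telescope) (simp add: z_def)
    then have "\<bar>D (y + u) - D (x + u)\<bar> \<le> (\<Sum>i<Suc n. \<bar>D (z (Suc i) + u) - D (z i + u)\<bar>)"
      by (simp only: sum_abs)
    then show ?thesis using 1 u(1) by (intro exI[of _ u]) auto
  qed
  then have "\<exists>u. \<forall>n. norm (u n) < 1 / real (Suc n) \<and> \<bar>D (y + u n) - D (x + u n)\<bar> \<le> 2 * R * norm (y - x) / real (Suc n)"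
    by (intro choice allI)
  then obtain u where u: "\<And>n. norm (u n) < 1 / real (Suc n)" "\<And>n. \<bar>D (y + u n) - D (x + u n)\<bar> \<le> 2 * R * norm (y - x) / real (Suc n)"
    by blast
  have null: "(\<lambda>n. c / real (Suc n)) \<longlonglongrightarrow> 0" for c :: real
    using LIMSEQ_Suc[OF lim_const_over_n[of c]] by simp
  have "u \<longlonglongrightarrow> 0"
    by (rule Lim_null_comparison[OF _ null[of 1]]) (use u(1) in \<open>auto intro!: always_eventually less_imp_le\<close>)
  then have lim: "(\<lambda>n. y + u n) \<longlonglongrightarrow> y" "(\<lambda>n. x + u n) \<longlonglongrightarrow> x"
    using tendsto_add[OF tendsto_const, of u 0] by auto
  have cD: "continuous_on UNIV D" unfolding D_def by (intro continuous_intros cont)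
  have "(\<lambda>n. D (y + u n) - D (x + u n)) \<longlonglongrightarrow> D y - D x"
    using continuous_on_tendsto_compose[OF cD lim(1)] continuous_on_tendsto_compose[OF cD lim(2)]
    by (intro tendsto_diff) auto
  moreover have "(\<lambda>n. D (y + u n) - D (x + u n)) \<longlonglongrightarrow> 0"
    by (rule Lim_null_comparison[OF _ null[of "2 * R * norm (y - x)"]]) (use u(2) in \<open>auto intro!: always_eventually\<close>)
  ultimately have "D y - D x = 0" by (rule LIMSEQ_unique)
  then show ?thesis by (simp add: D_def)
qed

locale glued_cells =
  fixes X :: "'a::euclidean_space set" and \<C> :: "'a set set" and \<phi> :: "'a set \<Rightarrow> 'a \<Rightarrow> real"
  assumes X: "convex X" "X \<noteq> {}" and fin: "finite \<C>"
    and cells: "\<And>A. A \<in> \<C> \<Longrightarrow> polytope A" "\<And>A. A \<in> \<C> \<Longrightarrow> interior A \<noteq> {}"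
    and cover: "\<Union>\<C> = X" and bc: "boundary_covering \<C>"
    and cvx: "\<And>A. A \<in> \<C> \<Longrightarrow> convex_on UNIV (\<phi> A)"
    and cont: "\<And>A. A \<in> \<C> \<Longrightarrow> continuous_on UNIV (\<phi> A)"
    and overlap: "\<And>A B x y. A \<in> \<C> \<Longrightarrow> B \<in> \<C> \<Longrightarrow> neighbors A B \<Longrightarrow> x \<in> A \<inter> B \<Longrightarrow> y \<in> A \<inter> B \<Longrightarrow>
      \<phi> A x - \<phi> B x = \<phi> A y - \<phi> B y"
begin

lemma cell_closed: "A \<in> \<C> \<Longrightarrow> closed A" and cell_convex: "A \<in> \<C> \<Longrightarrow> convex A"
  using cells(1) polytope_imp_closed polytope_imp_convex by auto

lemma compact_X: "compact X"
  unfolding cover[symmetric] using fin cells(1) by (intro compact_Union) (auto intro: polytope_imp_compact)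

text \<open>
  A neighbourhood of \<open>x\<close> that meets only the cells containing \<open>x\<close>.
\<close>

definition star :: "'a \<Rightarrow> 'a set" where "star x = - \<Union>{A \<in> \<C>. x \<notin> A}"

lemma open_star: "open (star x)"
  unfolding star_def using fin cell_closed by (intro open_Compl closed_Union) auto

lemma in_star: "x \<in> star x" by (auto simp: star_def)

lemma star_cell: "z \<in> star x \<Longrightarrow> A \<in> \<C> \<Longrightarrow> z \<in> A \<Longrightarrow> x \<in> A"
  by (auto simp: star_def)

text \<open>
  For adjacent cells the difference is locally constant on the intersection: a cell that joins them at a
  nearby point also contains the point itself. The intersection is convex, hence connected.
\<close>

lemma meet_const:
  assumes AB: "A \<in> \<C>" "B \<in> \<C>" and x: "x \<in> A \<inter> B" and y: "y \<in> A \<inter> B"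
  shows "\<phi> A x - \<phi> B x = \<phi> A y - \<phi> B y"
proof (cases "neighbors A B")
  case True
  then show ?thesis using overlap AB x y by blast
next
  case False
  then have adj: "adjacent A B" using x by (auto simp: adjacent_def neighbors_def)
  show ?thesis
  proof (rule connected_local_const[where f="\<lambda>x. \<phi> A x - \<phi> B x", OF _ x y])
    show "connected (A \<inter> B)" using AB by (intro convex_connected convex_Int cell_convex)
    show "\<forall>u\<in>A \<inter> B. \<forall>\<^sub>F z in at u within A \<inter> B. \<phi> A u - \<phi> B u = \<phi> A z - \<phi> B z"
    proof
      fix u assume u: "u \<in> A \<inter> B"
      show "\<forall>\<^sub>F z in at u within A \<inter> B. \<phi> A u - \<phi> B u = \<phi> A z - \<phi> B z"
        unfolding eventually_at_topological
      proof (intro exI[of _ "star u"] conjI open_star in_star ballI impI)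
        fix z assume z: "z \<in> star u" "z \<noteq> u" "z \<in> A \<inter> B"
        obtain C where C: "C \<in> \<C>" "neighbors C A" "neighbors C B" "z \<in> C"
          using bc adj AB z(3) unfolding boundary_covering_def by blast
        have "u \<in> C" by (rule star_cell[OF z(1) C(1,4)])
        then have "\<phi> C u - \<phi> A u = \<phi> C z - \<phi> A z" "\<phi> C u - \<phi> B u = \<phi> C z - \<phi> B z"
          using overlap[OF C(1) AB(1) C(2)] overlap[OF C(1) AB(2) C(3)] u z C(4) by auto
        then show "\<phi> A u - \<phi> B u = \<phi> A z - \<phi> B z" by linarith
      qed
    qed
  qed
qed

text \<open>
  A Lebesgue number of the covering of \<open>X\<close> by the open sets \<open>star x\<close>.
\<close>

lemma lebesgue_number:
  obtains e where "e > 0" "\<And>p. p \<in> X \<Longrightarrow> \<exists>x\<in>X. \<forall>A\<in>\<C>. A \<inter> ball p e \<noteq> {} \<longrightarrow> x \<in> A"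
proof -
  obtain e where e: "0 < e" "\<And>p. p \<in> X \<Longrightarrow> \<exists>G\<in>star ` X. ball p e \<subseteq> G"
    by (rule Heine_Borel_lemma[OF compact_X, of "star ` X"]) (use in_star open_star in auto)
  have "\<exists>x\<in>X. \<forall>A\<in>\<C>. A \<inter> ball p e \<noteq> {} \<longrightarrow> x \<in> A" if p: "p \<in> X" for p
  proof -
    obtain x where "x \<in> X" "ball p e \<subseteq> star x" using e(2)[OF p] by blast
    then show ?thesis using star_cell by blast
  qed
  then show ?thesis using that e(1) by blast
qed

definition offset :: "'a set \<Rightarrow> 'a set \<Rightarrow> real" where
  "offset A B = (let p = SOME p. p \<in> A \<inter> B in \<phi> A p - \<phi> B p)"

lemma offset_eq:
  assumes "A \<in> \<C>" "B \<in> \<C>" "p \<in> A" "p \<in> B"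
  shows "offset A B = \<phi> A p - \<phi> B p"
  unfolding offset_def Let_def
  by (rule meet_const[OF assms(1,2)]) (use assms(3,4) someI[of "\<lambda>p. p \<in> A \<inter> B" p] in auto)

definition cell :: "'a \<Rightarrow> 'a set" where "cell x = (SOME A. A \<in> \<C> \<and> x \<in> A)"

lemma cell: "x \<in> X \<Longrightarrow> cell x \<in> \<C>" "x \<in> X \<Longrightarrow> x \<in> cell x"
  using someI_ex[of "\<lambda>A. A \<in> \<C> \<and> x \<in> A"] cover unfolding cell_def by auto

text \<open>
  For nearby points this is the increment from \<open>z\<close> to \<open>w\<close> of the function to be constructed.
\<close>

definition increment :: "'a \<Rightarrow> 'a \<Rightarrow> real" where
  "increment z w = \<phi> (cell w) w - \<phi> (cell z) z + offset (cell z) (cell w)"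

text \<open>
  The Poincare lemma on a convex set. Nearby increments are additive, because the cells involved have a common
  point. Summing them along the segment from a base point defines \<open>\<Phi>\<close>; moving the end point of the
  segment changes the sum by a telescoping series of increments across the thin quadrilaterals.
\<close>

lemma glue:
  obtains \<Phi> where "\<And>A. A \<in> \<C> \<Longrightarrow> \<exists>c. \<forall>x\<in>A. \<Phi> x = \<phi> A x + c"
proof -
  obtain e where e: "e > 0" and common: "\<And>p. p \<in> X \<Longrightarrow> \<exists>x\<in>X. \<forall>A\<in>\<C>. A \<inter> ball p e \<noteq> {} \<longrightarrow> x \<in> A"
    using lebesgue_number by blast
  have increment_add: "increment z u = increment z w + increment w u"
    if p: "p \<in> X" and zwu: "z \<in> X \<inter> ball p e" "w \<in> X \<inter> ball p e" "u \<in> X \<inter> ball p e" for p z w u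
  proof -
    obtain x where x: "\<forall>A\<in>\<C>. A \<inter> ball p e \<noteq> {} \<longrightarrow> x \<in> A" using common[OF p] by blast
    have "x \<in> cell z" "x \<in> cell w" "x \<in> cell u" using x cell zwu by blast+
    then show ?thesis
      using offset_eq[of "cell z" "cell w" x] offset_eq[of "cell w" "cell u" x] offset_eq[of "cell z" "cell u" x] cell zwu
      unfolding increment_def by auto
  qed
  have increment_cell: "increment z w = \<phi> A w - \<phi> A z"
    if z: "z \<in> A" and w: "w \<in> A" "dist z w < e" and A: "A \<in> \<C>" for z w A
  proof -
    have X: "z \<in> X" "w \<in> X" using z w A cover by auto
    obtain x where x: "\<forall>A\<in>\<C>. A \<inter> ball z e \<noteq> {} \<longrightarrow> x \<in> A" using common[OF X(1)] by blast
    have b: "z \<in> ball z e" "w \<in> ball z e" using w e by auto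
    have xs: "x \<in> cell z" "x \<in> cell w" "x \<in> A" using x cell X b z A by blast+
    have "offset (cell z) (cell w) = \<phi> (cell z) x - \<phi> (cell w) x"
      using offset_eq[of "cell z" "cell w" x] cell X xs by auto
    moreover have "\<phi> (cell z) z - \<phi> A z = \<phi> (cell z) x - \<phi> A x"
      by (rule meet_const) (use cell X xs z A in auto)
    moreover have "\<phi> (cell w) w - \<phi> A w = \<phi> (cell w) x - \<phi> A x"
      by (rule meet_const) (use cell X xs w A in auto)
    ultimately show ?thesis unfolding increment_def by linarith
  qed
  obtain x0 where x0: "x0 \<in> X" using X(2) by blast
  obtain d where d: "\<And>q. q \<in> X \<Longrightarrow> norm (q - x0) \<le> d"
    using compact_imp_bounded[OF compact_X] bounded_iff[of "(\<lambda>q. q - x0) ` X"] bounded_translation_minus[of X x0]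
    by (metis imageI)
  \<comment> \<open>so many pieces that consecutive division points of every segment are closer than \<open>e / 2\<close>\<close>
  obtain n0 :: nat where n0: "2 * d < real n0 * e" using reals_Archimedean3[OF e] by blast
  define n where "n = Suc n0"
  have n: "0 < real n" "d / real n < e / 2"
    using n0 e d[OF x0] by (auto simp: n_def field_simps)
  define pt where "pt q i = x0 + (real i / real n) *\<^sub>R (q - x0)" for q i
  have pt0: "pt q 0 = x0" and ptn: "pt q n = q" for q using n(1) by (simp_all add: pt_def)
  have ptX: "pt q i \<in> X" if "q \<in> X" "i \<le> n" for q i
  proof -
    have "pt q i = (1 - real i / real n) *\<^sub>R x0 + (real i / real n) *\<^sub>R q"
      unfolding pt_def by (simp add: algebra_simps)
    then show ?thesis using convexD_alt[OF X(1) x0 that(1), of "real i / real n"] that(2) n(1) by simp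
  qed
  have pt_step: "dist (pt q i) (pt q (Suc i)) < e / 2" if "q \<in> X" for q i
  proof -
    have "pt q i - pt q (Suc i) = - ((1 / real n) *\<^sub>R (q - x0))"
      unfolding pt_def by (simp add: add_divide_distrib scaleR_left_distrib)
    then have "dist (pt q i) (pt q (Suc i)) = norm (q - x0) / real n" using n(1) by (simp add: dist_norm)
    also have "\<dots> \<le> d / real n" using d[OF that] n(1) by (simp add: divide_right_mono)
    finally show ?thesis using n(2) by linarith
  qed
  have pt_dist: "dist (pt q i) (pt q' i) \<le> dist q q'" if "i \<le> n" for q q' i
  proof -
    have "pt q i - pt q' i = (real i / real n) *\<^sub>R (q - q')"
      unfolding pt_def by (simp add: scaleR_diff_right)
    then have "dist (pt q i) (pt q' i) = (real i / real n) * dist q q'" by (simp add: dist_norm)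
    also have "\<dots> \<le> 1 * dist q q'" using that n(1) by (intro mult_right_mono) auto
    finally show ?thesis by simp
  qed
  define \<Phi> where "\<Phi> q = (\<Sum>i<n. increment (pt q i) (pt q (Suc i)))" for q
  have loc: "\<Phi> q' - \<Phi> q = increment q q'" if q: "q \<in> X" "q' \<in> X" "dist q q' < e / 2" for q q'
  proof -
    have "increment (pt q' i) (pt q' (Suc i)) - increment (pt q i) (pt q (Suc i))
        = increment (pt q (Suc i)) (pt q' (Suc i)) - increment (pt q i) (pt q' i)" if i: "i < n" for i
    proof -
      let ?p = "pt q i"
      have 1: "?p \<in> X \<inter> ball ?p e" using ptX q i e by auto
      have 2: "pt q (Suc i) \<in> X \<inter> ball ?p e" using ptX q i e pt_step[OF q(1), of i] by auto
      have 3: "pt q' i \<in> X \<inter> ball ?p e" using ptX q i e pt_dist[of i q q'] by auto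
      have "dist ?p (pt q' (Suc i)) \<le> dist ?p (pt q' i) + dist (pt q' i) (pt q' (Suc i))" by (rule dist_triangle)
      then have 4: "pt q' (Suc i) \<in> X \<inter> ball ?p e"
        using ptX q i pt_dist[of i q q'] pt_step[OF q(2), of i] by auto
      show ?thesis
        using increment_add[of ?p ?p "pt q' i" "pt q' (Suc i)"] increment_add[of ?p ?p "pt q (Suc i)" "pt q' (Suc i)"] 1 2 3 4 by auto
    qed
    then have "\<Phi> q' - \<Phi> q = (\<Sum>i<n. increment (pt q (Suc i)) (pt q' (Suc i)) - increment (pt q i) (pt q' i))"
      unfolding \<Phi>_def by (simp add: sum_subtractf[symmetric])
    also have "\<dots> = increment (pt q n) (pt q' n) - increment (pt q 0) (pt q' 0)" by (rule sum_lessThan_telescope)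
    also have "increment (pt q 0) (pt q' 0) = 0"
    proof -
      have "increment x0 x0 = increment x0 x0 + increment x0 x0" using increment_add[OF x0, of x0 x0 x0] x0 e by simp
      then show ?thesis by (simp add: pt0)
    qed
    finally show ?thesis by (simp add: ptn)
  qed
  have "\<exists>c. \<forall>x\<in>A. \<Phi> x = \<phi> A x + c" if A: "A \<in> \<C>" for A
  proof -
    obtain a where a: "a \<in> A" using cells(2)[OF A] interior_subset by blast
    have "\<Phi> a - \<phi> A a = \<Phi> x - \<phi> A x" if x: "x \<in> A" for x
    proof (rule connected_local_const[where f="\<lambda>x. \<Phi> x - \<phi> A x", OF _ a x])
      show "connected A" by (intro convex_connected cell_convex A)
      show "\<forall>u\<in>A. \<forall>\<^sub>F z in at u within A. \<Phi> u - \<phi> A u = \<Phi> z - \<phi> A z"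
      proof
        fix u assume u: "u \<in> A"
        show "\<forall>\<^sub>F z in at u within A. \<Phi> u - \<phi> A u = \<Phi> z - \<phi> A z"
          unfolding eventually_at
        proof (intro exI[of _ "e/2"] conjI ballI impI)
          fix z assume z: "z \<in> A" "z \<noteq> u \<and> dist z u < e / 2"
          then have "\<Phi> z - \<Phi> u = \<phi> A z - \<phi> A u"
            using loc[of u z] increment_cell[OF u z(1) _ A] u A cover e by (auto simp: dist_commute)
          then show "\<Phi> u - \<phi> A u = \<Phi> z - \<phi> A z" by linarith
        qed (use e in simp)
      qed
    qed
    then show ?thesis by (intro exI[of _ "\<Phi> a - \<phi> A a"]) (auto simp: algebra_simps)
  qed
  then show ?thesis using that by blast
qed

text \<open>
  Strict validity of finitely many linear constraints is an open condition, so at a boundary point of a cell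
  one of its own constraints is active. The list \<open>P\<close> collects the constraints of all cells.
\<close>

lemma facets:
  obtains P :: "('a \<times> real) set" where "finite P" "\<And>a b. (a, b) \<in> P \<Longrightarrow> a \<noteq> 0"
    "\<And>A z. A \<in> \<C> \<Longrightarrow> z \<in> A \<Longrightarrow> z \<notin> interior A \<Longrightarrow> \<exists>(a, b)\<in>P. A \<subseteq> {x. a \<bullet> x \<le> b} \<and> a \<bullet> z = b"
proof -
  have "\<exists>P :: ('a \<times> real) set. finite P \<and> (\<forall>(a, b)\<in>P. a \<noteq> 0) \<and>
     (\<forall>z\<in>A. z \<notin> interior A \<longrightarrow> (\<exists>(a, b)\<in>P. A \<subseteq> {x. a \<bullet> x \<le> b} \<and> a \<bullet> z = b))" if A: "A \<in> \<C>" for A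
  proof -
    have "polyhedron A" using cells(1)[OF A] by (rule polytope_imp_polyhedron)
    then obtain F where F: "finite F" "A = \<Inter>F" "\<forall>h\<in>F. \<exists>a b. a \<noteq> 0 \<and> h = {x. a \<bullet> x \<le> b}"
      unfolding polyhedron_def by (elim exE conjE)
    then have "\<forall>h\<in>F. \<exists>ab. fst ab \<noteq> 0 \<and> h = {x. fst ab \<bullet> x \<le> snd ab}" by simp
    from bchoice[OF this] obtain ab where *: "\<forall>h\<in>F. fst (ab h) \<noteq> 0 \<and> h = {x. fst (ab h) \<bullet> x \<le> snd (ab h)}"
      by (elim exE)
    have ab1: "fst (ab h) \<noteq> 0" if "h \<in> F" for h by (rule conjunct1[OF bspec[OF * that]])
    have ab2: "x \<in> h \<longleftrightarrow> fst (ab h) \<bullet> x \<le> snd (ab h)" if "h \<in> F" for h x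
    proof -
      have "x \<in> h \<longleftrightarrow> x \<in> {x. fst (ab h) \<bullet> x \<le> snd (ab h)}"
        by (rule arg_cong[OF conjunct2[OF bspec[OF * that]]])
      then show ?thesis by (simp only: mem_Collect_eq)
    qed
    have "\<exists>h\<in>F. A \<subseteq> {x. fst (ab h) \<bullet> x \<le> snd (ab h)} \<and> fst (ab h) \<bullet> z = snd (ab h)"
      if z: "z \<in> A" "z \<notin> interior A" for z
    proof (rule ccontr)
      assume neg: "\<not> ?thesis"
      have "fst (ab h) \<bullet> z < snd (ab h)" if h: "h \<in> F" for h
      proof -
        have "A \<subseteq> {x. fst (ab h) \<bullet> x \<le> snd (ab h)}" using F(2) h ab2[OF h] by blast
        then have "fst (ab h) \<bullet> z \<noteq> snd (ab h)" "fst (ab h) \<bullet> z \<le> snd (ab h)" using neg h z(1) by blast+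
        then show ?thesis by linarith
      qed
      then have "z \<in> (\<Inter>h\<in>F. {x. fst (ab h) \<bullet> x < snd (ab h)})" by blast
      moreover have "open (\<Inter>h\<in>F. {x. fst (ab h) \<bullet> x < snd (ab h)})"
        using F(1) by (intro open_INT) (auto intro: open_halfspace_lt)
      moreover have "(\<Inter>h\<in>F. {x. fst (ab h) \<bullet> x < snd (ab h)}) \<subseteq> A"
        unfolding F(2) using ab2 less_imp_le by blast
      ultimately show False using z(2) interiorI by blast
    qed
    then show ?thesis using F(1) ab1 by (intro exI[of _ "ab ` F"]) (auto simp: case_prod_beta)
  qed
  then have "\<forall>A\<in>\<C>. \<exists>P :: ('a \<times> real) set. finite P \<and> (\<forall>(a, b)\<in>P. a \<noteq> 0) \<and>
     (\<forall>z\<in>A. z \<notin> interior A \<longrightarrow> (\<exists>(a, b)\<in>P. A \<subseteq> {x. a \<bullet> x \<le> b} \<and> a \<bullet> z = b))" by blast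
  from bchoice[OF this] obtain Q where Q: "\<And>A. A \<in> \<C> \<Longrightarrow> finite (Q A)" "\<And>A a b. A \<in> \<C> \<Longrightarrow> (a, b) \<in> Q A \<Longrightarrow> a \<noteq> 0"
    "\<And>A z. A \<in> \<C> \<Longrightarrow> z \<in> A \<Longrightarrow> z \<notin> interior A \<Longrightarrow> \<exists>(a, b)\<in>Q A. A \<subseteq> {x. a \<bullet> x \<le> b} \<and> a \<bullet> z = b"
    by fast
  show ?thesis
  proof (rule that[of "\<Union>A\<in>\<C>. Q A"])
    show "finite (\<Union>A\<in>\<C>. Q A)" using fin Q(1) by blast
    show "\<And>a b. (a, b) \<in> (\<Union>A\<in>\<C>. Q A) \<Longrightarrow> a \<noteq> 0" using Q(2) by blast
    show "\<exists>(a, b)\<in>\<Union>A\<in>\<C>. Q A. A \<subseteq> {x. a \<bullet> x \<le> b} \<and> a \<bullet> z = b" if "A \<in> \<C>" "z \<in> A" "z \<notin> interior A" for A z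
      using Q(3)[OF that] that(1) by fast
  qed
qed

text \<open>
  If all facet normals at \<open>z\<close> were proportional, each cell at \<open>z\<close> would lie on one side of the same
  hyperplane. Both sides occur, and two cells on different sides are adjacent. The boundary covering
  assumption yields a cell at \<open>z\<close> that overlaps both of them, although it lies on one side.
\<close>

lemma two_facets_at_uncovered_point:
  fixes P :: "('a \<times> real) set"
  assumes P: "\<And>a b. (a, b) \<in> P \<Longrightarrow> a \<noteq> 0"
    "\<And>A z. A \<in> \<C> \<Longrightarrow> z \<in> A \<Longrightarrow> z \<notin> interior A \<Longrightarrow> \<exists>(a, b)\<in>P. A \<subseteq> {x. a \<bullet> x \<le> b} \<and> a \<bullet> z = b"
    and z: "z \<in> interior X" "\<And>A. A \<in> \<C> \<Longrightarrow> z \<notin> interior A"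
  shows "\<exists>(a, b)\<in>P. \<exists>(a', b')\<in>P. a \<bullet> z = b \<and> a' \<bullet> z = b' \<and> (\<forall>c. a' \<noteq> c *\<^sub>R a)"
proof (rule ccontr)
  assume neg: "\<not> ?thesis"
  have zX: "z \<in> X" using z(1) interior_subset by blast
  obtain a b where ab: "(a, b) \<in> P" "a \<bullet> z = b"
    using P(2)[OF cell(1)[OF zX] cell(2)[OF zX]] z(2)[OF cell(1)[OF zX]] by blast
  have a0: "a \<noteq> 0" by (rule P(1)[OF ab(1)])
  have side: "(\<forall>x\<in>A. 0 \<le> a \<bullet> (x - z)) \<or> (\<forall>x\<in>A. a \<bullet> (x - z) \<le> 0)" if A: "A \<in> \<C>" "z \<in> A" for A
  proof -
    obtain a' b' where ab': "(a', b') \<in> P" "A \<subseteq> {x. a' \<bullet> x \<le> b'}" "a' \<bullet> z = b'"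
      using P(2)[OF A] z(2)[OF A(1)] by blast
    then obtain c where c: "a' = c *\<^sub>R a" using neg ab by blast
    have "c * (a \<bullet> (x - z)) \<le> 0" if "x \<in> A" for x
      using ab'(2,3) that c by (auto simp: inner_diff_right right_diff_distrib)
    moreover have "c \<noteq> 0" using c P(1)[OF ab'(1)] by auto
    ultimately show ?thesis by (cases "c > 0") (auto simp: mult_le_0_iff)
  qed
  have flat: "interior S = {}" if "\<And>x. x \<in> S \<Longrightarrow> a \<bullet> (x - z) = 0" for S
  proof -
    have "S \<subseteq> {x. a \<bullet> x = b}" using that ab(2) by (auto simp: inner_diff_right)
    then show ?thesis using interior_mono[of S "{x. a \<bullet> x = b}"] interior_hyperplane[OF a0] by auto
  qed
  have "open (star z \<inter> interior X)" using open_star by auto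
  then obtain d where d: "d > 0" "ball z d \<subseteq> star z \<inter> interior X"
    using z(1) in_star by (metis IntI open_contains_ball)
  define s where "s = d / (2 * norm a)"
  have s: "s > 0" "\<bar>s\<bar> * norm a < d" using d a0 by (auto simp: s_def)
  have ex: "\<exists>A\<in>\<C>. z \<in> A \<and> z + t *\<^sub>R a \<in> A" if "\<bar>t\<bar> = s" for t
  proof -
    have "z + t *\<^sub>R a \<in> ball z d" using s that by (simp add: dist_norm)
    then have w: "z + t *\<^sub>R a \<in> star z" "z + t *\<^sub>R a \<in> X" using d interior_subset[of X] by auto
    then show ?thesis using star_cell[OF w(1)] cover by blast
  qed
  obtain A1 where A1: "A1 \<in> \<C>" "z \<in> A1" "z + s *\<^sub>R a \<in> A1" using ex[of s] s by auto
  obtain A2 where A2: "A2 \<in> \<C>" "z \<in> A2" "z + (- s) *\<^sub>R a \<in> A2" using ex[of "- s"] s by auto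
  have aa: "0 < s * (a \<bullet> a)" using a0 s(1) by simp
  have p1: "0 \<le> a \<bullet> (x - z)" if "x \<in> A1" for x
  proof -
    have "a \<bullet> ((z + s *\<^sub>R a) - z) = s * (a \<bullet> a)" by simp
    then have "\<not> a \<bullet> ((z + s *\<^sub>R a) - z) \<le> 0" using aa by linarith
    then show ?thesis using side[OF A1(1,2)] A1(3) that by blast
  qed
  have p2: "a \<bullet> (x - z) \<le> 0" if "x \<in> A2" for x
  proof -
    have "a \<bullet> ((z + (- s) *\<^sub>R a) - z) = - (s * (a \<bullet> a))" by simp
    then have "\<not> 0 \<le> a \<bullet> ((z + (- s) *\<^sub>R a) - z)" using aa by linarith
    then show ?thesis using side[OF A2(1,2)] A2(3) that by blast
  qed
  have "interior (A1 \<inter> A2) = {}" by (rule flat) (use p1 p2 in \<open>auto intro: antisym\<close>)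
  then have "adjacent A1 A2" using A1(2) A2(2) by (auto simp: adjacent_def)
  then obtain C where C: "C \<in> \<C>" "neighbors C A1" "neighbors C A2" "z \<in> C"
    using bc A1 A2 unfolding boundary_covering_def by blast
  from side[OF C(1,4)] show False
  proof
    assume "\<forall>x\<in>C. 0 \<le> a \<bullet> (x - z)"
    then have "interior (C \<inter> A2) = {}" by (intro flat) (use p2 in \<open>auto intro: antisym\<close>)
    then show False using C(3) by (simp add: neighbors_def)
  next
    assume "\<forall>x\<in>C. a \<bullet> (x - z) \<le> 0"
    then have "interior (C \<inter> A1) = {}" by (intro flat) (use p1 in \<open>auto intro: antisym\<close>)
    then show False using C(2) by (simp add: neighbors_def)
  qed
qed

end

section \<open>Convexity of the glued potential\<close>

text \<open>
  At the leftmost maximiser of the difference between the function and its chord, a positive maximum would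
  contradict the midpoint inequality, because the values to the left are strictly smaller.
\<close>

lemma locally_midpoint_convex:
  fixes g :: "real \<Rightarrow> real"
  assumes cont: "continuous_on {0..1} g"
    and mid: "\<And>t. 0 < t \<Longrightarrow> t < 1 \<Longrightarrow> \<exists>e>0. \<forall>h. 0 < h \<and> h < e \<longrightarrow> 2 * g t \<le> g (t - h) + g (t + h)"
    and t: "t \<in> {0..1}"
  shows "g t \<le> (1 - t) * g 0 + t * g 1"
proof (rule ccontr)
  define f where "f t = g t - ((1 - t) * g 0 + t * g 1)" for t
  assume "\<not> ?thesis"
  then have ft: "0 < f t" by (simp add: f_def)
  have cf: "continuous_on {0..1} f" unfolding f_def by (intro continuous_intros cont)
  obtain s where s: "s \<in> {0..1}" "\<And>u. u \<in> {0..1} \<Longrightarrow> f u \<le> f s"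
    using continuous_attains_sup[OF compact_Icc, of 0 1 f] cf by auto
  define S where "S = {u \<in> {0..1}. f u = f s}"
  have "closed S" unfolding S_def by (rule continuous_closed_preimage_constant[OF cf]) simp
  then have "compact S" unfolding compact_eq_bounded_closed S_def by (auto intro: bounded_subset[of "{0..1::real}"])
  then obtain u where u: "u \<in> S" "\<And>v. v \<in> S \<Longrightarrow> u \<le> v"
    using compact_attains_inf[of S] s(1) by (auto simp: S_def)
  have fs: "0 < f s" using s(2)[OF t] ft by simp
  have "f 0 = 0" "f 1 = 0" by (simp_all add: f_def)
  then have u01: "0 < u" "u < 1" using u(1) fs by (auto simp: S_def less_le)
  obtain e where e: "e > 0" "\<And>h. 0 < h \<Longrightarrow> h < e \<Longrightarrow> 2 * g u \<le> g (u - h) + g (u + h)"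
    using mid[OF u01] by blast
  \<comment> \<open>small enough to stay in the range of the midpoint inequality and inside the unit interval\<close>
  define h where "h = min (e / 2) (min (u / 2) ((1 - u) / 2))"
  have "h \<le> e / 2" "h \<le> min (u / 2) ((1 - u) / 2)" unfolding h_def by (rule min.cobounded1, rule min.cobounded2)
  then have "h \<le> e / 2" "h \<le> u / 2" "h \<le> (1 - u) / 2" by (simp_all only: min.bounded_iff)
  moreover have "0 < h" using e(1) u01 by (simp add: h_def)
  ultimately have hs: "h \<le> e / 2" "h \<le> u / 2" "h \<le> (1 - u) / 2" "0 < h" by blast+
  have h: "0 < h" "h < e" "0 < u - h" "u + h < 1"
    using hs e(1) u01 by (simp_all add: field_simps)
  have "2 * f u \<le> f (u - h) + f (u + h)"
    using e(2)[OF h(1,2)] by (simp add: f_def algebra_simps)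
  moreover have "f (u + h) \<le> f s" by (rule s(2)) (use h u01 in auto)
  moreover have "f (u - h) < f s"
  proof -
    have "u - h \<notin> S" using u(2)[of "u - h"] h(1) by auto
    then show ?thesis using s(2)[of "u - h"] h u01 by (auto simp: S_def less_le)
  qed
  ultimately show False using u(1) by (simp add: S_def)
qed

context glued_cells
begin

lemma interior_X_nonempty: "interior X \<noteq> {}"
proof -
  obtain A where "A \<in> \<C>" using X(2) cover by blast
  then show ?thesis using cells(2)[of A] interior_mono[of A X] cover by blast
qed

lemma approx_interior:
  assumes "negligible N" "x \<in> X" "0 < e"
  obtains p where "p \<in> interior X" "p \<notin> N" "dist p x < e"
proof -
  have "x \<in> closure (interior X)"
    using assms(2) convex_closure_interior[OF X(1) interior_X_nonempty] closure_subset by blast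
  then obtain y where "y \<in> interior X" "dist y x < e" using assms(3) closure_approachable by blast
  then have "interior X \<inter> ball x e \<noteq> {}" by (auto simp: dist_commute)
  moreover have "open (interior X \<inter> ball x e)" by auto
  ultimately obtain p where "p \<in> interior X \<inter> ball x e" "p \<notin> N"
    using avoid_negligible[OF assms(1)] by blast
  then show ?thesis using that by (auto simp: dist_commute)
qed

lemma glue_continuous:
  assumes "\<And>A. A \<in> \<C> \<Longrightarrow> \<exists>c. \<forall>x\<in>A. \<Phi> x = \<phi> A x + c"
  shows "continuous_on X \<Phi>"
proof -
  have "continuous_on A \<Phi>" if A: "A \<in> \<C>" for A
  proof -
    obtain c where c: "\<forall>x\<in>A. \<Phi> x = \<phi> A x + c" using assms[OF A] by blast
    have "continuous_on A (\<lambda>x. \<phi> A x + c)"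
      by (intro continuous_intros continuous_on_subset[OF cont[OF A]]) auto
    then show ?thesis by (rule continuous_on_eq) (use c in auto)
  qed
  then have "continuous_on (\<Union>A\<in>\<C>. A) \<Phi>"
    by (intro continuous_on_closed_Union fin cell_closed)
  then show ?thesis using cover by simp
qed

text \<open>
  If a segment from \<open>p\<close> to \<open>q\<close> hits \<open>a \<bullet> z = b\<close> and \<open>a' \<bullet> z = b'\<close> at the same point, eliminating the
  parameter puts \<open>q\<close> on a hyperplane through \<open>p\<close>. Finitely many such hyperplanes are negligible, so generic
  segments meet only points that are interior to a cell. Continuity extends convexity to all segments.
\<close>

lemma glue_convex:
  assumes glue: "\<And>A. A \<in> \<C> \<Longrightarrow> \<exists>c. \<forall>x\<in>A. \<Phi> x = \<phi> A x + c"
  shows "convex_on X \<Phi>"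
proof -
  have c\<Phi>: "continuous_on X \<Phi>" by (rule glue_continuous[OF glue])
  obtain P :: "('a \<times> real) set" where P: "finite P" "\<And>a b. (a, b) \<in> P \<Longrightarrow> a \<noteq> 0"
    "\<And>A z. A \<in> \<C> \<Longrightarrow> z \<in> A \<Longrightarrow> z \<notin> interior A \<Longrightarrow> \<exists>(a, b)\<in>P. A \<subseteq> {x. a \<bullet> x \<le> b} \<and> a \<bullet> z = b"
    using facets by blast
  define H where "H = (\<Union>(a, b)\<in>P. {x. a \<bullet> x = b})"
  \<comment> \<open>the normal of the hyperplane of end points \<open>q\<close> for which both constraints are active at one point\<close>
  define nv where "nv p w = (snd (fst w) - fst (fst w) \<bullet> p) *\<^sub>R fst (snd w) - (snd (snd w) - fst (snd w) \<bullet> p) *\<^sub>R fst (fst w)"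
    for p and w :: "('a \<times> real) \<times> ('a \<times> real)"
  define Bad where "Bad p = (\<Union>w\<in>{w \<in> P \<times> P. nv p w \<noteq> 0}. {q. nv p w \<bullet> q = nv p w \<bullet> p})" for p
  have negH: "negligible H" unfolding H_def
    using P(1,2) by (intro negligible_Union) (auto intro: negligible_hyperplane)
  have negB: "negligible (Bad p)" for p unfolding Bad_def
    using P(1) by (intro negligible_Union) (auto intro!: negligible_hyperplane)
  have generic: "\<Phi> (p + t *\<^sub>R (q - p)) \<le> (1 - t) * \<Phi> p + t * \<Phi> q"
    if p: "p \<in> interior X" "p \<notin> H" and q: "q \<in> interior X" "q \<notin> Bad p" and t: "t \<in> {0..1}" for p q t
  proof -
    define g where "g t = \<Phi> (p + t *\<^sub>R (q - p))" for t
    have zint: "p + t *\<^sub>R (q - p) \<in> interior X" if "t \<in> {0..1}" for t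
    proof -
      have "p + t *\<^sub>R (q - p) = (1 - t) *\<^sub>R p + t *\<^sub>R q" by (simp add: algebra_simps)
      then show ?thesis using convexD_alt[OF convex_interior[OF X(1)] p(1) q(1), of t] that by simp
    qed
    have "continuous_on {0..1} g" unfolding g_def
      by (rule continuous_on_compose2[OF c\<Phi>]) (use subsetD[OF interior_subset zint] in \<open>auto intro!: continuous_intros\<close>)
    moreover have "\<exists>e>0. \<forall>h. 0 < h \<and> h < e \<longrightarrow> 2 * g t \<le> g (t - h) + g (t + h)" if t: "0 < t" "t < 1" for t
    proof -
      define z where "z = p + t *\<^sub>R (q - p)"
      have "\<exists>A\<in>\<C>. z \<in> interior A"
      proof (rule ccontr)
        assume no: "\<not> ?thesis"
        have zi: "z \<in> interior X" unfolding z_def using zint[of t] t by auto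
        have "\<exists>(a, b)\<in>P. \<exists>(a', b')\<in>P. a \<bullet> z = b \<and> a' \<bullet> z = b' \<and> (\<forall>c. a' \<noteq> c *\<^sub>R a)"
          by (rule two_facets_at_uncovered_point) (use P(2,3) zi no in blast)+
        then obtain a b a' b' where ab: "(a, b) \<in> P" "(a', b') \<in> P" "a \<bullet> z = b" "a' \<bullet> z = b'" "\<forall>c. a' \<noteq> c *\<^sub>R a"
          by blast
        define w where "w = ((a, b), (a', b'))"
        have pos: "b - a \<bullet> p \<noteq> 0" using p(2) ab(1) by (auto simp: H_def)
        have e1: "b - a \<bullet> p = t * (a \<bullet> (q - p))" and e2: "b' - a' \<bullet> p = t * (a' \<bullet> (q - p))"
          using ab(3,4) by (auto simp: z_def inner_add_right)
        have "nv p w \<noteq> 0"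
        proof
          assume "nv p w = 0"
          then have "(b - a \<bullet> p) *\<^sub>R a' = (b' - a' \<bullet> p) *\<^sub>R a" by (simp add: nv_def w_def)
          then have "(1 / (b - a \<bullet> p)) *\<^sub>R (b - a \<bullet> p) *\<^sub>R a' = (1 / (b - a \<bullet> p)) *\<^sub>R (b' - a' \<bullet> p) *\<^sub>R a" by simp
          then have "a' = ((1 / (b - a \<bullet> p)) * (b' - a' \<bullet> p)) *\<^sub>R a" using pos by simp
          then show False using ab(5) by blast
        qed
        moreover have "nv p w \<bullet> (q - p) = 0"
        proof -
          have "nv p w \<bullet> (q - p) = (b - a \<bullet> p) * (a' \<bullet> (q - p)) - (b' - a' \<bullet> p) * (a \<bullet> (q - p))"
            by (simp add: nv_def w_def inner_diff_left)
          then show ?thesis unfolding e1 e2 by simp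
        qed
        ultimately have "q \<in> Bad p" using ab(1,2) by (auto simp: Bad_def w_def inner_diff_right)
        then show False using q(2) by blast
      qed
      then obtain A where A: "A \<in> \<C>" "z \<in> interior A" by blast
      obtain c where c: "\<forall>x\<in>A. \<Phi> x = \<phi> A x + c" using glue[OF A(1)] by blast
      obtain d where d: "d > 0" "ball z d \<subseteq> A" using A(2) mem_interior by blast
      show ?thesis
      proof (intro exI[of _ "d / (norm (q - p) + 1)"] conjI allI impI)
        show "0 < d / (norm (q - p) + 1)" using d(1) by (intro divide_pos_pos) (auto intro: add_nonneg_pos)
        fix h assume h: "0 < h \<and> h < d / (norm (q - p) + 1)"
        have "h * (norm (q - p) + 1) < d" using h by (simp add: pos_less_divide_eq add_nonneg_pos)
        then have hd: "\<bar>h\<bar> * norm (q - p) < d" using h by (simp add: algebra_simps)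
        have m: "z - h *\<^sub>R (q - p) \<in> A" "z + h *\<^sub>R (q - p) \<in> A" "z \<in> A"
          using hd d by (auto simp: subset_iff dist_norm)
        have "\<phi> A ((1 - 1/2) *\<^sub>R (z - h *\<^sub>R (q - p)) + (1/2) *\<^sub>R (z + h *\<^sub>R (q - p)))
           \<le> (1 - 1/2) * \<phi> A (z - h *\<^sub>R (q - p)) + (1/2) * \<phi> A (z + h *\<^sub>R (q - p))"
          by (rule convex_onD[OF cvx[OF A(1)]]) auto
        moreover have "(1 - 1/2) *\<^sub>R (z - h *\<^sub>R (q - p)) + (1/2) *\<^sub>R (z + h *\<^sub>R (q - p)) = z"
          by (simp add: algebra_simps flip: scaleR_left.add)
        ultimately have "2 * \<phi> A z \<le> \<phi> A (z - h *\<^sub>R (q - p)) + \<phi> A (z + h *\<^sub>R (q - p))" by simp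
        then have F: "2 * \<Phi> z \<le> \<Phi> (z - h *\<^sub>R (q - p)) + \<Phi> (z + h *\<^sub>R (q - p))"
          using c m by simp
        have e12: "z - h *\<^sub>R (q - p) = p + (t - h) *\<^sub>R (q - p)" "z + h *\<^sub>R (q - p) = p + (t + h) *\<^sub>R (q - p)"
          by (simp_all add: z_def scaleR_left_diff_distrib scaleR_left_distrib)
        show "2 * g t \<le> g (t - h) + g (t + h)"
          using F unfolding e12 g_def by (simp only: z_def)
      qed
    qed
    ultimately have "g t \<le> (1 - t) * g 0 + t * g 1" by (rule locally_midpoint_convex[OF _ _ t])
    then show ?thesis by (simp add: g_def)
  qed
  show ?thesis
  proof (rule convex_onI)
    fix t :: real and x y assume t: "0 < t" "t < 1" and xy: "x \<in> X" "y \<in> X"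
    have "\<exists>pq. fst pq \<in> interior X \<and> fst pq \<notin> H \<and> snd pq \<in> interior X \<and> snd pq \<notin> Bad (fst pq)
       \<and> dist (fst pq) x < 1 / real (Suc n) \<and> dist (snd pq) y < 1 / real (Suc n)" for n
    proof -
      have e: "0 < 1 / real (Suc n)" by simp
      obtain p where p: "p \<in> interior X" "p \<notin> H" "dist p x < 1 / real (Suc n)"
        by (rule approx_interior[OF negH xy(1) e])
      obtain q where "q \<in> interior X" "q \<notin> Bad p" "dist q y < 1 / real (Suc n)"
        by (rule approx_interior[OF negB xy(2) e])
      then show ?thesis using p by (intro exI[of _ "(p, q)"]) simp
    qed
    then have "\<exists>pq. \<forall>n. fst (pq n) \<in> interior X \<and> fst (pq n) \<notin> H \<and> snd (pq n) \<in> interior X \<and> snd (pq n) \<notin> Bad (fst (pq n))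
       \<and> dist (fst (pq n)) x < 1 / real (Suc n) \<and> dist (snd (pq n)) y < 1 / real (Suc n)"
      by (intro choice allI)
    then obtain pq where pq: "\<And>n. fst (pq n) \<in> interior X \<and> fst (pq n) \<notin> H \<and> snd (pq n) \<in> interior X \<and> snd (pq n) \<notin> Bad (fst (pq n))
       \<and> dist (fst (pq n)) x < 1 / real (Suc n) \<and> dist (snd (pq n)) y < 1 / real (Suc n)"
      by blast
    have null: "(\<lambda>n. 1 / real (Suc n)) \<longlonglongrightarrow> 0"
      using LIMSEQ_Suc[OF lim_const_over_n[of "1::real"]] by simp
    have l1: "(\<lambda>n. fst (pq n)) \<longlonglongrightarrow> x"
      by (rule Lim_transform2[OF tendsto_const], rule Lim_null_comparison[OF _ null])
         (use pq in \<open>auto simp: dist_norm norm_minus_commute intro!: always_eventually less_imp_le\<close>)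
    have l2: "(\<lambda>n. snd (pq n)) \<longlonglongrightarrow> y"
      by (rule Lim_transform2[OF tendsto_const], rule Lim_null_comparison[OF _ null])
         (use pq in \<open>auto simp: dist_norm norm_minus_commute intro!: always_eventually less_imp_le\<close>)
    have inX: "fst (pq n) \<in> X" "snd (pq n) \<in> X" "fst (pq n) + t *\<^sub>R (snd (pq n) - fst (pq n)) \<in> X" for n
    proof -
      show a: "fst (pq n) \<in> X" "snd (pq n) \<in> X" using pq[of n] interior_subset by blast+
      have "fst (pq n) + t *\<^sub>R (snd (pq n) - fst (pq n)) = (1 - t) *\<^sub>R fst (pq n) + t *\<^sub>R snd (pq n)"
        by (simp add: algebra_simps)
      then show "fst (pq n) + t *\<^sub>R (snd (pq n) - fst (pq n)) \<in> X"
        using convexD_alt[OF X(1) a, of t] t by simp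
    qed
    have z: "x + t *\<^sub>R (y - x) = (1 - t) *\<^sub>R x + t *\<^sub>R y" by (simp add: algebra_simps)
    then have zX: "x + t *\<^sub>R (y - x) \<in> X" using convexD_alt[OF X(1) xy, of t] t by simp
    have "\<Phi> (x + t *\<^sub>R (y - x)) \<le> (1 - t) * \<Phi> x + t * \<Phi> y"
    proof (rule LIMSEQ_le)
      have "(\<lambda>n. fst (pq n) + t *\<^sub>R (snd (pq n) - fst (pq n))) \<longlonglongrightarrow> x + t *\<^sub>R (y - x)"
        by (intro tendsto_intros l1 l2)
      then show "(\<lambda>n. \<Phi> (fst (pq n) + t *\<^sub>R (snd (pq n) - fst (pq n)))) \<longlonglongrightarrow> \<Phi> (x + t *\<^sub>R (y - x))"
        by (rule continuous_on_tendsto_compose[OF c\<Phi> _ zX]) (use inX in auto)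
      show "(\<lambda>n. (1 - t) * \<Phi> (fst (pq n)) + t * \<Phi> (snd (pq n))) \<longlonglongrightarrow> (1 - t) * \<Phi> x + t * \<Phi> y"
        by (intro tendsto_intros continuous_on_tendsto_compose[OF c\<Phi> l1 xy(1)] continuous_on_tendsto_compose[OF c\<Phi> l2 xy(2)])
           (use inX in auto)
      show "\<exists>N. \<forall>n\<ge>N. \<Phi> (fst (pq n) + t *\<^sub>R (snd (pq n) - fst (pq n))) \<le> (1 - t) * \<Phi> (fst (pq n)) + t * \<Phi> (snd (pq n))"
        using generic pq t by auto
    qed
    then show "\<Phi> ((1 - t) *\<^sub>R x + t *\<^sub>R y) \<le> (1 - t) * \<Phi> x + t * \<Phi> y" unfolding z .
  qed (rule X(1))
qed

lemma glue_subgradient: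
  assumes glue: "\<And>A. A \<in> \<C> \<Longrightarrow> \<exists>c. \<forall>x\<in>A. \<Phi> x = \<phi> A x + c"
    and A: "A \<in> \<C>" "x \<in> interior A" and p: "subgradient (\<phi> A) x p" and y: "y \<in> X"
  shows "\<Phi> x + p \<bullet> (y - x) \<le> \<Phi> y"
proof -
  obtain c where c: "\<forall>x\<in>A. \<Phi> x = \<phi> A x + c" using glue[OF A(1)] by blast
  obtain d where d: "d > 0" "ball x d \<subseteq> A" using A(2) mem_interior by blast
  have xA: "x \<in> A" using A(2) interior_subset by blast
  then have xX: "x \<in> X" using A(1) cover by blast
  define t where "t = min 1 (d / (2 * (norm (y - x) + 1)))"
  have n: "0 < norm (y - x) + 1" by (simp add: add_nonneg_pos)
  have half: "d / (2 * N) * N = d / 2" if "0 < N" for N using that by (simp add: field_simps)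
  have t: "0 < t" "t \<le> 1" using d(1) n by (auto simp: t_def)
  have "t * norm (y - x) \<le> d / (2 * (norm (y - x) + 1)) * (norm (y - x) + 1)"
    using t n d(1) by (intro mult_mono) (auto simp: t_def)
  also have "\<dots> = d / 2" using half[OF n] .
  also have "\<dots> < d" using d(1) by simp
  finally have zA: "x + t *\<^sub>R (y - x) \<in> A" using d(2) t by (auto simp: subset_iff dist_norm)
  have z: "x + t *\<^sub>R (y - x) = (1 - t) *\<^sub>R x + t *\<^sub>R y" by (simp add: algebra_simps)
  have "\<Phi> x + t * (p \<bullet> (y - x)) \<le> \<Phi> (x + t *\<^sub>R (y - x))"
  proof -
    have "\<phi> A x + p \<bullet> (x + t *\<^sub>R (y - x) - x) \<le> \<phi> A (x + t *\<^sub>R (y - x))"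
      using p unfolding subgradient_def by blast
    then show ?thesis using c xA zA by simp
  qed
  also have "\<dots> \<le> (1 - t) * \<Phi> x + t * \<Phi> y"
    unfolding z by (rule convex_onD[OF glue_convex[OF glue]]) (use t xX y in auto)
  finally have "t * (\<Phi> x + p \<bullet> (y - x)) \<le> t * \<Phi> y" by (simp add: algebra_simps)
  then show ?thesis using t(1) by simp
qed

end

section \<open>Iterates as maps\<close>

text \<open>
  The part of the plan over the cells visited so far is a graph; after \<open>K\<close> steps these cells cover \<open>X\<close>.
\<close>

lemma iterates_are_maps:
  fixes X Y :: "'a::euclidean_space set" and A :: "nat \<Rightarrow> 'a set"
  assumes R: "0 \<le> R" and X: "closed X" "X \<subseteq> cball 0 R" and Y: "Y \<subseteq> cball 0 R"
    and \<mu>: "measure_on X \<mu>" "finite_measure \<mu>" "absolutely_continuous lborel (ambient \<mu>)"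
    and \<nu>: "measure_on Y \<nu>"
    and K: "0 < K" and A: "\<And>j. closed (A j)" and cover: "X \<subseteq> (\<Union>j<K. A j)"
    and \<pi>0: "\<pi> 0 \<in> couplings X Y \<mu> \<nu>"
    and \<pi>_Suc: "\<And>k. \<pi> (Suc k) = domdec_step X Y \<mu> (A (k mod K)) (\<pi> k)"
  obtains f T where "cell_sweep R (ambient \<mu>) K A f T" "\<And>k. \<pi> k \<in> couplings X Y \<mu> \<nu>"
    "\<And>k. K \<le> k \<Longrightarrow> ambient (\<pi> k) = distr (ambient \<mu>) borel (\<lambda>x. (x, T k x))"
proof -
  let ?m = "ambient \<mu>"
  have c: "\<pi> k \<in> couplings X Y \<mu> \<nu>" for k
  proof (induction k)
    case (Suc k)
    show ?case
      unfolding \<pi>_Suc by (rule domdec_step_map[OF R X Y \<mu> \<nu> Suc A[of "k mod K"]])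
  qed (rule \<pi>0)
  have "\<exists>f. potential R f \<and>
    (\<forall>D\<in>sets borel. emeasure (ambient (\<pi> (Suc k))) D =
       emeasure ?m (A (k mod K) \<inter> {x. (x, grad (legendre R f) x) \<in> D}) + emeasure (ambient (\<pi> k)) (D \<inter> ((- A (k mod K)) \<times> UNIV))) \<and>
    (\<forall>D\<in>sets borel. emeasure ?m (A (k mod K) \<inter> grad (legendre R f) -` D) = emeasure (ambient (\<pi> k)) (A (k mod K) \<times> D))" for k
    unfolding \<pi>_Suc by (rule domdec_step_map[OF R X Y \<mu> \<nu> c[of k] A[of "k mod K"]]) blast
  then have "\<exists>f. \<forall>k. potential R (f k) \<and>
    (\<forall>D\<in>sets borel. emeasure (ambient (\<pi> (Suc k))) D =
       emeasure ?m (A (k mod K) \<inter> {x. (x, grad (legendre R (f k)) x) \<in> D}) + emeasure (ambient (\<pi> k)) (D \<inter> ((- A (k mod K)) \<times> UNIV))) \<and>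
    (\<forall>D\<in>sets borel. emeasure ?m (A (k mod K) \<inter> grad (legendre R (f k)) -` D) = emeasure (ambient (\<pi> k)) (A (k mod K) \<times> D))"
    by (intro choice allI)
  then obtain f where f: "\<And>k. potential R (f k)"
    and step: "\<And>k D. D \<in> sets borel \<Longrightarrow> emeasure (ambient (\<pi> (Suc k))) D =
       emeasure ?m (A (k mod K) \<inter> {x. (x, grad (legendre R (f k)) x) \<in> D}) + emeasure (ambient (\<pi> k)) (D \<inter> ((- A (k mod K)) \<times> UNIV))"
    and marg: "\<And>k D. D \<in> sets borel \<Longrightarrow> emeasure ?m (A (k mod K) \<inter> grad (legendre R (f k)) -` D) = emeasure (ambient (\<pi> k)) (A (k mod K) \<times> D)"
    by blast
  define T where "T = rec_nat (\<lambda>_. 0) (\<lambda>k S x. if x \<in> A (k mod K) then grad (legendre R (f k)) x else S x)"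
  have T0: "T 0 = (\<lambda>_. 0)" and T_Suc: "T (Suc k) x = (if x \<in> A (k mod K) then grad (legendre R (f k)) x else T k x)" for k x
    by (simp_all add: T_def)
  have Tm: "T k \<in> borel_measurable borel" for k
  proof (induction k)
    case (Suc k)
    have "T (Suc k) = (\<lambda>x. if x \<in> A (k mod K) then grad (legendre R (f k)) x else T k x)"
      using T_Suc by blast
    then show ?case
      using Suc A[of "k mod K"] measurable_grad_legendre[OF R f[of k]] by (auto intro!: measurable_If_set)
  qed (simp add: T0)
  have Ab: "A j \<in> sets borel" for j using A by simp
  have graph_sets: "{x. (x, S x) \<in> D} \<in> sets borel" if "S \<in> borel_measurable borel" "D \<in> sets borel" for S :: "'a \<Rightarrow> 'a" and D
    using measurable_sets[OF measurable_graph[OF that(1)] that(2)] by (simp add: vimage_def)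
  define B where "B k = (\<Union>j<k. A (j mod K))" for k
  have Bb: "B k \<in> sets borel" for k unfolding B_def using Ab by blast
  have prod: "C \<times> D \<in> sets borel" if "C \<in> sets borel" "D \<in> sets borel" for C D :: "'a set"
    using that by (rule borel_Times)
  have key: "emeasure (ambient (\<pi> k)) (D \<inter> (B k \<times> UNIV)) = emeasure ?m (B k \<inter> {x. (x, T k x) \<in> D})"
    if "D \<in> sets borel" for k D
    using that
  proof (induction k arbitrary: D)
    case (Suc k)
    let ?A = "A (k mod K)"
    let ?g = "grad (legendre R (f k))"
    have gm: "?g \<in> borel_measurable borel" by (rule measurable_grad_legendre[OF R f])
    have BS: "B (Suc k) = B k \<union> ?A" by (auto simp: B_def less_Suc_eq)
    define D' where "D' = D \<inter> ((- ?A) \<times> UNIV)"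
    have nA: "- ?A \<in> sets borel" by (intro borel_open open_Compl A)
    have D': "D' \<in> sets borel" unfolding D'_def using Suc.prems prod[OF nA, of UNIV] by simp
    have E: "D \<inter> (B (Suc k) \<times> UNIV) \<in> sets borel" using Suc.prems prod[OF Bb, of UNIV] by simp
    have "emeasure (ambient (\<pi> (Suc k))) (D \<inter> (B (Suc k) \<times> UNIV)) =
      emeasure ?m (?A \<inter> {x. (x, ?g x) \<in> D \<inter> (B (Suc k) \<times> UNIV)}) +
      emeasure (ambient (\<pi> k)) (D \<inter> (B (Suc k) \<times> UNIV) \<inter> ((- ?A) \<times> UNIV))"
      by (rule step[OF E])
    also have "D \<inter> (B (Suc k) \<times> UNIV) \<inter> ((- ?A) \<times> UNIV) = D' \<inter> (B k \<times> UNIV)"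
      unfolding BS D'_def by auto
    also have "emeasure (ambient (\<pi> k)) (D' \<inter> (B k \<times> UNIV)) = emeasure ?m (B k \<inter> {x. (x, T k x) \<in> D'})"
      by (rule Suc.IH[OF D'])
    also have "?A \<inter> {x. (x, ?g x) \<in> D \<inter> (B (Suc k) \<times> UNIV)} = ?A \<inter> {x. (x, ?g x) \<in> D}"
      unfolding BS by auto
    also have "emeasure ?m (?A \<inter> {x. (x, ?g x) \<in> D}) + emeasure ?m (B k \<inter> {x. (x, T k x) \<in> D'})
       = emeasure ?m ((?A \<inter> {x. (x, ?g x) \<in> D}) \<union> (B k \<inter> {x. (x, T k x) \<in> D'}))"
    proof (rule plus_emeasure)
      show "?A \<inter> {x. (x, ?g x) \<in> D} \<in> sets ?m" using Ab graph_sets[OF gm Suc.prems] by simp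
      show "B k \<inter> {x. (x, T k x) \<in> D'} \<in> sets ?m" using Bb graph_sets[OF Tm D'] by simp
    qed (auto simp: D'_def)
    also have "(?A \<inter> {x. (x, ?g x) \<in> D}) \<union> (B k \<inter> {x. (x, T k x) \<in> D'}) = B (Suc k) \<inter> {x. (x, T (Suc k) x) \<in> D}"
      unfolding BS D'_def T_Suc by auto
    finally show ?case .
  qed (simp add: B_def)
  have XB: "X \<subseteq> B k" if "K \<le> k" for k
  proof
    fix x assume "x \<in> X"
    then obtain j where "j < K" "x \<in> A j" using cover by blast
    then show "x \<in> B k" using that unfolding B_def by (intro UN_I[of j]) auto
  qed
  have amb: "ambient (\<pi> k) = distr ?m borel (\<lambda>x. (x, T k x))" if k: "K \<le> k" for k
  proof (rule measure_eqI)
    fix D assume "D \<in> sets (ambient (\<pi> k))"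
    then have D: "D \<in> sets borel" by simp
    have on: "measure_on (X \<times> Y) (\<pi> k)" using c by (simp add: couplings_def)
    have "emeasure (ambient (\<pi> k)) D = emeasure (ambient (\<pi> k)) (D \<inter> (B k \<times> UNIV))"
    proof -
      have "D \<inter> (B k \<times> UNIV) \<inter> (X \<times> Y) = D \<inter> (X \<times> Y)" using XB[OF k] by auto
      then show ?thesis using emeasure_ambient[OF on D] emeasure_ambient[OF on, of "D \<inter> (B k \<times> UNIV)"] D prod[OF Bb, of UNIV] by simp
    qed
    also have "\<dots> = emeasure ?m (B k \<inter> {x. (x, T k x) \<in> D})" by (rule key[OF D])
    also have "\<dots> = emeasure ?m {x. (x, T k x) \<in> D}"
    proof -
      have "B k \<inter> {x. (x, T k x) \<in> D} \<inter> X = {x. (x, T k x) \<in> D} \<inter> X" using XB[OF k] by auto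
      then show ?thesis
        using emeasure_ambient[OF \<mu>(1), of "B k \<inter> {x. (x, T k x) \<in> D}"] emeasure_ambient[OF \<mu>(1) graph_sets[OF Tm D]]
          Bb graph_sets[OF Tm D] by simp
    qed
    also have "\<dots> = emeasure (distr ?m borel (\<lambda>x. (x, T k x))) D"
    proof -
      have "(\<lambda>x. (x, T k x)) \<in> measurable ?m borel"
        using measurable_graph[OF Tm] by (simp add: measurable_cong_sets[OF sets_ambient refl])
      then show ?thesis using D by (subst emeasure_distr) (auto simp: vimage_def)
    qed
    finally show "emeasure (ambient (\<pi> k)) D = emeasure (distr ?m borel (\<lambda>x. (x, T k x))) D" .
  qed simp
  have conc: "AE x in ?m. x \<in> X" by (rule AE_ambient_closed[OF \<mu>(1) _ X(1)]) simp
  have "cell_sweep R ?m K A f T"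
  proof (rule cell_sweep.intro)
    show "0 \<le> R" "finite_measure ?m" "sets ?m = sets borel" "absolutely_continuous lborel ?m" "0 < K" "T 0 = (\<lambda>_. 0)"
      by (auto simp: R K T0 \<mu>(3) intro: finite_measure_ambient[OF \<mu>(1,2)])
    show "AE x in ?m. x \<in> cball 0 R" by (rule AE_ambient_closed[OF \<mu>(1) X(2)]) simp
    show "A j \<in> sets borel" for j by (rule Ab)
    show "AE x in ?m. \<exists>j<K. x \<in> A j" using conc by eventually_elim (use cover in blast)
    show "potential R (f k)" for k by (rule f)
    show "T (Suc k) x = (if x \<in> A (k mod K) then grad (legendre R (f k)) x else T k x)" for k x by (rule T_Suc)
    fix k :: nat and D :: "'a set" assume k: "K \<le> k" and D: "D \<in> sets borel"
    let ?A = "A (k mod K)"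
    have AB: "?A \<subseteq> B k"
    proof -
      have "k mod K < k" using k K by (meson mod_less_divisor less_le_trans)
      then have "A ((k mod K) mod K) \<subseteq> B k" unfolding B_def by blast
      then show ?thesis by simp
    qed
    have "?A \<inter> T (Suc k) -` D = ?A \<inter> grad (legendre R (f k)) -` D" by (auto simp: T_Suc)
    then have "emeasure ?m (?A \<inter> T (Suc k) -` D) = emeasure (ambient (\<pi> k)) (?A \<times> D)"
      using marg[OF D] by simp
    also have "?A \<times> D = (?A \<times> D) \<inter> (B k \<times> UNIV)" using AB by auto
    also have "emeasure (ambient (\<pi> k)) \<dots> = emeasure ?m (B k \<inter> {x. (x, T k x) \<in> ?A \<times> D})"
      by (rule key[OF prod[OF Ab D]])
    also have "B k \<inter> {x. (x, T k x) \<in> ?A \<times> D} = ?A \<inter> T k -` D" using AB by auto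
    finally show "emeasure ?m (?A \<inter> T (Suc k) -` D) = emeasure ?m (?A \<inter> T k -` D)" .
  qed
  then show ?thesis using that c amb by blast
qed

section \<open>A global potential for the limit map\<close>

text \<open>
  Positivity of the density makes \<open>\<mu>\<close> and Lebesgue measure equivalent on \<open>X\<close>.
\<close>

lemma null_sets_of_positive_density:
  fixes X :: "'a::euclidean_space set"
  assumes X: "X \<in> sets borel" and \<mu>: "measure_on X \<mu>"
    and ac: "absolutely_continuous (restrict_space lborel X) \<mu>"
    and pos: "AE x in restrict_space lborel X. RN_deriv (restrict_space lborel X) \<mu> x > 0"
  shows "absolutely_continuous lborel (ambient \<mu>)"
    and "\<And>N. N \<in> sets borel \<Longrightarrow> N \<subseteq> X \<Longrightarrow> emeasure (ambient \<mu>) N = 0 \<Longrightarrow> N \<in> null_sets lborel"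
proof -
  let ?L = "restrict_space lborel X"
  have Xl: "X \<inter> space lborel \<in> sets lborel" using X by simp
  have sL: "sets \<mu> = sets ?L" using \<mu> by (simp add: measure_on_def sets_restrict_space)
  show "absolutely_continuous lborel (ambient \<mu>)"
    unfolding absolutely_continuous_def
  proof
    fix N :: "'a set" assume N: "N \<in> null_sets lborel"
    then have Nb: "N \<in> sets borel" by auto
    have "N \<inter> X \<in> null_sets lborel" using N X by (intro null_set_Int2) auto
    then have "N \<inter> X \<in> null_sets ?L" using null_sets_restrict_space[OF Xl] by auto
    then have "N \<inter> X \<in> null_sets \<mu>" using ac by (auto simp: absolutely_continuous_def)
    then show "N \<in> null_sets (ambient \<mu>)" using Nb emeasure_ambient[OF \<mu> Nb] by (auto simp: null_sets_def)
  qed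
  fix N assume N: "N \<in> sets borel" "N \<subseteq> X" "emeasure (ambient \<mu>) N = 0"
  interpret L: sigma_finite_measure ?L by (rule sigma_finite_measure_restrict_space[OF sigma_finite_lborel]) (use X in simp)
  have NL: "N \<in> sets ?L" using N(1,2) X by (auto simp: sets_restrict_space intro!: image_eqI[of _ _ N])
  have "emeasure \<mu> N = 0" using N emeasure_ambient[OF \<mu> N(1)] by (simp add: Int_absorb2)
  also have "\<mu> = density ?L (RN_deriv ?L \<mu>)" by (rule L.density_RN_deriv[OF ac sL, symmetric])
  finally have "(\<integral>\<^sup>+x. RN_deriv ?L \<mu> x * indicator N x \<partial>?L) = 0"
    using NL by (simp add: emeasure_density)
  then have "AE x in ?L. RN_deriv ?L \<mu> x * indicator N x = 0"
    using NL by (subst (asm) nn_integral_0_iff_AE) auto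
  then have "AE x in ?L. x \<notin> N"
    using pos by eventually_elim (auto split: split_indicator_asm)
  then have "N \<in> null_sets ?L" using NL by (simp add: AE_iff_null_sets)
  then show "N \<in> null_sets lborel" using null_sets_restrict_space[OF Xl] by auto
qed

lemma AE_interior:
  fixes C :: "'a::euclidean_space set"
  assumes "convex C" "absolutely_continuous lborel m" "sets m = sets borel"
  shows "AE x in m. x \<in> C \<longrightarrow> x \<in> interior C"
proof -
  have "negligible (frontier C)" by (rule negligible_convex_frontier[OF assms(1)])
  then have "frontier C \<in> null_sets lborel"
    using null_sets_completion_iff[of "frontier C" lborel] by (simp add: negligible_iff_null_sets)
  then have "AE x in lborel. x \<notin> frontier C" by (rule AE_not_in)
  then have AE: "AE x in lborel. x \<in> C \<longrightarrow> x \<in> interior C"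
    by eventually_elim (use closure_subset in \<open>auto simp: frontier_def\<close>)
  show ?thesis by (rule absolutely_continuous_AE[OF _ assms(2) AE]) (use assms(3) in simp)
qed

text \<open>
  On the overlap both gradients equal \<open>S\<close> almost everywhere with respect to \<open>m\<close>, hence with respect to
  Lebesgue measure.
\<close>

lemma overlapping_potentials:
  fixes A B X :: "'a::euclidean_space set"
  assumes R: "0 \<le> R" and m: "sets m = sets borel" "absolutely_continuous lborel m"
    and pos: "\<And>N. N \<in> sets borel \<Longrightarrow> N \<subseteq> X \<Longrightarrow> emeasure m N = 0 \<Longrightarrow> N \<in> null_sets lborel"
    and AB: "convex A" "convex B" "A \<subseteq> X" "neighbors A B"
    and g: "potential R g" "AE x in m. x \<in> A \<longrightarrow> S x = grad (legendre R g) x"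
    and h: "potential R h" "AE x in m. x \<in> B \<longrightarrow> S x = grad (legendre R h) x"
    and xy: "x \<in> A \<inter> B" "y \<in> A \<inter> B"
  shows "legendre R g x - legendre R h x = legendre R g y - legendre R h y"
proof -
  let ?U = "interior (A \<inter> B)"
  let ?G = "grad (legendre R g)" and ?H = "grad (legendre R h)"
  have U: "open ?U" "convex ?U" "?U \<noteq> {}"
    using AB by (auto simp: neighbors_def intro: convex_interior convex_Int)
  note cg = continuous_on_legendre[OF R potential_continuous[OF g(1)]]
  note ch = continuous_on_legendre[OF R potential_continuous[OF h(1)]]
  have meas: "?G \<in> borel_measurable borel" "?H \<in> borel_measurable borel"
    by (rule measurable_grad_legendre[OF R g(1)], rule measurable_grad_legendre[OF R h(1)])
  define N where "N = {x. ?G x \<noteq> ?H x} \<inter> ?U"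
  have "{x \<in> space borel. ?G x \<noteq> ?H x} \<in> sets borel" using meas by measurable
  then have Nb: "N \<in> sets borel" unfolding N_def by simp
  have "AE x in m. x \<notin> N"
    using g(2) h(2)
  proof eventually_elim
    case (elim x)
    show ?case
    proof
      assume "x \<in> N"
      then have "x \<in> A \<inter> B" "?G x \<noteq> ?H x" using interior_subset[of "A \<inter> B"] by (auto simp: N_def)
      then show False using elim by auto
    qed
  qed
  then have "N \<in> null_sets m" using Nb m(1) by (simp add: AE_iff_null_sets)
  moreover have "N \<subseteq> X" using AB(3) interior_subset[of "A \<inter> B"] by (auto simp: N_def)
  ultimately have "N \<in> null_sets lborel" using pos Nb by auto
  then have "AE x in lborel. x \<notin> N" by (rule AE_not_in)
  then have AEQ: "AE x in lborel. x \<in> ?U \<longrightarrow> subgradient (legendre R g) x (?G x) \<and> subgradient (legendre R h) x (?G x) \<and> norm (?G x) \<le> R"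
    using AE_grad_legendre[OF R potential_continuous[OF g(1)]] AE_grad_legendre[OF R potential_continuous[OF h(1)]]
  proof eventually_elim
    case (elim x)
    have "subgradient (legendre R g) x (?G x)"
      by (rule subgradient_legendre[OF R potential_continuous[OF g(1)]]) (use elim in auto)
    moreover have "subgradient (legendre R h) x (?H x)"
      by (rule subgradient_legendre[OF R potential_continuous[OF h(1)]]) (use elim in auto)
    moreover have "x \<in> ?U \<Longrightarrow> ?H x = ?G x" using elim(1) by (auto simp: N_def)
    moreover have "norm (?G x) \<le> R" using elim(2) by simp
    ultimately show ?case by metis
  qed
  obtain N' where N': "negligible N'"
    "\<And>x. x \<notin> N' \<Longrightarrow> x \<in> ?U \<longrightarrow> subgradient (legendre R g) x (?G x) \<and> subgradient (legendre R h) x (?G x) \<and> norm (?G x) \<le> R"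
    by (rule AE_lborel_negligible[OF AEQ], rule that)
  obtain u where u: "u \<in> ?U" using U(3) by blast
  let ?D = "\<lambda>x. legendre R g x - legendre R h x"
  have const: "?D z = ?D u" if "z \<in> ?U" for z
    by (rule equal_gradients_const[OF U(1,2) N'(1) _ cg ch that u, where g="?G" and R=R]) (use N'(2) in blast)
  have "?D z = ?D u" if z: "z \<in> A \<inter> B" for z
  proof (rule continuous_constant_on_closure[where S="?U" and f="?D"])
    show "continuous_on (closure ?U) ?D"
      by (intro continuous_intros continuous_on_subset[OF cg] continuous_on_subset[OF ch]) auto
    show "z \<in> closure ?U"
      using z convex_closure_interior[OF convex_Int[OF AB(1,2)] U(3)] closure_subset[of "A \<inter> B"] by auto
  qed (rule const)
  then show ?thesis using xy by metis
qed

lemma limit_map_potential: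
  fixes X :: "'a::euclidean_space set"
  assumes R: "0 \<le> R" and m: "sets m = sets borel" "absolutely_continuous lborel m" "AE x in m. x \<in> X"
    and pos: "\<And>N. N \<in> sets borel \<Longrightarrow> N \<subseteq> X \<Longrightarrow> emeasure m N = 0 \<Longrightarrow> N \<in> null_sets lborel"
    and X: "convex X" "X \<noteq> {}"
    and \<C>: "finite \<C>" "\<And>A. A \<in> \<C> \<Longrightarrow> polytope A" "\<And>A. A \<in> \<C> \<Longrightarrow> interior A \<noteq> {}" "\<Union>\<C> = X" "boundary_covering \<C>"
    and h: "\<And>A. A \<in> \<C> \<Longrightarrow> \<exists>h. potential R h \<and> (AE x in m. x \<in> A \<longrightarrow> S x = grad (legendre R h) x)"
  obtains \<Phi> where "continuous_on X \<Phi>" "AE x in m. \<forall>y\<in>X. \<Phi> x + S x \<bullet> (y - x) \<le> \<Phi> y"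
proof -
  have "\<forall>A\<in>\<C>. \<exists>h. potential R h \<and> (AE x in m. x \<in> A \<longrightarrow> S x = grad (legendre R h) x)"
    using h by (rule ballI)
  from bchoice[OF this] obtain h where
    h': "\<forall>A\<in>\<C>. potential R (h A) \<and> (AE x in m. x \<in> A \<longrightarrow> S x = grad (legendre R (h A)) x)"
    by (elim exE)
  have h: "potential R (h A)" "AE x in m. x \<in> A \<longrightarrow> S x = grad (legendre R (h A)) x" if "A \<in> \<C>" for A
    using bspec[OF h' that] by (rule conjunct1, rule conjunct2)
  interpret glued_cells X \<C> "\<lambda>A. legendre R (h A)"
  proof
    show "legendre R (h A) x - legendre R (h B) x = legendre R (h A) y - legendre R (h B) y"
      if "A \<in> \<C>" "B \<in> \<C>" "neighbors A B" "x \<in> A \<inter> B" "y \<in> A \<inter> B" for A B x y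
    proof (rule overlapping_potentials[OF R m(1,2) pos _ _ _ that(3) h(1,2)[OF that(1)] h(1,2)[OF that(2)] that(4,5)])
      show "convex A" "convex B" using \<C>(2) that polytope_imp_convex by blast+
      show "A \<subseteq> X" using \<C>(4) that(1) by blast
    qed
    show "convex_on UNIV (legendre R (h A))" "continuous_on UNIV (legendre R (h A))" if "A \<in> \<C>" for A
      by (rule convex_on_legendre[OF R potential_continuous[OF h(1)[OF that]]],
          rule continuous_on_legendre[OF R potential_continuous[OF h(1)[OF that]]])
  qed (use X \<C> in auto)
  obtain \<Phi> where \<Phi>: "\<And>A. A \<in> \<C> \<Longrightarrow> \<exists>c. \<forall>x\<in>A. \<Phi> x = legendre R (h A) x + c"
    using glue by blast
  have "AE x in m. \<forall>A\<in>\<C>. x \<in> A \<longrightarrow> (\<forall>y\<in>X. \<Phi> x + S x \<bullet> (y - x) \<le> \<Phi> y)"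
  proof (rule AE_finite_allI[OF \<C>(1)])
    fix A assume A: "A \<in> \<C>"
    show "AE x in m. x \<in> A \<longrightarrow> (\<forall>y\<in>X. \<Phi> x + S x \<bullet> (y - x) \<le> \<Phi> y)"
      using h(2)[OF A] AE_interior[OF cell_convex[OF A] m(2,1)] AE_grad_in_cball[OF R h(1)[OF A] m(2,1)]
    proof eventually_elim
      case (elim x)
      show ?case
      proof (intro impI ballI)
        fix y assume x: "x \<in> A" and y: "y \<in> X"
        have "subgradient (legendre R (h A)) x (S x)"
          by (rule subgradient_legendre[OF R potential_continuous[OF h(1)[OF A]]]) (use elim x in auto)
        then show "\<Phi> x + S x \<bullet> (y - x) \<le> \<Phi> y"
          using glue_subgradient[OF \<Phi> A _ _ y] elim x by blast
      qed
    qed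
  qed
  then have "AE x in m. \<forall>y\<in>X. \<Phi> x + S x \<bullet> (y - x) \<le> \<Phi> y"
    using m(3) by eventually_elim (use \<C>(4) in blast)
  then show ?thesis using that glue_continuous[OF \<Phi>] by blast
qed

text \<open>
  The Fenchel-Young inequality for \<open>\<Phi>\<close> and its conjugate over \<open>X\<close>, with equality along \<open>S\<close>.
\<close>

lemma global_potential_certifies:
  fixes X :: "'a::euclidean_space set" and \<gamma> :: "('a \<times> 'a) measure"
  assumes R: "0 \<le> R" and X: "compact X" "X \<noteq> {}" "X \<subseteq> cball 0 R"
    and m: "finite_measure m" "sets m = sets borel" "AE x in m. x \<in> X"
    and S: "S \<in> borel_measurable borel" "AE x in m. S x \<in> cball 0 R"
    and \<Phi>: "continuous_on X \<Phi>" "AE x in m. \<forall>y\<in>X. \<Phi> x + S x \<bullet> (y - x) \<le> \<Phi> y"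
    and \<gamma>: "finite_measure \<gamma>" "sets \<gamma> = sets borel" "distr \<gamma> borel fst = m" "distr \<gamma> borel snd = distr m borel S"
  shows "(\<integral>z. fst z \<bullet> snd z \<partial>\<gamma>) \<le> (\<integral>x. x \<bullet> S x \<partial>m)"
proof -
  define \<Psi> where "\<Psi> y = (SUP x\<in>X. x \<bullet> y - \<Phi> x)" for y
  have att: "\<exists>x\<in>X. \<Psi> y = x \<bullet> y - \<Phi> x \<and> (\<forall>z\<in>X. z \<bullet> y - \<Phi> z \<le> x \<bullet> y - \<Phi> x)" for y
  proof -
    have "continuous_on X (\<lambda>x. x \<bullet> y - \<Phi> x)" by (intro continuous_intros \<Phi>(1))
    then obtain x where x: "x \<in> X" "\<And>z. z \<in> X \<Longrightarrow> z \<bullet> y - \<Phi> z \<le> x \<bullet> y - \<Phi> x"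
      using continuous_attains_sup[OF X(1,2), of "\<lambda>x. x \<bullet> y - \<Phi> x"] by auto
    moreover have "\<Psi> y = x \<bullet> y - \<Phi> x"
      unfolding \<Psi>_def using x by (intro cSup_eq_maximum) auto
    ultimately show ?thesis by auto
  qed
  have young: "x \<bullet> y \<le> \<Phi> x + \<Psi> y" if "x \<in> X" for x y
    using att[of y] that by force
  have "R-lipschitz_on UNIV \<Psi>"
  proof (rule lipschitz_onI[OF _ R])
    have *: "\<Psi> y - \<Psi> z \<le> R * dist y z" for y z
    proof -
      obtain x where x: "x \<in> X" "\<Psi> y = x \<bullet> y - \<Phi> x" using att[of y] by blast
      then have "\<Psi> y - \<Psi> z \<le> x \<bullet> (y - z)" using young[OF x(1), of z] by (simp add: inner_diff_right)
      also have "\<dots> \<le> norm x * norm (y - z)" by (rule norm_cauchy_schwarz)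
      also have "\<dots> \<le> R * norm (y - z)" using x(1) X(3) by (intro mult_right_mono) auto
      finally show ?thesis by (simp add: dist_norm)
    qed
    show "dist (\<Psi> y) (\<Psi> z) \<le> R * dist y z" for y z
      using *[of y z] *[of z y] by (auto simp: dist_real_def dist_commute)
  qed
  then have c\<Psi>: "continuous_on UNIV \<Psi>" by (rule lipschitz_on_continuous_on)
  \<comment> \<open>outside \<open>X\<close> nothing is known about \<open>\<Phi>\<close>, not even measurability\<close>
  define \<Phi>' where "\<Phi>' x = indicator X x * \<Phi> x" for x
  have \<Phi>'m: "\<Phi>' \<in> borel_measurable borel"
    using borel_measurable_continuous_on_indicator[OF _ \<Phi>(1)] X(1) unfolding \<Phi>'_def[abs_def] by (simp add: borel_compact)
  obtain B where B: "\<And>x. x \<in> X \<Longrightarrow> \<bar>\<Phi> x\<bar> \<le> B"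
    using compact_imp_bounded[OF compact_continuous_image[OF \<Phi>(1) X(1)]] unfolding bounded_iff by auto
  have B': "\<bar>\<Phi>' x\<bar> \<le> \<bar>B\<bar>" for x unfolding \<Phi>'_def using B[of x] by (cases "x \<in> X") auto
  have mm: "g \<in> measurable m N" if "g \<in> measurable borel N" for g :: "'a \<Rightarrow> 'b" and N
    using that by (simp add: measurable_cong_sets[OF m(2) refl])
  have fs: "fst \<in> measurable \<gamma> borel" "snd \<in> measurable \<gamma> borel"
    using measurable_fst_snd_borel by (simp_all add: measurable_cong_sets[OF \<gamma>(2) refl])
  have i\<Phi>: "integrable m \<Phi>'"
    by (rule finite_measure.integrable_const_bound[OF m(1), of _ "\<bar>B\<bar>"]) (use B' mm[OF \<Phi>'m] in auto)
  have i\<Phi>\<gamma>: "integrable \<gamma> (\<lambda>z. \<Phi>' (fst z))"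
    by (rule finite_measure.integrable_const_bound[OF \<gamma>(1), of _ "\<bar>B\<bar>"]) (use B' measurable_compose[OF fs(1) \<Phi>'m] in auto)
  have AE1: "AE z in \<gamma>. fst z \<in> X" by (rule AE_distrD[OF fs(1)]) (unfold \<gamma>(3), rule m(3))
  have AE2: "AE z in \<gamma>. snd z \<in> cball 0 R"
  proof (rule AE_distrD[OF fs(2)])
    show "AE y in distr \<gamma> borel snd. y \<in> cball 0 R"
      unfolding \<gamma>(4) using S(2) by (subst AE_distr_iff[OF mm[OF S(1)]]) auto
  qed
  have AEc: "AE z in \<gamma>. fst z \<in> cball 0 R \<and> snd z \<in> cball 0 R" using AE1 AE2 by eventually_elim (use X(3) in blast)
  note ip = integrable_concentrated_pair[OF \<gamma>(1,2) AEc]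
  have i\<Psi>: "integrable \<gamma> (\<lambda>z. \<Psi> (snd z))" by (intro ip continuous_on_compose2[OF c\<Psi>] continuous_intros) auto
  have ixy: "integrable \<gamma> (\<lambda>z. fst z \<bullet> snd z)" by (intro ip continuous_intros)
  have m\<Psi>: "\<Psi> \<in> borel_measurable borel" by (rule borel_measurable_continuous_onI[OF c\<Psi>])
  have i\<Psi>S: "integrable m (\<lambda>x. \<Psi> (S x))"
  proof -
    have "integrable (distr \<gamma> borel snd) \<Psi>" using i\<Psi> by (subst integrable_distr_eq[OF fs(2) m\<Psi>])
    then show ?thesis unfolding \<gamma>(4) by (subst (asm) integrable_distr_eq[OF mm[OF S(1)] m\<Psi>])
  qed
  have "(\<integral>z. fst z \<bullet> snd z \<partial>\<gamma>) \<le> (\<integral>z. \<Phi>' (fst z) + \<Psi> (snd z) \<partial>\<gamma>)"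
  proof (rule integral_mono_AE[OF ixy])
    show "AE z in \<gamma>. fst z \<bullet> snd z \<le> \<Phi>' (fst z) + \<Psi> (snd z)"
      using AE1 by eventually_elim (use young in \<open>auto simp: \<Phi>'_def\<close>)
  qed (use i\<Phi>\<gamma> i\<Psi> in simp)
  also have "\<dots> = (\<integral>z. \<Phi>' (fst z) \<partial>\<gamma>) + (\<integral>z. \<Psi> (snd z) \<partial>\<gamma>)" using i\<Phi>\<gamma> i\<Psi> by simp
  also have "(\<integral>z. \<Phi>' (fst z) \<partial>\<gamma>) = (\<integral>x. \<Phi>' x \<partial>m)"
    unfolding \<gamma>(3)[symmetric] by (rule integral_distr[OF fs(1) \<Phi>'m, symmetric])
  also have "(\<integral>z. \<Psi> (snd z) \<partial>\<gamma>) = (\<integral>x. \<Psi> (S x) \<partial>m)"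
    using integral_distr[OF fs(2) m\<Psi>] integral_distr[OF mm[OF S(1)] m\<Psi>] \<gamma>(4) by simp
  also have "(\<integral>x. \<Phi>' x \<partial>m) + (\<integral>x. \<Psi> (S x) \<partial>m) = (\<integral>x. \<Phi>' x + \<Psi> (S x) \<partial>m)"
    using i\<Phi> i\<Psi>S by simp
  also have "\<dots> = (\<integral>x. x \<bullet> S x \<partial>m)"
  proof (rule integral_cong_AE)
    show "AE x in m. \<Phi>' x + \<Psi> (S x) = x \<bullet> S x"
      using m(3) \<Phi>(2)
    proof eventually_elim
      case (elim x)
      obtain y where y: "y \<in> X" "\<Psi> (S x) = y \<bullet> S x - \<Phi> y" using att[of "S x"] by blast
      have "\<Phi> x + S x \<bullet> (y - x) \<le> \<Phi> y" using elim(2) y(1) by blast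
      then have "\<Phi> x + \<Psi> (S x) \<le> x \<bullet> S x" using y(2) by (simp add: inner_diff_right inner_commute)
      then show ?case using young[OF elim(1), of "S x"] elim(1) by (simp add: \<Phi>'_def)
    qed
    show "(\<lambda>x. x \<bullet> S x) \<in> borel_measurable m" by (rule mm) (use S(1) in measurable)
  qed (use i\<Phi> i\<Psi>S in auto)
  finally show ?thesis .
qed

section \<open>Convergence of the iterates in the ambient space\<close>

lemma graph_integral_tendsto:
  fixes T :: "nat \<Rightarrow> 'a::euclidean_space \<Rightarrow> 'a" and h :: "'a \<times> 'a \<Rightarrow> real"
  assumes m: "finite_measure m" "sets m = sets borel"
    and T: "\<And>n. T n \<in> borel_measurable borel" "S \<in> borel_measurable borel" "AE x in m. (\<lambda>n. T n x) \<longlonglongrightarrow> S x"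
    and h: "continuous_on UNIV h" "\<And>z. \<bar>h z\<bar> \<le> B"
  shows "(\<lambda>n. \<integral>z. h z \<partial>distr m borel (\<lambda>x. (x, T n x))) \<longlonglongrightarrow> (\<integral>z. h z \<partial>distr m borel (\<lambda>x. (x, S x)))"
proof -
  have mm: "g \<in> measurable m N" if "g \<in> measurable borel N" for g :: "'a \<Rightarrow> 'b" and N
    using that by (simp add: measurable_cong_sets[OF m(2) refl])
  have hm: "h \<in> borel_measurable borel" by (rule borel_measurable_continuous_onI[OF h(1)])
  have eq: "(\<integral>z. h z \<partial>distr m borel (\<lambda>x. (x, G x))) = (\<integral>x. h (x, G x) \<partial>m)" if "G \<in> borel_measurable borel" for G
    by (rule integral_distr[OF mm[OF measurable_graph[OF that]] hm])
  show ?thesis unfolding eq[OF T(1)] eq[OF T(2)]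
  proof (rule integral_dominated_convergence[where w="\<lambda>_. B"])
    show "AE x in m. (\<lambda>n. h (x, T n x)) \<longlonglongrightarrow> h (x, S x)"
      using T(3) by eventually_elim (auto intro!: continuous_on_tendsto_compose[OF h(1)] tendsto_Pair)
    show "(\<lambda>x. h (x, S x)) \<in> borel_measurable m" "(\<lambda>x. h (x, T n x)) \<in> borel_measurable m" for n
      by (rule mm, rule measurable_compose[OF measurable_graph[OF T(2)] hm],
          rule mm, rule measurable_compose[OF measurable_graph[OF T(1)] hm])
  qed (use m(1) h(2) in \<open>auto simp: finite_measure.integrable_const\<close>)
qed

text \<open>
  A subsequence principle that treats the \<open>K\<close> residue classes of the index simultaneously.
\<close>

lemma residue_subsequences_tendsto:
  fixes a :: "nat \<Rightarrow> real"
  assumes K: "0 < K"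
    and sub: "\<And>s :: nat \<Rightarrow> nat. strict_mono s \<Longrightarrow> \<exists>r. strict_mono r \<and> (\<forall>i<K. (\<lambda>n. a (K * s (r n) + K + i)) \<longlonglongrightarrow> l)"
  shows "a \<longlonglongrightarrow> l"
proof -
  have res: "(\<lambda>n. a (K * n + K + i)) \<longlonglongrightarrow> l" if i: "i < K" for i
  proof (rule ccontr)
    assume "\<not> ?thesis"
    then obtain e where e: "e > 0" "\<And>N. \<exists>n\<ge>N. e \<le> dist (a (K * n + K + i)) l"
      unfolding lim_sequentially by (metis not_less)
    define D where "D = {n. e \<le> dist (a (K * n + K + i)) l}"
    have D: "infinite D" using e(2) unfolding D_def infinite_nat_iff_unbounded_le by blast
    define s where "s = enumerate D"
    have s: "strict_mono s" "\<And>n. e \<le> dist (a (K * s n + K + i)) l"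
      using D enumerate_in_set[OF D] by (auto simp: s_def strict_mono_enumerate D_def)
    obtain r where lim: "(\<lambda>n. a (K * s (r n) + K + i)) \<longlonglongrightarrow> l" using sub[OF s(1)] i by blast
    have "(\<lambda>n. dist (a (K * s (r n) + K + i)) l) \<longlonglongrightarrow> 0" using tendsto_dist[OF lim tendsto_const[of l]] by simp
    then have "e \<le> 0" by (rule LIMSEQ_le_const) (use s in auto)
    then show False using e(1) by simp
  qed
  show ?thesis
  proof (rule LIMSEQ_I)
    fix e :: real assume e: "0 < e"
    have "\<exists>N. \<forall>n\<ge>N. norm (a (K * n + K + i) - l) < e" if "i < K" for i
      using LIMSEQ_D[OF res[OF that] e] .
    then obtain N where N: "\<And>i n. i < K \<Longrightarrow> N i \<le> n \<Longrightarrow> norm (a (K * n + K + i) - l) < e" by metis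
    define M where "M = Max (N ` {..<K})"
    have M: "N i \<le> M" if "i < K" for i unfolding M_def using that by (intro Max_ge) auto
    have "norm (a k - l) < e" if k: "K * M + K \<le> k" for k
    proof -
      define n where "n = (k - K) div K"
      have "K * n + K + k mod K = k"
      proof -
        have "(k - K) mod K = k mod K" using k by (simp add: le_mod_geq)
        then show ?thesis using k mult_div_mod_eq[of K "k - K"] unfolding n_def by simp
      qed
      moreover have "M \<le> n" unfolding n_def using k K by (simp add: less_eq_div_iff_mult_less_eq mult.commute)
      moreover have "k mod K < K" using K by simp
      ultimately show ?thesis using N[of "k mod K" n] M[of "k mod K"] by fastforce
    qed
    then show "\<exists>no. \<forall>n\<ge>no. norm (a n - l) < e" by blast
  qed
qed

section \<open>Weak convergence on a subset\<close>

text \<open>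
  The Lipschitz functions \<open>inf w. f w + j * dist z w\<close> are defined on the whole space, lie below \<open>f\<close> on \<open>S\<close>,
  and increase to \<open>f\<close> there; truncation from above keeps them bounded.
\<close>

lemma weak_limit_trace_lower:
  fixes f :: "'b::euclidean_space \<Rightarrow> real"
  assumes S: "S \<noteq> {}"
    and on: "\<And>n. measure_on S (\<pi>s n)" "measure_on S \<pi>"
    and fin: "\<And>n. finite_measure (\<pi>s n)" "finite_measure \<pi>"
    and lim: "\<And>h :: 'b \<Rightarrow> real. continuous_on UNIV h \<Longrightarrow> bounded (range h) \<Longrightarrow>
      (\<lambda>n. \<integral>z. h z \<partial>ambient (\<pi>s n)) \<longlonglongrightarrow> (\<integral>z. h z \<partial>ambient \<pi>)"
    and f: "continuous_on S f" "\<And>z. z \<in> S \<Longrightarrow> \<bar>f z\<bar> \<le> B"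
    and e: "0 < e"
  shows "\<forall>\<^sub>F n in sequentially. (\<integral>z. f z \<partial>\<pi>) - e < (\<integral>z. f z \<partial>\<pi>s n)"
proof -
  define g where "g j z = (INF w\<in>S. f w + real j * dist z w)" for j z
  have B0: "0 \<le> B" using S f(2) by fastforce
  have lb: "- B \<le> f w + real j * dist z w" if "w \<in> S" for w z j
  proof -
    have "0 \<le> real j * dist z w" by simp
    then show ?thesis using f(2)[OF that] by linarith
  qed
  have bdd: "bdd_below ((\<lambda>w. f w + real j * dist z w) ` S)" for j z using lb by (intro bdd_belowI2)
  have g_le: "g j z \<le> f w + real j * dist z w" if "w \<in> S" for j z w
    unfolding g_def by (rule cINF_lower[OF bdd that])
  have g_ge: "- B \<le> g j z" for j z unfolding g_def by (rule cINF_greatest[OF S]) (rule lb)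
  have g_lip: "g j z \<le> g j y + real j * dist z y" for j z y
  proof -
    have "g j z - real j * dist z y \<le> g j y"
      unfolding g_def[of j y]
    proof (rule cINF_greatest[OF S])
      fix w assume w: "w \<in> S"
      have "real j * dist z w \<le> real j * (dist z y + dist y w)" by (intro mult_left_mono dist_triangle) auto
      then show "g j z - real j * dist z y \<le> f w + real j * dist y w"
        using g_le[OF w, of j z] by (simp add: distrib_left)
    qed
    then show ?thesis by simp
  qed
  have cg: "continuous_on UNIV (g j)" for j
  proof -
    have "(real j)-lipschitz_on UNIV (g j)"
    proof (rule lipschitz_onI)
      show "dist (g j z) (g j y) \<le> real j * dist z y" for z y
        using g_lip[of j z y] g_lip[of j y z] by (auto simp: dist_real_def dist_commute)
    qed simp
    then show ?thesis by (rule lipschitz_on_continuous_on)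
  qed
  define h where "h j z = min B (g j z)" for j z
  have ch: "continuous_on UNIV (h j)" for j unfolding h_def by (intro continuous_intros cg)
  have hb: "\<bar>h j z\<bar> \<le> B" for j z using g_ge[of j z] B0 by (auto simp: h_def min_def)
  have h_le: "h j z \<le> f z" if "z \<in> S" for j z using g_le[OF that, of j z] by (simp add: h_def)
  have h_lim: "(\<lambda>j. h j z) \<longlonglongrightarrow> f z" if z: "z \<in> S" for z
  proof (rule LIMSEQ_I)
    fix r :: real assume r: "0 < r"
    then obtain d where d: "d > 0" "\<And>w. w \<in> S \<Longrightarrow> dist w z < d \<Longrightarrow> dist (f w) (f z) < r / 2"
      using f(1) z unfolding continuous_on_iff by (metis half_gt_zero)
    obtain j0 :: nat where j0: "2 * B < real j0 * d" using reals_Archimedean3[OF d(1)] by blast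
    have "norm (h j z - f z) < r" if j: "j0 \<le> j" for j
    proof -
      have "f z - r / 2 \<le> g j z" unfolding g_def
      proof (rule cINF_greatest[OF S])
        fix w assume w: "w \<in> S"
        show "f z - r / 2 \<le> f w + real j * dist z w"
        proof (cases "dist w z < d")
          case True
          have "0 \<le> real j * dist z w" by simp
          then show ?thesis using d(2)[OF w True] unfolding dist_real_def by linarith
        next
          case False
          have "real j0 * d \<le> real j * dist z w"
            using False j d(1) by (intro mult_mono) (auto simp: dist_commute)
          then show ?thesis using j0 f(2)[OF w] f(2)[OF z] r by linarith
        qed
      qed
      moreover have "f z \<le> B" using f(2)[OF z] by linarith
      ultimately have "f z - r / 2 \<le> h j z" using r by (simp add: h_def)
      then show ?thesis using h_le[OF z, of j] r by simp
    qed
    then show "\<exists>no. \<forall>j\<ge>no. norm (h j z - f z) < r" by blast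
  qed
  have sp: "space \<pi> = S" "space (\<pi>s n) = S" for n using on space_measure_on by blast+
  have fm: "f \<in> borel_measurable M" if "measure_on S M" for M
    using borel_measurable_continuous_on_restrict[OF f(1)] that measurable_cong_sets[of M "restrict_space borel S" borel borel]
    by (auto simp: measure_on_def)
  have hm: "h j \<in> borel_measurable M" if "measure_on S M" for M j
    by (rule measurable_measure_on[OF that borel_measurable_continuous_onI[OF ch]])
  have "(\<lambda>j. \<integral>z. h j z \<partial>\<pi>) \<longlonglongrightarrow> (\<integral>z. f z \<partial>\<pi>)"
    by (rule integral_dominated_convergence[where w="\<lambda>_. B"])
       (use fm[OF on(2)] hm[OF on(2)] fin(2) h_lim hb in \<open>auto simp: sp finite_measure.integrable_const\<close>)
  from LIMSEQ_D[OF this, of "e / 2"] e obtain j where "norm ((\<integral>z. h j z \<partial>\<pi>) - (\<integral>z. f z \<partial>\<pi>)) < e / 2" by auto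
  then have j: "(\<integral>z. f z \<partial>\<pi>) - e / 2 < (\<integral>z. h j z \<partial>\<pi>)" unfolding real_norm_def by linarith
  have "bounded (range (h j))" using hb[of j] by (auto simp: bounded_iff)
  from lim[OF ch this] have "(\<lambda>n. \<integral>z. h j z \<partial>\<pi>s n) \<longlonglongrightarrow> (\<integral>z. h j z \<partial>\<pi>)"
    using integral_ambient[OF on(1) borel_measurable_continuous_onI[OF ch]]
      integral_ambient[OF on(2) borel_measurable_continuous_onI[OF ch]] by simp
  then have "\<forall>\<^sub>F n in sequentially. (\<integral>z. f z \<partial>\<pi>) - e / 2 < (\<integral>z. h j z \<partial>\<pi>s n)"
    using j by (rule order_tendstoD(1))
  then show ?thesis
  proof eventually_elim
    case (elim n)
    have "(\<integral>z. h j z \<partial>\<pi>s n) \<le> (\<integral>z. f z \<partial>\<pi>s n)"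
    proof (rule integral_mono_AE)
      show "integrable (\<pi>s n) (h j)"
        by (rule finite_measure.integrable_const_bound[OF fin(1), of _ B]) (use hb hm[OF on(1)] in auto)
      show "integrable (\<pi>s n) f"
        by (rule finite_measure.integrable_const_bound[OF fin(1), of _ B])
           (use f(2) fm[OF on(1)] in \<open>auto simp: sp intro!: AE_I2\<close>)
      show "AE z in \<pi>s n. h j z \<le> f z" by (rule AE_I2) (use h_le sp in auto)
    qed
    then show ?case using elim e by linarith
  qed
qed

lemma weak_star_trace:
  fixes \<pi> :: "'b::euclidean_space measure"
  assumes S: "S \<noteq> {}"
    and on: "\<And>n. measure_on S (\<pi>s n)" "measure_on S \<pi>"
    and fin: "\<And>n. finite_measure (\<pi>s n)" "finite_measure \<pi>"
    and lim: "\<And>h :: 'b \<Rightarrow> real. continuous_on UNIV h \<Longrightarrow> bounded (range h) \<Longrightarrow>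
      (\<lambda>n. \<integral>z. h z \<partial>ambient (\<pi>s n)) \<longlonglongrightarrow> (\<integral>z. h z \<partial>ambient \<pi>)"
  shows "weak_star_tendsto S \<pi>s \<pi>"
  unfolding weak_star_tendsto_def
proof (intro allI impI)
  fix f :: "'b \<Rightarrow> real" assume f: "continuous_on S f \<and> bounded (f ` S)"
  then obtain B where B: "\<And>z. z \<in> S \<Longrightarrow> \<bar>f z\<bar> \<le> B" unfolding bounded_iff by auto
  note lower = weak_limit_trace_lower[OF S on fin lim]
  have c: "continuous_on S f" "continuous_on S (\<lambda>z. - f z)" using f by (auto intro: continuous_intros)
  show "(\<lambda>n. \<integral>z. f z \<partial>\<pi>s n) \<longlonglongrightarrow> (\<integral>z. f z \<partial>\<pi>)"
  proof (rule tendstoI)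
    fix e :: real assume e: "0 < e"
    have "\<forall>\<^sub>F n in sequentially. (\<integral>z. f z \<partial>\<pi>) - e < (\<integral>z. f z \<partial>\<pi>s n)"
      by (rule lower[of f B]) (use c B e in auto)
    moreover have "\<forall>\<^sub>F n in sequentially. (\<integral>z. - f z \<partial>\<pi>) - e < (\<integral>z. - f z \<partial>\<pi>s n)"
      by (rule lower[of "\<lambda>z. - f z" B]) (use c B e in auto)
    ultimately show "\<forall>\<^sub>F n in sequentially. dist (\<integral>z. f z \<partial>\<pi>s n) (\<integral>z. f z \<partial>\<pi>) < e"
      by eventually_elim (auto simp: dist_real_def abs_less_iff)
  qed
qed

section \<open>Convergence of the domain decomposition algorithm\<close>

theorem theoremA2:
  fixes X Y :: "'a::euclidean_space set"
    and \<mu> \<nu> :: "'a measure"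
    and I :: "'i set" and Xc :: "'i \<Rightarrow> 'a set"
    and K :: nat and J :: "nat \<Rightarrow> 'i set"
    and \<pi>0 :: "('a \<times> 'a) measure"
  assumes X: "polytope X" and Y: "bounded Y"
    and mu: "prob_space \<mu>" "measure_on X \<mu>"
    and mu_ac: "absolutely_continuous (restrict_space lborel X) \<mu>"
    and mu_pos: "AE x in restrict_space lborel X. RN_deriv (restrict_space lborel X) \<mu> x > 0"
    and nu: "prob_space \<nu>" "measure_on Y \<nu>"
    and basic_finite: "finite I"
    and basic_polytope: "\<And>i. i \<in> I \<Longrightarrow> polytope (Xc i) \<and> Xc i \<subseteq> X \<and> interior (Xc i) \<noteq> {}"
    and basic_cover: "X \<subseteq> (\<Union>i\<in>I. Xc i)"
    and basic_disjoint: "disjoint_family_on (\<lambda>i. interior (Xc i)) I"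
    and comp_subset: "\<And>k. k \<in> {1..K} \<Longrightarrow> J k \<subseteq> I"
    and comp_polytope: "\<And>k. k \<in> {1..K} \<Longrightarrow> polytope (composite_cell Xc (J k))"
    and comp_cover: "X \<subseteq> (\<Union>k\<in>{1..K}. composite_cell Xc (J k))"
    and boundary: "boundary_covering ((\<lambda>k. composite_cell Xc (J k)) ` {1..K})"
    and init: "\<pi>0 \<in> couplings X Y \<mu> \<nu>"
  shows "\<exists>\<pi>opt. optimal_plan X Y \<mu> \<nu> \<pi>opt \<and>
      (\<forall>\<pi>. optimal_plan X Y \<mu> \<nu> \<pi> \<longrightarrow> \<pi> = \<pi>opt) \<and>
      weak_star_tendsto (X \<times> Y)
        (domdec_iterate X Y \<mu> K (\<lambda>k. composite_cell Xc (J k)) \<pi>0) \<pi>opt"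
proof -
  interpret \<mu>: prob_space \<mu> by (rule mu(1))
  interpret \<nu>: prob_space \<nu> by (rule nu(1))
  let ?m = "ambient \<mu>"
  have cX: "compact X" "closed X" "convex X"
    using X polytope_imp_compact polytope_imp_closed polytope_imp_convex by auto
  have ne: "X \<noteq> {}" "Y \<noteq> {}"
    using \<mu>.not_empty \<nu>.not_empty space_measure_on[OF mu(2)] space_measure_on[OF nu(2)] by auto
  obtain R where R: "0 \<le> R" "X \<subseteq> cball 0 R" "Y \<subseteq> cball 0 R"
  proof -
    have "bounded (X \<union> Y)" using cX(1) Y compact_imp_bounded by auto
    then obtain b where "0 < b" "\<forall>x\<in>X \<union> Y. norm x \<le> b" unfolding bounded_pos by blast
    then show ?thesis using that[of b] by (auto simp: subset_iff)
  qed
  have Xb: "X \<in> sets borel" using cX(2) by simp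
  note ac = null_sets_of_positive_density(1)[OF Xb mu(2) mu_ac mu_pos]
  note pos = null_sets_of_positive_density(2)[OF Xb mu(2) mu_ac mu_pos]
  have fm: "finite_measure \<mu>" by (rule \<mu>.finite_measure_axioms)
  have fin_m: "finite_measure ?m" by (rule finite_measure_ambient[OF mu(2) fm])
  obtain f0 \<pi>opt where f0: "potential R f0" and \<pi>opt: "\<pi>opt \<in> couplings X Y \<mu> \<nu>"
    "ambient \<pi>opt = distr ?m borel (\<lambda>x. (x, grad (legendre R f0) x))"
    "distr ?m borel (grad (legendre R f0)) = ambient \<nu>"
    and opt: "\<And>\<rho>. optimal_plan X Y \<mu> \<nu> \<rho> \<longleftrightarrow> \<rho> = \<pi>opt"
    by (rule optimal_plan_ex1[OF R(1) cX(2) R(2,3) mu(2) fm ac init], rule that)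
  define C where "C k = composite_cell Xc (J k)" for k
  define A where "A j = (if j < K then C (j + 1) else {})" for j
  have K: "0 < K" using comp_cover ne(1) by (cases K) auto
  have Cpoly: "polytope (C k)" if "k \<in> {1..K}" for k using comp_polytope[OF that] by (simp add: C_def)
  have CX: "C k \<subseteq> X" if "k \<in> {1..K}" for k
    using comp_subset[OF that] basic_polytope by (fastforce simp: C_def composite_cell_def)
  have Cint: "interior (C k) \<noteq> {}" if k: "k \<in> {1..K}" "C k \<noteq> {}" for k
  proof -
    obtain i where i: "i \<in> J k" using k(2) by (auto simp: C_def composite_cell_def)
    then have "interior (Xc i) \<noteq> {}" using basic_polytope comp_subset[OF k(1)] by blast
    moreover have "Xc i \<subseteq> C k" using i by (auto simp: C_def composite_cell_def)
    ultimately show ?thesis using interior_mono by blast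
  qed
  have Aclosed: "closed (A j)" for j
    using Cpoly[of "j + 1"] polytope_imp_closed by (auto simp: A_def)
  have Acover: "X \<subseteq> (\<Union>j<K. A j)"
  proof
    fix x assume "x \<in> X"
    then obtain k where "k \<in> {1..K}" "x \<in> C k" using comp_cover by (auto simp: C_def)
    then show "x \<in> (\<Union>j<K. A j)" by (intro UN_I[of "k - 1"]) (auto simp: A_def)
  qed
  define \<pi> where "\<pi> = domdec_iterate X Y \<mu> K C \<pi>0"
  have \<pi>0: "\<pi> 0 \<in> couplings X Y \<mu> \<nu>" using init by (simp add: \<pi>_def)
  have \<pi>_Suc: "\<pi> (Suc k) = domdec_step X Y \<mu> (A (k mod K)) (\<pi> k)" for k
    using K by (simp add: \<pi>_def A_def)
  obtain f T where sweep: "cell_sweep R ?m K A f T" and \<pi>c: "\<And>k. \<pi> k \<in> couplings X Y \<mu> \<nu>"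
    and \<pi>T: "\<And>k. K \<le> k \<Longrightarrow> ambient (\<pi> k) = distr ?m borel (\<lambda>x. (x, T k x))"
    by (rule iterates_are_maps[OF R(1) cX(2) R(2,3) mu(2) fm ac nu(2) K Aclosed Acover \<pi>0 \<pi>_Suc], rule that)
  interpret sw: cell_sweep R ?m K A f T by (rule sweep)
  have concX: "AE x in ?m. x \<in> X" by (rule AE_ambient_closed[OF mu(2) _ cX(2)]) simp
  have snd_marginal_iterate: "distr (ambient (\<pi> k)) borel snd = ambient \<nu>" for k
    using \<pi>c[of k] couplings_iff[OF mu(2) nu(2)] by blast
  have weak: "(\<lambda>k. \<integral>z. h z \<partial>ambient (\<pi> k)) \<longlonglongrightarrow> (\<integral>z. h z \<partial>ambient \<pi>opt)"
    if h: "continuous_on UNIV h" "bounded (range h)" for h :: "'a \<times> 'a \<Rightarrow> real"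
  proof (rule residue_subsequences_tendsto[OF K])
    fix s :: "nat \<Rightarrow> nat" assume s: "strict_mono s"
    obtain r S where r: "strict_mono r" and S: "S \<in> borel_measurable borel"
      and lim: "\<And>i. i < K \<Longrightarrow> AE x in ?m. (\<lambda>n. T (K * s (r n) + K + i) x) \<longlonglongrightarrow> S x"
      and S_grad: "\<And>j. j < K \<Longrightarrow> \<exists>h. potential R h \<and> (AE x in ?m. x \<in> A j \<longrightarrow> S x = grad (legendre R h) x)"
      by (rule sw.sweep_limit[OF s], rule that)
    have Sm: "S \<in> measurable ?m borel" by (rule sw.measurable_m[OF S])
    have S_in: "AE x in ?m. S x \<in> cball 0 R"
      using lim[OF K] sw.AE_maps
    proof eventually_elim
      case (elim x)
      show ?case by (rule closed_sequentially[OF closed_cball _ elim(1)]) (use elim(2) in blast)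
    qed
    have graph_m: "(\<lambda>x. (x, G x)) \<in> measurable ?m borel" if "G \<in> borel_measurable borel" for G :: "'a \<Rightarrow> 'a"
      by (rule sw.measurable_m[OF measurable_graph[OF that]])
    have marg2: "distr (distr ?m borel (\<lambda>x. (x, G x))) borel snd = distr ?m borel G"
      if "G \<in> borel_measurable borel" for G :: "'a \<Rightarrow> 'a"
      by (subst distr_distr[OF measurable_fst_snd_borel(2) graph_m[OF that]]) (simp add: o_def)
    have marg1: "distr (distr ?m borel (\<lambda>x. (x, G x))) borel fst = ?m"
      if "G \<in> borel_measurable borel" for G :: "'a \<Rightarrow> 'a"
      by (subst distr_distr[OF measurable_fst_snd_borel(1) graph_m[OF that]]) (simp add: o_def distr_id2)
    \<comment> \<open>the limit plan along the subsequence, to be identified with \<open>\<pi>opt\<close>\<close>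
    define \<gamma> where "\<gamma> = distr ?m borel (\<lambda>x. (x, S x))"
    have tend: "(\<lambda>n. \<integral>z. g z \<partial>ambient (\<pi> (K * s (r n) + K + i))) \<longlonglongrightarrow> (\<integral>z. g z \<partial>\<gamma>)"
      if g: "continuous_on UNIV g" "\<And>z. \<bar>g z\<bar> \<le> B" and i: "i < K" for g :: "'a \<times> 'a \<Rightarrow> real" and B i
    proof -
      have "ambient (\<pi> (K * s (r n) + K + i)) = distr ?m borel (\<lambda>x. (x, T (K * s (r n) + K + i) x))" for n
        by (rule \<pi>T) simp
      then show ?thesis unfolding \<gamma>_def
        using graph_integral_tendsto[OF fin_m sets_ambient sw.T_measurable S lim[OF i] g] by simp
    qed
    have S_\<nu>: "distr ?m borel S = ambient \<nu>"
    proof (rule finite_borel_measure_eqI)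
      show "finite_measure (distr ?m borel S)" by (rule finite_measure.finite_measure_distr[OF fin_m Sm])
      show "finite_measure (ambient \<nu>)" by (rule finite_measure_ambient[OF nu(2) \<nu>.finite_measure_axioms])
      fix g :: "'a \<Rightarrow> real" assume g: "continuous_on UNIV g" "\<And>x. \<bar>g x\<bar> \<le> 1"
      have gm: "g \<in> borel_measurable borel" by (rule borel_measurable_continuous_onI[OF g(1)])
      have c: "continuous_on UNIV (\<lambda>z::'a \<times> 'a. g (snd z))"
        by (intro continuous_on_compose2[OF g(1)] continuous_intros) auto
      have "(\<integral>z. g (snd z) \<partial>ambient (\<pi> k)) = (\<integral>y. g y \<partial>ambient \<nu>)" for k
        unfolding snd_marginal_iterate[of k, symmetric]
        by (rule integral_distr[symmetric]) (use measurable_fst_snd_borel gm in \<open>auto simp: measurable_cong_sets[OF sets_ambient refl]\<close>)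
      then have "(\<integral>z. g (snd z) \<partial>\<gamma>) = (\<integral>y. g y \<partial>ambient \<nu>)"
        using tend[OF c _ K, of 1] g(2) LIMSEQ_unique[OF _ tendsto_const] by simp
      moreover have "(\<integral>z. g (snd z) \<partial>\<gamma>) = (\<integral>y. g y \<partial>distr ?m borel S)"
        unfolding marg2[OF S, symmetric] \<gamma>_def
        by (rule integral_distr[symmetric]) (use measurable_fst_snd_borel gm in auto)
      ultimately show "(\<integral>x. g x \<partial>distr ?m borel S) = (\<integral>x. g x \<partial>ambient \<nu>)" by simp
    qed simp_all
    \<comment> \<open>empty composite cells have empty interior and are dropped\<close>
    define \<C> where "\<C> = C ` {1..K} - {{}}"
    obtain \<Phi> where \<Phi>: "continuous_on X \<Phi>" "AE x in ?m. \<forall>y\<in>X. \<Phi> x + S x \<bullet> (y - x) \<le> \<Phi> y"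
    proof (rule limit_map_potential[OF R(1) sets_ambient ac concX pos cX(3) ne(1), of \<C> S])
      show "finite \<C>" by (simp add: \<C>_def)
      show "polytope B" "interior B \<noteq> {}" if B: "B \<in> \<C>" for B
      proof -
        obtain k where "k \<in> {1..K}" "B = C k" "C k \<noteq> {}" using B unfolding \<C>_def by blast
        then show "polytope B" "interior B \<noteq> {}" using Cpoly Cint by simp_all
      qed
      show "\<Union>\<C> = X" using CX comp_cover unfolding \<C>_def C_def by blast
      show "boundary_covering \<C>"
        unfolding boundary_covering_def
      proof (intro ballI impI)
        fix A B x assume AB: "A \<in> \<C>" "B \<in> \<C>" "adjacent A B" and x: "x \<in> A \<inter> B"
        then obtain D where "D \<in> C ` {1..K}" "neighbors D A" "neighbors D B" "x \<in> D"
          using boundary unfolding boundary_covering_def \<C>_def C_def by blast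
        then show "\<exists>C\<in>\<C>. neighbors C A \<and> neighbors C B \<and> x \<in> C" unfolding \<C>_def by blast
      qed
      fix B assume "B \<in> \<C>"
      then obtain k where k: "k \<in> {1..K}" "B = C k" unfolding \<C>_def by blast
      then have "k - 1 < K" "B = A (k - 1)" by (auto simp: A_def)
      then show "\<exists>h. potential R h \<and> (AE x in ?m. x \<in> B \<longrightarrow> S x = grad (legendre R h) x)"
        using S_grad[of "k - 1"] by simp
    qed
    have opt_marg: "distr (ambient \<pi>opt) borel fst = ?m" "distr (ambient \<pi>opt) borel snd = ambient \<nu>"
      using \<pi>opt(1) couplings_iff[OF mu(2) nu(2)] by auto
    have on_opt: "measure_on (X \<times> Y) \<pi>opt" using \<pi>opt(1) by (simp add: couplings_def)
    have le: "(\<integral>z. fst z \<bullet> snd z \<partial>ambient \<pi>opt) \<le> (\<integral>x. x \<bullet> S x \<partial>?m)"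
      by (rule global_potential_certifies[OF R(1) cX(1) ne(1) R(2) fin_m sets_ambient concX S S_in \<Phi>
            finite_measure_ambient[OF on_opt couplings_finite[OF \<pi>opt(1) fm]] sets_ambient opt_marg(1)])
         (simp add: opt_marg(2) S_\<nu>)
    let ?T = "grad (legendre R f0)"
    have Tm: "?T \<in> borel_measurable borel" by (rule measurable_grad_legendre[OF R(1) f0])
    have inner_m: "(\<lambda>z::'a \<times> 'a. fst z \<bullet> snd z) \<in> borel_measurable borel"
      by (intro borel_measurable_continuous_onI continuous_intros)
    have F: "(\<integral>z. fst z \<bullet> snd z \<partial>distr ?m borel (\<lambda>x. (x, G x))) = (\<integral>x. x \<bullet> G x \<partial>?m)"
      if "G \<in> borel_measurable borel" for G :: "'a \<Rightarrow> 'a"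
      by (subst integral_distr[OF graph_m[OF that] inner_m]) simp
    have "\<gamma> = distr ?m borel (\<lambda>x. (x, ?T x))"
    proof (rule plan_unique[OF R(1) f0 fin_m sets_ambient _ ac])
      show "AE x in ?m. x \<in> cball 0 R" by (rule AE_ambient_closed[OF mu(2) R(2)]) simp
      show "sets \<gamma> = sets borel" by (simp add: \<gamma>_def)
      show "distr \<gamma> borel fst = ?m" unfolding \<gamma>_def by (rule marg1[OF S])
      show "distr \<gamma> borel snd = distr ?m borel ?T" unfolding \<gamma>_def marg2[OF S] S_\<nu> \<pi>opt(3) ..
      show "(\<integral>x. x \<bullet> ?T x \<partial>?m) \<le> (\<integral>z. fst z \<bullet> snd z \<partial>\<gamma>)"
        using le unfolding \<pi>opt(2) F[OF Tm] \<gamma>_def F[OF S] .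
    qed
    then have "\<gamma> = ambient \<pi>opt" using \<pi>opt(2) by simp
    moreover obtain B where "\<And>z. \<bar>h z\<bar> \<le> B" using h(2) unfolding bounded_iff by auto
    ultimately show "\<exists>r. strict_mono r \<and> (\<forall>i<K. (\<lambda>n. \<integral>z. h z \<partial>ambient (\<pi> (K * s (r n) + K + i))) \<longlonglongrightarrow> (\<integral>z. h z \<partial>ambient \<pi>opt))"
      using r tend[OF h(1)] by blast
  qed
  have "weak_star_tendsto (X \<times> Y) \<pi> \<pi>opt"
    by (rule weak_star_trace)
       (use ne \<pi>c \<pi>opt(1) couplings_finite[OF _ fm] weak in \<open>auto simp: couplings_def\<close>)
  then show ?thesis using opt unfolding \<pi>_def C_def[abs_def] by blast
qed

end
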